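(* Let $H$ be an $n$-dimensional Hilbert space, let $\xi\in M_n(H)$ be a magic basis, let $A$ be the quantum permutation algebra associated to $\xi$, with fundamental magic unitary $u\in M_n(A)$, and let $G^k$ be the higher Gram matrices of $\xi$. Then for all integers $k,l\ge 0$, $$Hom(u^{\otimes k},u^{\otimes l})=\{T\in M_{n^l\times n^k}(\mathbb C)\mid T^\circ G^{k+2}=G^{l+2}T^\circ\},$$ where $T^\circ=1\otimes T\otimes 1\in M_{n^{l+2}\times n^{k+2}}(\mathbb C)$, with $1$ being the $n\times n$ identity matrix.
   Context: A magic basis of $H$ is a square matrix of vectors $\xi\in M_n(H)$ such that each row and each column is an orthogonal basis of $H$. The scalar product is linear in its first variable. The Gram matrix of $\xi$ is $G_{ia}^{jb}=\langle\xi_{ij},\xi_{ab}\rangle$, and the higher Gram matrices are the matrices $G^k\in M_{n^k}(\mathbb C)$, $k\geq 2$, given by $$G^k_{i_1\ldots i_k,j_1\ldots j_k}=G_{i_ki_{k-1}}^{j_kj_{k-1}}\cdots G_{i_2i_1}^{j_2j_1}.$$ C*-algebras and morphisms are unital. A magic unitary over a C*-algebra $A$ is a matrix $u\in M_n(A)$ of projections such that on each row and each column the entries are pairwise orthogonal and sum to $1$. For such $u$, $u^{\otimes k}=(u_{i_1j_1}\cdots u_{i_kj_k})_{i_1\ldots i_k,j_1\ldots j_k}$ is an $n^k\times n^k$ matrix over $A$ (with $u^{\otimes 0}=1$), and $Hom(u^{\otimes k},u^{\otimes l})=\{T\in M_{n^l\times n^k}(\mathbb C)\mid Tu^{\otimes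 k}=u^{\otimes l}T\}$. $A_s(n)$ is the universal C*-algebra generated by $n^2$ elements $u_{ij}$ with the relations making $(u_{ij})$ a magic unitary. A quantum permutation algebra is a C*-algebra $A$ with a magic unitary $u\in M_n(A)$ whose entries generate $A$, and such that $\Delta(u_{ij})=\sum_k u_{ik}\otimes u_{kj}$, $\varepsilon(u_{ij})=\delta_{ij}$, $S(u_{ij})=u_{ji}$ define morphisms $\Delta:A\to A\otimes A$, $\varepsilon:A\to\mathbb C$, $S:A\to A^{op}$. All quantum permutation algebras are taken full: $A$ is the enveloping C*-algebra of the $*$-algebra generated by the $u_{ij}$. Given a representation $\pi:A_s(n)\to B(H)$, its Hopf image is the smallest quantum permutation algebra $A$ (with $n\times n$ magic unitary) realizing a factorization $A_s(n)\to A\to B(H)$ of $\pi$, the first map sending generators to generators; smallest means that any other algebra realizing such a factorization maps onto $A$, generators being sent to generators. The quantum permutation algebra associated to $\xi$ is the Hopf image of $\pi:A_s(n)\to B(H)$, $\pi(u_{ij})=P_{ij}$, where $P_{ij}$ is the orthogonal projection onto $\mathbb C\xi_{ij}$.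
   Formalization: All vectors of the magic basis are assumed to have norm one; for merely orthogonal bases the claim fails (n=1, ξ=(c) with |c|≠1 and k≠l), and for n≥1 it holds for all k,l only when the vectors are unit vectors. *)

theory Defs
  imports Complex_Main "HOL-Algebra.Module"
begin

section \<open>Unital C*-algebras\<close>

record 'a cstar_alg = "(complex, 'a) module" +
  star :: "'a \<Rightarrow> 'a"
  nrm :: "'a \<Rightarrow> real"

text \<open>The complex numbers, as a commutative ring and as a C*-algebra.  The module operation of
  the record is the scalar action of the complex numbers.\<close>

definition complex_alg :: "complex cstar_alg" where
  "complex_alg = \<lparr>carrier = UNIV, mult = (*), one = 1, zero = 0, add = (+),
     smult = (*), star = cnj, nrm = cmod\<rparr>"

locale star_algebra = ring A for A :: "'a cstar_alg" (structure) +
  assumes scalar_module: "module complex_alg A"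
    and smult_mult_left: "\<lbrakk>x \<in> carrier A; y \<in> carrier A\<rbrakk> \<Longrightarrow> (c \<odot> x) \<otimes> y = c \<odot> (x \<otimes> y)"
    and smult_mult_right: "\<lbrakk>x \<in> carrier A; y \<in> carrier A\<rbrakk> \<Longrightarrow> x \<otimes> (c \<odot> y) = c \<odot> (x \<otimes> y)"
    and star_closed: "x \<in> carrier A \<Longrightarrow> star A x \<in> carrier A"
    and star_star: "x \<in> carrier A \<Longrightarrow> star A (star A x) = x"
    and star_add: "\<lbrakk>x \<in> carrier A; y \<in> carrier A\<rbrakk> \<Longrightarrow> star A (x \<oplus> y) = star A x \<oplus> star A y"
    and star_smult: "x \<in> carrier A \<Longrightarrow> star A (c \<odot> x) = cnj c \<odot> star A x"
    and star_mult: "\<lbrakk>x \<in> carrier A; y \<in> carrier A\<rbrakk> \<Longrightarrow> star A (x \<otimes> y) = star A y \<otimes> star A x"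

text \<open>The zero algebra is not excluded.\<close>

locale cstar_algebra = star_algebra +
  assumes nrm_eq_0: "x \<in> carrier A \<Longrightarrow> nrm A x = 0 \<longleftrightarrow> x = \<zero>"
    and nrm_triangle: "\<lbrakk>x \<in> carrier A; y \<in> carrier A\<rbrakk> \<Longrightarrow> nrm A (x \<oplus> y) \<le> nrm A x + nrm A y"
    and nrm_smult: "x \<in> carrier A \<Longrightarrow> nrm A (c \<odot> x) = cmod c * nrm A x"
    and nrm_mult: "\<lbrakk>x \<in> carrier A; y \<in> carrier A\<rbrakk> \<Longrightarrow> nrm A (x \<otimes> y) \<le> nrm A x * nrm A y"
    and nrm_star: "x \<in> carrier A \<Longrightarrow> nrm A (star A x \<otimes> x) = (nrm A x)\<^sup>2"
    and complete: "\<lbrakk>range X \<subseteq> carrier A;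
        \<forall>e>0. \<exists>N. \<forall>p\<ge>N. \<forall>q\<ge>N. nrm A (X p \<ominus> X q) < e\<rbrakk>
      \<Longrightarrow> \<exists>x\<in>carrier A. (\<lambda>p. nrm A (X p \<ominus> x)) \<longlonglongrightarrow> 0"

text \<open>Unital *-homomorphisms.\<close>

definition star_hom :: "'a cstar_alg \<Rightarrow> 'b cstar_alg \<Rightarrow> ('a \<Rightarrow> 'b) set" where
  "star_hom A B = {\<phi> \<in> ring_hom A B.
     (\<forall>c. \<forall>x\<in>carrier A. \<phi> (c \<odot>\<^bsub>A\<^esub> x) = c \<odot>\<^bsub>B\<^esub> \<phi> x) \<and>
     (\<forall>x\<in>carrier A. \<phi> (star A x) = star B (\<phi> x))}"

definition star_subalgebra :: "'a cstar_alg \<Rightarrow> 'a set \<Rightarrow> bool" where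
  "star_subalgebra A B \<longleftrightarrow> B \<subseteq> carrier A \<and> \<one>\<^bsub>A\<^esub> \<in> B \<and>
     (\<forall>x\<in>B. \<forall>y\<in>B. x \<oplus>\<^bsub>A\<^esub> y \<in> B \<and> x \<otimes>\<^bsub>A\<^esub> y \<in> B) \<and>
     (\<forall>c. \<forall>x\<in>B. c \<odot>\<^bsub>A\<^esub> x \<in> B) \<and> (\<forall>x\<in>B. star A x \<in> B)"

definition cstar_subalgebra :: "'a cstar_alg \<Rightarrow> 'a set \<Rightarrow> bool" where
  "cstar_subalgebra A B \<longleftrightarrow> star_subalgebra A B \<and>
     (\<forall>X. \<forall>x\<in>carrier A. range X \<subseteq> B \<and> (\<lambda>p. nrm A (X p \<ominus>\<^bsub>A\<^esub> x)) \<longlonglongrightarrow> 0 \<longrightarrow> x \<in> B)"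

definition star_gen :: "'a cstar_alg \<Rightarrow> 'a set \<Rightarrow> 'a set" where
  "star_gen A X = \<Inter>{B. star_subalgebra A B \<and> X \<subseteq> B}"

definition cstar_gen :: "'a cstar_alg \<Rightarrow> 'a set \<Rightarrow> 'a set" where
  "cstar_gen A X = \<Inter>{B. cstar_subalgebra A B \<and> X \<subseteq> B}"

text \<open>HOL cannot quantify over types inside a formula, so the "for all C*-algebras" and "there is a
  C*-algebra" of the definitions below range over the C*-algebras whose carrier is a subset of the
  following type, which has the cardinality of the continuum.  Nothing is lost: each of these
  quantifiers concerns only C*-algebras generated by the image of a finite set (after replacing the
  target of a homomorphism by the closed subalgebra generated by that image), and such an algebra is
  separable, hence isomorphic to one carried by a subset of this type.\<close>

type_synonym univ = "nat \<Rightarrow> complex"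

definition opposite :: "'a cstar_alg \<Rightarrow> 'a cstar_alg" where
  "opposite A = A\<lparr>mult := \<lambda>x y. y \<otimes>\<^bsub>A\<^esub> x\<rparr>"

text \<open>\<open>C\<close>, with the embeddings \<open>\<iota> a = a \<otimes> 1\<close> and \<open>\<kappa> b = 1 \<otimes> b\<close>, is the (maximal) C*-tensor product
  of \<open>A\<close> and \<open>B\<close>.  For full quantum permutation algebras the choice of the tensor norm is
  immaterial: a comultiplication into any other C*-completion of the algebraic tensor product maps
  the dense *-algebra generated by the entries of the magic unitary into the algebraic tensor
  product, hence extends to the full algebra with values in the maximal completion.\<close>

definition is_tensor_product ::
  "'a cstar_alg \<Rightarrow> 'b cstar_alg \<Rightarrow> 'c cstar_alg \<Rightarrow> ('a \<Rightarrow> 'c) \<Rightarrow> ('b \<Rightarrow> 'c) \<Rightarrow> bool" where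
  "is_tensor_product A B C \<iota> \<kappa> \<longleftrightarrow>
     cstar_algebra C \<and> \<iota> \<in> star_hom A C \<and> \<kappa> \<in> star_hom B C \<and>
     (\<forall>a\<in>carrier A. \<forall>b\<in>carrier B. \<iota> a \<otimes>\<^bsub>C\<^esub> \<kappa> b = \<kappa> b \<otimes>\<^bsub>C\<^esub> \<iota> a) \<and>
     cstar_gen C (\<iota> ` carrier A \<union> \<kappa> ` carrier B) = carrier C \<and>
     (\<forall>(D :: univ cstar_alg) \<phi> \<psi>.
        cstar_algebra D \<and> \<phi> \<in> star_hom A D \<and> \<psi> \<in> star_hom B D \<and>
        (\<forall>a\<in>carrier A. \<forall>b\<in>carrier B. \<phi> a \<otimes>\<^bsub>D\<^esub> \<psi> b = \<psi> b \<otimes>\<^bsub>D\<^esub> \<phi> a) \<longrightarrow>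
        (\<exists>\<theta>\<in>star_hom C D. (\<forall>a\<in>carrier A. \<theta> (\<iota> a) = \<phi> a) \<and> (\<forall>b\<in>carrier B. \<theta> (\<kappa> b) = \<psi> b)))"

text \<open>\<open>A\<close>, with the canonical map \<open>j\<close>, is the enveloping C*-algebra of the *-algebra \<open>R\<close>; the norm
  field of \<open>R\<close> plays no role.\<close>

definition is_enveloping :: "'r cstar_alg \<Rightarrow> 'a cstar_alg \<Rightarrow> ('r \<Rightarrow> 'a) \<Rightarrow> bool" where
  "is_enveloping R A j \<longleftrightarrow>
     star_algebra R \<and> cstar_algebra A \<and> j \<in> star_hom R A \<and>
     cstar_gen A (j ` carrier R) = carrier A \<and>
     (\<forall>(B :: univ cstar_alg) \<phi>. cstar_algebra B \<and> \<phi> \<in> star_hom R B \<longrightarrow>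
        (\<exists>\<psi>\<in>star_hom A B. \<forall>x\<in>carrier R. \<psi> (j x) = \<phi> x))"


section \<open>Magic unitaries and quantum permutation algebras\<close>

text \<open>An \<open>n \<times> n\<close> matrix is a function of two indices, of which only the values at indices \<open>< n\<close>
  matter.\<close>

definition entries :: "nat \<Rightarrow> (nat \<Rightarrow> nat \<Rightarrow> 'a) \<Rightarrow> 'a set" where
  "entries n u = {u i j |i j. i < n \<and> j < n}"

definition magic_unitary :: "'a cstar_alg \<Rightarrow> nat \<Rightarrow> (nat \<Rightarrow> nat \<Rightarrow> 'a) \<Rightarrow> bool" where
  "magic_unitary A n u \<longleftrightarrow>
     (\<forall>i<n. \<forall>j<n. u i j \<in> carrier A \<and> star A (u i j) = u i j \<and> u i j \<otimes>\<^bsub>A\<^esub> u i j = u i j) \<and>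
     (\<forall>i<n. \<forall>j<n. \<forall>k<n. j \<noteq> k \<longrightarrow> u i j \<otimes>\<^bsub>A\<^esub> u i k = \<zero>\<^bsub>A\<^esub>) \<and>
     (\<forall>i<n. \<forall>j<n. \<forall>k<n. j \<noteq> k \<longrightarrow> u j i \<otimes>\<^bsub>A\<^esub> u k i = \<zero>\<^bsub>A\<^esub>) \<and>
     (\<forall>i<n. (\<Oplus>\<^bsub>A\<^esub>j\<in>{..<n}. u i j) = \<one>\<^bsub>A\<^esub>) \<and>
     (\<forall>j<n. (\<Oplus>\<^bsub>A\<^esub>i\<in>{..<n}. u i j) = \<one>\<^bsub>A\<^esub>)"

text \<open>\<open>S\<close>, with generators \<open>s\<close>, is the universal algebra \<open>A\<^sub>s(n)\<close>.\<close>

definition is_universal_magic :: "nat \<Rightarrow> 's cstar_alg \<Rightarrow> (nat \<Rightarrow> nat \<Rightarrow> 's) \<Rightarrow> bool" where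
  "is_universal_magic n S s \<longleftrightarrow>
     cstar_algebra S \<and> magic_unitary S n s \<and> cstar_gen S (entries n s) = carrier S \<and>
     (\<forall>(B :: univ cstar_alg) v. cstar_algebra B \<and> magic_unitary B n v \<longrightarrow>
        (\<exists>\<phi>\<in>star_hom S B. \<forall>i<n. \<forall>j<n. \<phi> (s i j) = v i j))"

definition quantum_permutation_algebra ::
  "nat \<Rightarrow> 'a cstar_alg \<Rightarrow> (nat \<Rightarrow> nat \<Rightarrow> 'a) \<Rightarrow> bool" where
  "quantum_permutation_algebra n A u \<longleftrightarrow>
     cstar_algebra A \<and> magic_unitary A n u \<and> cstar_gen A (entries n u) = carrier A \<and>
     (\<exists>(C :: univ cstar_alg) \<iota> \<kappa>. is_tensor_product A A C \<iota> \<kappa> \<and>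
        (\<exists>\<Delta>\<in>star_hom A C. \<forall>i<n. \<forall>j<n. \<Delta> (u i j) = (\<Oplus>\<^bsub>C\<^esub>k\<in>{..<n}. \<iota> (u i k) \<otimes>\<^bsub>C\<^esub> \<kappa> (u k j)))) \<and>
     (\<exists>\<epsilon>\<in>star_hom A complex_alg. \<forall>i<n. \<forall>j<n. \<epsilon> (u i j) = (if i = j then 1 else 0)) \<and>
     (\<exists>\<sigma>\<in>star_hom A (opposite A). \<forall>i<n. \<forall>j<n. \<sigma> (u i j) = u j i) \<and>
     is_enveloping (A\<lparr>carrier := star_gen A (entries n u)\<rparr>) A (\<lambda>x. x)"

text \<open>The morphism \<open>\<pi> : S \<rightarrow> B\<close> factors as \<open>S \<rightarrow> A \<rightarrow> B\<close>, the first map sending generators to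
  generators.\<close>

definition factors_through ::
  "nat \<Rightarrow> 's cstar_alg \<Rightarrow> (nat \<Rightarrow> nat \<Rightarrow> 's) \<Rightarrow> 'b cstar_alg \<Rightarrow> ('s \<Rightarrow> 'b) \<Rightarrow>
   'a cstar_alg \<Rightarrow> (nat \<Rightarrow> nat \<Rightarrow> 'a) \<Rightarrow> bool" where
  "factors_through n S s B \<pi> A u \<longleftrightarrow>
     (\<exists>\<phi>\<in>star_hom S A. \<exists>\<rho>\<in>star_hom A B.
        (\<forall>i<n. \<forall>j<n. \<phi> (s i j) = u i j) \<and> (\<forall>x\<in>carrier S. \<rho> (\<phi> x) = \<pi> x))"

definition is_hopf_image ::
  "nat \<Rightarrow> 's cstar_alg \<Rightarrow> (nat \<Rightarrow> nat \<Rightarrow> 's) \<Rightarrow> 'b cstar_alg \<Rightarrow> ('s \<Rightarrow> 'b) \<Rightarrow>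
   'a cstar_alg \<Rightarrow> (nat \<Rightarrow> nat \<Rightarrow> 'a) \<Rightarrow> bool" where
  "is_hopf_image n S s B \<pi> A u \<longleftrightarrow>
     quantum_permutation_algebra n A u \<and> factors_through n S s B \<pi> A u \<and>
     (\<forall>(A' :: univ cstar_alg) u'.
        quantum_permutation_algebra n A' u' \<and> factors_through n S s B \<pi> A' u' \<longrightarrow>
        (\<exists>\<theta>\<in>star_hom A' A. \<theta> ` carrier A' = carrier A \<and> (\<forall>i<n. \<forall>j<n. \<theta> (u' i j) = u i j)))"


section \<open>Matrices indexed by multi-indices, and intertwiners\<close>

text \<open>A multi-index \<open>i\<^sub>1 \<dots> i\<^sub>k\<close> is a list of length \<open>k\<close>, and an \<open>n\<^sup>l \<times> n\<^sup>k\<close> matrix is a function of a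
  row index in \<open>idx n l\<close> and a column index in \<open>idx n k\<close>.\<close>

definition idx :: "nat \<Rightarrow> nat \<Rightarrow> nat list set" where
  "idx n k = {is. length is = k \<and> set is \<subseteq> {..<n}}"

type_synonym multimat = "nat list \<Rightarrow> nat list \<Rightarrow> complex"

text \<open>\<open>M\<^bsub>n\<^sup>l \<times> n\<^sup>k\<^esub>(\<complex>)\<close>; entries outside the index range are set to zero, so that distinct
  functions are distinct matrices.\<close>

definition mats :: "nat \<Rightarrow> nat \<Rightarrow> nat \<Rightarrow> multimat set" where
  "mats n l k = {T. \<forall>a b. a \<notin> idx n l \<or> b \<notin> idx n k \<longrightarrow> T a b = 0}"

text \<open>Equality of two \<open>n\<^sup>l \<times> n\<^sup>k\<close> matrices, and product of matrices with inner dimension \<open>n\<^sup>m\<close>.\<close>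

definition mat_eq :: "nat \<Rightarrow> nat \<Rightarrow> nat \<Rightarrow> multimat \<Rightarrow> multimat \<Rightarrow> bool" where
  "mat_eq n l k M N \<longleftrightarrow> (\<forall>a\<in>idx n l. \<forall>b\<in>idx n k. M a b = N a b)"

definition mat_mult :: "nat \<Rightarrow> nat \<Rightarrow> multimat \<Rightarrow> multimat \<Rightarrow> multimat" where
  "mat_mult n m M N = (\<lambda>a b. \<Sum>c\<in>idx n m. M a c * N c b)"

definition mat_id :: multimat where
  "mat_id = (\<lambda>a b. if a = b then 1 else 0)"

text \<open>\<open>M \<otimes> N\<close> for \<open>M\<close> of size \<open>n\<^sup>l \<times> n\<^sup>k\<close>.\<close>

definition mat_tensor :: "nat \<Rightarrow> nat \<Rightarrow> multimat \<Rightarrow> multimat \<Rightarrow> multimat" where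
  "mat_tensor l k M N = (\<lambda>a b. M (take l a) (take k b) * N (drop l a) (drop k b))"

text \<open>\<open>T\<^sup>\<circ> = 1 \<otimes> T \<otimes> 1\<close> for \<open>T\<close> of size \<open>n\<^sup>l \<times> n\<^sup>k\<close>.\<close>

definition circ :: "nat \<Rightarrow> nat \<Rightarrow> multimat \<Rightarrow> multimat" where
  "circ l k T = mat_tensor 1 1 mat_id (mat_tensor l k T mat_id)"

text \<open>The entry \<open>u\<^bsub>i\<^sub>1j\<^sub>1\<^esub> \<dots> u\<^bsub>i\<^sub>kj\<^sub>k\<^esub>\<close> of the \<open>k\<close>-th tensor power of \<open>u\<close>.\<close>

definition tensor_power :: "'a cstar_alg \<Rightarrow> (nat \<Rightarrow> nat \<Rightarrow> 'a) \<Rightarrow> nat list \<Rightarrow> nat list \<Rightarrow> 'a" where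
  "tensor_power A u is js = foldr (\<lambda>(i, j) x. u i j \<otimes>\<^bsub>A\<^esub> x) (zip is js) \<one>\<^bsub>A\<^esub>"

definition Hom :: "'a cstar_alg \<Rightarrow> nat \<Rightarrow> (nat \<Rightarrow> nat \<Rightarrow> 'a) \<Rightarrow> nat \<Rightarrow> nat \<Rightarrow> multimat set" where
  "Hom A n u k l = {T \<in> mats n l k. \<forall>a\<in>idx n l. \<forall>b\<in>idx n k.
     (\<Oplus>\<^bsub>A\<^esub>c\<in>idx n k. T a c \<odot>\<^bsub>A\<^esub> tensor_power A u c b) =
     (\<Oplus>\<^bsub>A\<^esub>c\<in>idx n l. T c b \<odot>\<^bsub>A\<^esub> tensor_power A u a c)}"


section \<open>Hilbert spaces and magic bases\<close>

text \<open>A Hilbert space is a type with a scalar multiplication and a scalar product, linear in its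
  first variable.\<close>

definition hnorm :: "('h \<Rightarrow> 'h \<Rightarrow> complex) \<Rightarrow> 'h \<Rightarrow> real" where
  "hnorm ip x = sqrt (Re (ip x x))"

locale hilbert_space = vector_space scale
  for scale :: "complex \<Rightarrow> 'h::ab_group_add \<Rightarrow> 'h" +
  fixes ip :: "'h \<Rightarrow> 'h \<Rightarrow> complex"
  assumes ip_add_left: "ip (x + y) z = ip x z + ip y z"
    and ip_scale_left: "ip (scale c x) y = c * ip x y"
    and ip_cnj: "ip y x = cnj (ip x y)"
    and ip_pos: "x \<noteq> 0 \<Longrightarrow> Re (ip x x) > 0"
    and ip_complete: "\<forall>e>0. \<exists>N. \<forall>p\<ge>N. \<forall>q\<ge>N. hnorm ip (X p - X q) < e
      \<Longrightarrow> \<exists>x. (\<lambda>p. hnorm ip (X p - x)) \<longlonglongrightarrow> 0"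

definition has_dimension :: "(complex \<Rightarrow> 'h::ab_group_add \<Rightarrow> 'h) \<Rightarrow> nat \<Rightarrow> bool" where
  "has_dimension scale n \<longleftrightarrow> (\<exists>B. finite_dimensional_vector_space scale B \<and> card B = n)"

text \<open>The C*-algebra \<open>B(H)\<close> of bounded operators, with the adjoint and the operator norm.\<close>

definition bounded_ops :: "(complex \<Rightarrow> 'h::ab_group_add \<Rightarrow> 'h) \<Rightarrow> ('h \<Rightarrow> 'h \<Rightarrow> complex) \<Rightarrow>
    ('h \<Rightarrow> 'h) cstar_alg" where
  "bounded_ops scale ip =
    \<lparr>carrier = {T. Vector_Spaces.linear scale scale T \<and> (\<exists>c. \<forall>x. hnorm ip (T x) \<le> c * hnorm ip x)},
     mult = (\<lambda>S T. S \<circ> T), one = id, zero = (\<lambda>x. 0), add = (\<lambda>S T x. S x + T x),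
     smult = (\<lambda>c T x. scale c (T x)),
     star = (\<lambda>T. THE S. \<forall>x y. ip (T x) y = ip x (S y)),
     nrm = (\<lambda>T. SUP x\<in>{x. hnorm ip x \<le> 1}. hnorm ip (T x))\<rparr>"

definition orthogonal_projection :: "('h::ab_group_add \<Rightarrow> 'h \<Rightarrow> complex) \<Rightarrow> 'h set \<Rightarrow> 'h \<Rightarrow> 'h" where
  "orthogonal_projection ip W x = (THE y. y \<in> W \<and> (\<forall>w\<in>W. ip (x - y) w = 0))"

definition orthogonal_basis :: "(complex \<Rightarrow> 'h::ab_group_add \<Rightarrow> 'h) \<Rightarrow> ('h \<Rightarrow> 'h \<Rightarrow> complex) \<Rightarrow>
    nat \<Rightarrow> (nat \<Rightarrow> 'h) \<Rightarrow> bool" where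
  "orthogonal_basis scale ip n e \<longleftrightarrow>
     inj_on e {..<n} \<and> \<not> module.dependent scale (e ` {..<n}) \<and>
     module.span scale (e ` {..<n}) = UNIV \<and>
     (\<forall>i<n. \<forall>j<n. i \<noteq> j \<longrightarrow> ip (e i) (e j) = 0)"

text \<open>The vectors of a magic basis are not required to be of norm one here; normalisation is a separate
  hypothesis where the unnormalised Gram matrix is used.\<close>

definition magic_basis :: "(complex \<Rightarrow> 'h::ab_group_add \<Rightarrow> 'h) \<Rightarrow> ('h \<Rightarrow> 'h \<Rightarrow> complex) \<Rightarrow>
    nat \<Rightarrow> (nat \<Rightarrow> nat \<Rightarrow> 'h) \<Rightarrow> bool" where
  "magic_basis scale ip n \<xi> \<longleftrightarrow>
     (\<forall>i<n. orthogonal_basis scale ip n (\<lambda>j. \<xi> i j)) \<and>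
     (\<forall>j<n. orthogonal_basis scale ip n (\<lambda>i. \<xi> i j))"

text \<open>\<open>gram ip \<xi> i a j b\<close> has lower indices \<open>i a\<close> and upper indices \<open>j b\<close>.\<close>

definition gram :: "('h \<Rightarrow> 'h \<Rightarrow> complex) \<Rightarrow> (nat \<Rightarrow> nat \<Rightarrow> 'h) \<Rightarrow>
    nat \<Rightarrow> nat \<Rightarrow> nat \<Rightarrow> nat \<Rightarrow> complex" where
  "gram ip \<xi> i a j b = ip (\<xi> i j) (\<xi> a b)"

text \<open>With the list entries numbered from 0, the factor for \<open>s\<close> is the one with lower indices
  \<open>i\<^bsub>s+2\<^esub> i\<^bsub>s+1\<^esub>\<close> in the usual numbering.\<close>

definition higher_gram :: "('h \<Rightarrow> 'h \<Rightarrow> complex) \<Rightarrow> (nat \<Rightarrow> nat \<Rightarrow> 'h) \<Rightarrow> nat \<Rightarrow> multimat" where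
  "higher_gram ip \<xi> k = (\<lambda>is js. \<Prod>s<k - 1.
     gram ip \<xi> (is ! Suc s) (is ! s) (js ! Suc s) (js ! s))"

end

theory Submission
  imports Defs "HOL-Library.Countable_Set"
begin

text \<open>No Tannakian duality is needed.  Given an intertwiner \<open>T\<close> of the magic unitary \<open>P = (\<pi> (s i j))\<close>, let
  \<open>U\<close> be the universal C*-algebra generated by the entries of a magic unitary \<open>w\<close> subject to the
  single further relation \<open>T w\<^sup>\<otimes>\<^sup>k = w\<^sup>\<otimes>\<^sup>l T\<close>.  This relation is compatible with comultiplication, counit
  and antipode (the latter because the tensor powers of \<open>w\<close> are unitary), so \<open>U\<close> is a quantum
  permutation algebra through which \<open>\<pi>\<close> factors.  The Hopf image is therefore a quotient of \<open>U\<close>, and the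
  relation holds in it.  Hence \<open>u\<close> and \<open>P\<close> have the same intertwiners.  Since \<open>P i j\<close> has rank one, the
  matrix coefficients of \<open>P\<^sup>\<otimes>\<^sup>k\<close> between the vectors \<open>\<xi> p q\<close> and \<open>\<xi> r s\<close> are the entries of the Gram matrix of
  order \<open>k + 2\<close>, which turns the intertwining relation for \<open>P\<close> into the one for \<open>1 \<otimes> T \<otimes> 1\<close>.\<close>

section \<open>Algebra and analysis in C*-algebras\<close>

text \<open>The weight lies in constructing \<open>U\<close>. The minimality clause of
  \<open>is_hopf_image\<close> only tests algebras carried by \<open>univ\<close>, so
  \<open>U\<close> must live there. The models of the relations on \<open>univ\<close> form a set,
  and their bounded product is a C*-algebra. Entries of magic unitaries are projections, of norm at
  most one, so the diagonal families of generators are bounded; the closed subalgebra that they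
  generate is countably generated, and its elements can be coded by sequences. The tensor square
  demanded of a quantum permutation algebra comes from the same construction. That homomorphisms are
  determined on generators rests on their continuity. Contractivity is derived from the C*-identity
  through a square root found by fixed-point iteration, which avoids spectral theory. Treating one
  \<open>T\<close> at a time costs nothing: the Hopf image is a quotient of the algebra
  \<open>U\<close> of every \<open>T\<close> intertwining \<open>P\<close>, so all these relations
  accumulate in it. In the final translation one row of \<xi> is already an orthonormal basis and
  determines an operator, while the Gram matrices record coefficients on all rows.\<close>

lemma cring_complex_alg: "cring complex_alg"
proof (rule cringI)
  show "abelian_group complex_alg"
  proof (rule abelian_groupI)
    fix x :: complex
    show "\<exists>y\<in>carrier complex_alg. y \<oplus>\<^bsub>complex_alg\<^esub> x = \<zero>\<^bsub>complex_alg\<^esub>"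
      by (rule bexI[of _ "- x"]) (auto simp: complex_alg_def)
  qed (auto simp: complex_alg_def)
  show "comm_monoid complex_alg"
    by (rule comm_monoidI) (auto simp: complex_alg_def)
qed (auto simp: complex_alg_def algebra_simps)

text \<open>The additive inverse comes from the scalar \<open>- 1\<close>, which leaves only
  equations and closure conditions to check.\<close>

lemma star_algebraI:
  fixes A :: "'a cstar_alg" (structure)
  assumes closed: "\<zero> \<in> carrier A" "\<one> \<in> carrier A"
      "\<And>x y. x \<in> carrier A \<Longrightarrow> y \<in> carrier A \<Longrightarrow> x \<oplus> y \<in> carrier A"
      "\<And>x y. x \<in> carrier A \<Longrightarrow> y \<in> carrier A \<Longrightarrow> x \<otimes> y \<in> carrier A"
      "\<And>c x. x \<in> carrier A \<Longrightarrow> c \<odot> x \<in> carrier A"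
      "\<And>x. x \<in> carrier A \<Longrightarrow> star A x \<in> carrier A"
    and add: "\<And>x y z. x \<in> carrier A \<Longrightarrow> y \<in> carrier A \<Longrightarrow> z \<in> carrier A \<Longrightarrow> (x \<oplus> y) \<oplus> z = x \<oplus> (y \<oplus> z)"
      "\<And>x y. x \<in> carrier A \<Longrightarrow> y \<in> carrier A \<Longrightarrow> x \<oplus> y = y \<oplus> x"
      "\<And>x. x \<in> carrier A \<Longrightarrow> \<zero> \<oplus> x = x"
      "\<And>x. x \<in> carrier A \<Longrightarrow> (- 1) \<odot> x \<oplus> x = \<zero>"
    and mult: "\<And>x y z. x \<in> carrier A \<Longrightarrow> y \<in> carrier A \<Longrightarrow> z \<in> carrier A \<Longrightarrow> (x \<otimes> y) \<otimes> z = x \<otimes> (y \<otimes> z)"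
      "\<And>x. x \<in> carrier A \<Longrightarrow> \<one> \<otimes> x = x"
      "\<And>x. x \<in> carrier A \<Longrightarrow> x \<otimes> \<one> = x"
      "\<And>x y z. x \<in> carrier A \<Longrightarrow> y \<in> carrier A \<Longrightarrow> z \<in> carrier A \<Longrightarrow> (x \<oplus> y) \<otimes> z = x \<otimes> z \<oplus> y \<otimes> z"
      "\<And>x y z. x \<in> carrier A \<Longrightarrow> y \<in> carrier A \<Longrightarrow> z \<in> carrier A \<Longrightarrow> z \<otimes> (x \<oplus> y) = z \<otimes> x \<oplus> z \<otimes> y"
    and smult: "\<And>c d x. x \<in> carrier A \<Longrightarrow> (c + d) \<odot> x = c \<odot> x \<oplus> d \<odot> x"
      "\<And>c x y. x \<in> carrier A \<Longrightarrow> y \<in> carrier A \<Longrightarrow> c \<odot> (x \<oplus> y) = c \<odot> x \<oplus> c \<odot> y"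
      "\<And>c d x. x \<in> carrier A \<Longrightarrow> (c * d) \<odot> x = c \<odot> (d \<odot> x)"
      "\<And>x. x \<in> carrier A \<Longrightarrow> 1 \<odot> x = x"
      "\<And>c x y. x \<in> carrier A \<Longrightarrow> y \<in> carrier A \<Longrightarrow> (c \<odot> x) \<otimes> y = c \<odot> (x \<otimes> y)"
      "\<And>c x y. x \<in> carrier A \<Longrightarrow> y \<in> carrier A \<Longrightarrow> x \<otimes> (c \<odot> y) = c \<odot> (x \<otimes> y)"
    and star: "\<And>x. x \<in> carrier A \<Longrightarrow> star A (star A x) = x"
      "\<And>x y. x \<in> carrier A \<Longrightarrow> y \<in> carrier A \<Longrightarrow> star A (x \<oplus> y) = star A x \<oplus> star A y"
      "\<And>c x. x \<in> carrier A \<Longrightarrow> star A (c \<odot> x) = cnj c \<odot> star A x"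
      "\<And>x y. x \<in> carrier A \<Longrightarrow> y \<in> carrier A \<Longrightarrow> star A (x \<otimes> y) = star A y \<otimes> star A x"
  shows "star_algebra A"
proof -
  have ab: "abelian_group A"
  proof (rule abelian_groupI)
    show "\<exists>y\<in>carrier A. y \<oplus> x = \<zero>" if "x \<in> carrier A" for x
      using add(4)[OF that] closed(5)[OF that] by blast
  qed (fact closed add)+
  have ring: "ring A"
    by (rule ringI[OF ab]) (intro monoidI, (fact closed mult)+)
  have module: "module complex_alg A"
    by (rule moduleI[OF cring_complex_alg ab])
      (simp_all add: complex_alg_def closed smult)
  show ?thesis
    by (intro star_algebra.intro star_algebra_axioms.intro) (fact ring module closed smult star)+
qed

context star_algebra
begin

lemma smult_closed [simp, intro]: "x \<in> carrier A \<Longrightarrow> c \<odot> x \<in> carrier A"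
  using module.smult_closed[OF scalar_module] by (auto simp: complex_alg_def)

lemma smult_add_left: "x \<in> carrier A \<Longrightarrow> (c + d) \<odot> x = c \<odot> x \<oplus> d \<odot> x"
  using module.smult_l_distr[OF scalar_module] by (auto simp: complex_alg_def)

lemma smult_add_right: "\<lbrakk>x \<in> carrier A; y \<in> carrier A\<rbrakk> \<Longrightarrow> c \<odot> (x \<oplus> y) = c \<odot> x \<oplus> c \<odot> y"
  using module.smult_r_distr[OF scalar_module] by (auto simp: complex_alg_def)

lemma smult_smult: "x \<in> carrier A \<Longrightarrow> c \<odot> (d \<odot> x) = (c * d) \<odot> x"
  using module.smult_assoc1[OF scalar_module] by (auto simp: complex_alg_def)

lemma smult_one [simp]: "x \<in> carrier A \<Longrightarrow> 1 \<odot> x = x"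
  using module.smult_one[OF scalar_module] by (auto simp: complex_alg_def)

lemma smult_zero_left [simp]: "x \<in> carrier A \<Longrightarrow> 0 \<odot> x = \<zero>"
  using smult_add_left[of x 0 0] add.l_cancel_one[of "0 \<odot> x" "0 \<odot> x"] by simp

lemma smult_zero_right [simp]: "c \<odot> \<zero> = \<zero>"
  using smult_add_right[of \<zero> \<zero> c] add.l_cancel_one[of "c \<odot> \<zero>" "c \<odot> \<zero>"] by simp

lemma a_inv_eq_smult: "x \<in> carrier A \<Longrightarrow> \<ominus> x = (- 1) \<odot> x"
  using smult_add_left[of x "- 1" 1] by (intro minus_equality) auto

lemma minus_eq_smult: "y \<in> carrier A \<Longrightarrow> x \<ominus> y = x \<oplus> (- 1) \<odot> y"
  by (simp add: a_minus_def a_inv_eq_smult)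

lemma minus_self [simp]: "x \<in> carrier A \<Longrightarrow> x \<ominus> x = \<zero>"
  by (simp add: a_minus_def r_neg)

lemma smult_minus_right:
  "\<lbrakk>x \<in> carrier A; y \<in> carrier A\<rbrakk> \<Longrightarrow> c \<odot> (x \<ominus> y) = c \<odot> x \<ominus> c \<odot> y"
  by (simp add: minus_eq_smult smult_add_right smult_smult mult.commute)

lemma minus_eq_zeroD: "\<lbrakk>x \<in> carrier A; y \<in> carrier A; x \<ominus> y = \<zero>\<rbrakk> \<Longrightarrow> x = y"
  using minus_equality[of x "\<ominus> y"] by (simp add: a_minus_def)

declare star_closed [simp, intro] star_star [simp]

lemma star_zero [simp]: "star A \<zero> = \<zero>"
  using star_smult[of \<zero> 0] by simp

lemma star_one [simp]: "star A \<one> = \<one>"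
proof -
  have "star A \<one> = star A \<one> \<otimes> star A (star A \<one>)" by simp
  also have "\<dots> = star A (star A \<one> \<otimes> \<one>)" by (subst star_mult) auto
  also have "\<dots> = \<one>" by simp
  finally show ?thesis .
qed

lemma star_minus:
  "\<lbrakk>x \<in> carrier A; y \<in> carrier A\<rbrakk> \<Longrightarrow> star A (x \<ominus> y) = star A x \<ominus> star A y"
  by (simp add: minus_eq_smult star_add star_smult)

lemma finsum_smult:
  "finite I \<Longrightarrow> f \<in> I \<rightarrow> carrier A \<Longrightarrow> c \<odot> (\<Oplus>i\<in>I. f i) = (\<Oplus>i\<in>I. c \<odot> f i)"
  by (induction set: finite) (auto simp: smult_add_right Pi_def)

lemma finsum_star:
  "finite I \<Longrightarrow> f \<in> I \<rightarrow> carrier A \<Longrightarrow> star A (\<Oplus>i\<in>I. f i) = (\<Oplus>i\<in>I. star A (f i))"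
  by (induction set: finite) (auto simp: star_add Pi_def)

end

section \<open>Finite sums in abelian monoids\<close>

lemma (in abelian_monoid) finsum_swap:
  assumes "finite I" "finite J" "\<And>i j. i \<in> I \<Longrightarrow> j \<in> J \<Longrightarrow> f i j \<in> carrier G"
  shows "(\<Oplus>i\<in>I. \<Oplus>j\<in>J. f i j) = (\<Oplus>j\<in>J. \<Oplus>i\<in>I. f i j)"
  using assms(1,3)
proof (induction set: finite)
  case (insert a I)
  have "(\<Oplus>j\<in>J. \<Oplus>i\<in>insert a I. f i j) = (\<Oplus>j\<in>J. f a j \<oplus> (\<Oplus>i\<in>I. f i j))"
    using insert assms(2) by (intro finsum_cong') (auto simp: Pi_def)
  also have "\<dots> = (\<Oplus>j\<in>J. f a j) \<oplus> (\<Oplus>j\<in>J. \<Oplus>i\<in>I. f i j)"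
    using insert assms(2) by (intro finsum_addf) (auto simp: Pi_def)
  finally show ?case
    using insert assms(2) by (simp add: Pi_def)
qed simp

lemma (in abelian_monoid) finsum_delta:
  assumes "finite I" "a \<in> I" "f a \<in> carrier G"
  shows "(\<Oplus>i\<in>I. if i = a then f i else \<zero>) = f a"
proof -
  have "(\<Oplus>i\<in>I. if i = a then f i else \<zero>) = (\<Oplus>i\<in>I. if a = i then f a else \<zero>)"
    using assms by (intro finsum_cong') auto
  also have "\<dots> = f a"
    using add.finprod_singleton[of a I "\<lambda>_. f a"] assms by auto
  finally show ?thesis .
qed

subsection \<open>Homomorphisms\<close>

lemma star_homI:
  assumes "\<And>x. x \<in> carrier A \<Longrightarrow> \<phi> x \<in> carrier B"
    and "\<And>x y. x \<in> carrier A \<Longrightarrow> y \<in> carrier A \<Longrightarrow> \<phi> (x \<otimes>\<^bsub>A\<^esub> y) = \<phi> x \<otimes>\<^bsub>B\<^esub> \<phi> y"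
    and "\<And>x y. x \<in> carrier A \<Longrightarrow> y \<in> carrier A \<Longrightarrow> \<phi> (x \<oplus>\<^bsub>A\<^esub> y) = \<phi> x \<oplus>\<^bsub>B\<^esub> \<phi> y"
    and "\<phi> \<one>\<^bsub>A\<^esub> = \<one>\<^bsub>B\<^esub>"
    and "\<And>c x. x \<in> carrier A \<Longrightarrow> \<phi> (c \<odot>\<^bsub>A\<^esub> x) = c \<odot>\<^bsub>B\<^esub> \<phi> x"
    and "\<And>x. x \<in> carrier A \<Longrightarrow> \<phi> (star A x) = star B (\<phi> x)"
  shows "\<phi> \<in> star_hom A B"
  using assms unfolding star_hom_def by (auto intro!: ring_hom_memI)

lemma star_homD:
  assumes "\<phi> \<in> star_hom A B"
  shows "\<And>x. x \<in> carrier A \<Longrightarrow> \<phi> x \<in> carrier B"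
    and "\<And>x y. x \<in> carrier A \<Longrightarrow> y \<in> carrier A \<Longrightarrow> \<phi> (x \<otimes>\<^bsub>A\<^esub> y) = \<phi> x \<otimes>\<^bsub>B\<^esub> \<phi> y"
    and "\<And>x y. x \<in> carrier A \<Longrightarrow> y \<in> carrier A \<Longrightarrow> \<phi> (x \<oplus>\<^bsub>A\<^esub> y) = \<phi> x \<oplus>\<^bsub>B\<^esub> \<phi> y"
    and "\<phi> \<one>\<^bsub>A\<^esub> = \<one>\<^bsub>B\<^esub>"
    and "\<And>c x. x \<in> carrier A \<Longrightarrow> \<phi> (c \<odot>\<^bsub>A\<^esub> x) = c \<odot>\<^bsub>B\<^esub> \<phi> x"
    and "\<And>x. x \<in> carrier A \<Longrightarrow> \<phi> (star A x) = star B (\<phi> x)"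
  using assms unfolding star_hom_def
  by (auto simp: ring_hom_closed ring_hom_mult ring_hom_add ring_hom_one)

lemma star_hom_comp:
  assumes "\<phi> \<in> star_hom A B" "\<psi> \<in> star_hom B C"
  shows "(\<lambda>x. \<psi> (\<phi> x)) \<in> star_hom A C"
  using assms by (intro star_homI) (simp_all add: star_homD)

locale star_algebra_hom = A: star_algebra A + B: star_algebra B
  for A :: "'a cstar_alg" and B :: "'b cstar_alg" +
  fixes \<phi> :: "'a \<Rightarrow> 'b"
  assumes hom: "\<phi> \<in> star_hom A B"
begin

lemmas hom_closed [simp, intro] = star_homD(1)[OF hom]
  and hom_mult = star_homD(2)[OF hom]
  and hom_add = star_homD(3)[OF hom]
  and hom_one = star_homD(4)[OF hom]
  and hom_smult = star_homD(5)[OF hom]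
  and hom_star = star_homD(6)[OF hom]

lemma hom_zero: "\<phi> \<zero>\<^bsub>A\<^esub> = \<zero>\<^bsub>B\<^esub>"
  using hom_smult[of "\<zero>\<^bsub>A\<^esub>" 0] by simp

lemma hom_minus:
  "x \<in> carrier A \<Longrightarrow> y \<in> carrier A \<Longrightarrow> \<phi> (x \<ominus>\<^bsub>A\<^esub> y) = \<phi> x \<ominus>\<^bsub>B\<^esub> \<phi> y"
  by (simp add: A.minus_eq_smult B.minus_eq_smult hom_add hom_smult)

lemma hom_finsum:
  "finite I \<Longrightarrow> (\<And>i. i \<in> I \<Longrightarrow> f i \<in> carrier A) \<Longrightarrow>
    \<phi> (finsum A f I) = finsum B (\<lambda>i. \<phi> (f i)) I"
proof (induction set: finite)
  case (insert a I)
  then have "f \<in> I \<rightarrow> carrier A" "(\<lambda>i. \<phi> (f i)) \<in> I \<rightarrow> carrier B" "f a \<in> carrier A"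
    by auto
  then show ?case
    using insert by (simp add: hom_add)
qed (simp add: hom_zero)

lemma star_subalgebra_vimage:
  assumes "star_subalgebra B B'"
  shows "star_subalgebra A {x \<in> carrier A. \<phi> x \<in> B'}"
  using assms unfolding star_subalgebra_def
  by (auto simp: hom_mult hom_add hom_one hom_smult hom_star)

end

lemma star_subalgebra_equalizer:
  assumes "star_algebra A" "\<phi> \<in> star_hom A B" "\<psi> \<in> star_hom A B"
  shows "star_subalgebra A {x \<in> carrier A. \<phi> x = \<psi> x}"
proof -
  interpret star_algebra A by fact
  show ?thesis
    using assms(2,3) by (auto simp: star_subalgebra_def star_homD)
qed

section \<open>Subalgebras and generation\<close>

lemma star_subalgebraD:
  assumes "star_subalgebra A B"
  shows "\<And>x. x \<in> B \<Longrightarrow> x \<in> carrier A" "\<one>\<^bsub>A\<^esub> \<in> B"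
    "\<And>x y. x \<in> B \<Longrightarrow> y \<in> B \<Longrightarrow> x \<oplus>\<^bsub>A\<^esub> y \<in> B"
    "\<And>x y. x \<in> B \<Longrightarrow> y \<in> B \<Longrightarrow> x \<otimes>\<^bsub>A\<^esub> y \<in> B"
    "\<And>c x. x \<in> B \<Longrightarrow> c \<odot>\<^bsub>A\<^esub> x \<in> B"
    "\<And>x. x \<in> B \<Longrightarrow> star A x \<in> B"
  using assms unfolding star_subalgebra_def by auto

lemma star_subalgebra_Inter:
  assumes "F \<noteq> {}" "\<And>B. B \<in> F \<Longrightarrow> star_subalgebra A B"
  shows "star_subalgebra A (\<Inter>F)"
proof -
  obtain B where "B \<in> F" using assms(1) by blast
  then have "\<Inter>F \<subseteq> carrier A"
    using star_subalgebraD(1)[OF assms(2)] by blast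
  then show ?thesis
    unfolding star_subalgebra_def
    by (intro conjI ballI allI InterI) (auto intro: star_subalgebraD[OF assms(2)])
qed

lemma star_gen_subset: "star_subalgebra A B \<Longrightarrow> X \<subseteq> B \<Longrightarrow> star_gen A X \<subseteq> B"
  unfolding star_gen_def by auto

lemma star_gen_superset: "X \<subseteq> star_gen A X"
  unfolding star_gen_def by auto

lemma cstar_gen_subset: "cstar_subalgebra A B \<Longrightarrow> X \<subseteq> B \<Longrightarrow> cstar_gen A X \<subseteq> B"
  unfolding cstar_gen_def by auto

lemma cstar_gen_superset: "X \<subseteq> cstar_gen A X"
  unfolding cstar_gen_def by auto

lemma cstar_gen_mono: "X \<subseteq> Y \<Longrightarrow> cstar_gen A X \<subseteq> cstar_gen A Y"
  unfolding cstar_gen_def by auto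

context star_algebra
begin

lemma star_subalgebra_carrier: "star_subalgebra A (carrier A)"
  unfolding star_subalgebra_def by auto

lemma star_subalgebra_star_gen: "X \<subseteq> carrier A \<Longrightarrow> star_subalgebra A (star_gen A X)"
  unfolding star_gen_def using star_subalgebra_carrier by (intro star_subalgebra_Inter) auto

lemma cstar_subalgebra_carrier: "cstar_subalgebra A (carrier A)"
  using star_subalgebra_carrier unfolding cstar_subalgebra_def by auto

lemma cstar_subalgebra_cstar_gen:
  assumes "X \<subseteq> carrier A" shows "cstar_subalgebra A (cstar_gen A X)"
proof -
  have star: "star_subalgebra A (cstar_gen A X)"
    unfolding cstar_gen_def using assms cstar_subalgebra_carrier
    by (intro star_subalgebra_Inter) (auto simp: cstar_subalgebra_def)
  have "x \<in> cstar_gen A X"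
    if "x \<in> carrier A" "range Y \<subseteq> cstar_gen A X" "(\<lambda>p. nrm A (Y p \<ominus> x)) \<longlonglongrightarrow> 0" for Y x
    unfolding cstar_gen_def
  proof (rule InterI, clarify)
    fix B assume "cstar_subalgebra A B" "X \<subseteq> B"
    then show "x \<in> B"
      using that cstar_gen_subset[of A B X] unfolding cstar_subalgebra_def by blast
  qed
  with star show ?thesis unfolding cstar_subalgebra_def by blast
qed

lemma cstar_gen_closed: "X \<subseteq> carrier A \<Longrightarrow> cstar_gen A X \<subseteq> carrier A"
  using cstar_gen_subset[OF cstar_subalgebra_carrier] by auto

end

subsection \<open>Norm and limits\<close>

context cstar_algebra
begin

lemma nrm_zero [simp]: "nrm A \<zero> = 0"
  by (simp add: nrm_eq_0)

lemma nrm_a_inv: "x \<in> carrier A \<Longrightarrow> nrm A (\<ominus> x) = nrm A x"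
  by (simp add: a_inv_eq_smult nrm_smult)

lemma nrm_minus_commute:
  assumes "x \<in> carrier A" "y \<in> carrier A"
  shows "nrm A (x \<ominus> y) = nrm A (y \<ominus> x)"
proof -
  have "y \<ominus> x = \<ominus> (x \<ominus> y)" using assms by algebra
  then show ?thesis using assms by (simp add: nrm_a_inv)
qed

lemma nrm_nonneg [simp]: "x \<in> carrier A \<Longrightarrow> 0 \<le> nrm A x"
  using nrm_triangle[of x "\<ominus> x"] by (simp add: r_neg nrm_a_inv)

lemma nrm_minus_le: "x \<in> carrier A \<Longrightarrow> y \<in> carrier A \<Longrightarrow> nrm A (x \<ominus> y) \<le> nrm A x + nrm A y"
  unfolding a_minus_def using nrm_triangle[of x "\<ominus> y"] by (simp add: nrm_a_inv)

lemma nrm_minus_triangle: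
  assumes "x \<in> carrier A" "y \<in> carrier A" "z \<in> carrier A"
  shows "nrm A (x \<ominus> z) \<le> nrm A (x \<ominus> y) + nrm A (y \<ominus> z)"
proof -
  have "x \<ominus> z = (x \<ominus> y) \<oplus> (y \<ominus> z)" using assms by algebra
  then show ?thesis using nrm_triangle assms by simp
qed

text \<open>The C*-identity and submultiplicativity give one inequality after a factor is cancelled;
  applied to the adjoint it gives the other.\<close>

lemma nrm_star_eq [simp]:
  assumes "x \<in> carrier A" shows "nrm A (star A x) = nrm A x"
proof -
  have le: "nrm A y \<le> nrm A (star A y)" if "y \<in> carrier A" for y
  proof (cases "nrm A y = 0")
    case False
    have "nrm A y * nrm A y \<le> nrm A (star A y) * nrm A y"
      using nrm_star[OF that] nrm_mult[of "star A y" y] that by (simp add: power2_eq_square)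
    then show ?thesis using False nrm_nonneg[OF that] by simp
  qed (use that in auto)
  show ?thesis using le[OF assms] le[of "star A x"] assms by simp
qed

lemma nrm_isometry_le_1:
  assumes "x \<in> carrier A" "star A x \<otimes> x = \<one>" shows "nrm A x \<le> 1"
proof -
  \<comment> \<open>The C*-identity makes \<open>nrm A \<one>\<close> idempotent, hence 0 or 1; the
    value 0 occurs in the zero algebra.\<close>
  have *: "(nrm A \<one>)\<^sup>2 = nrm A \<one>" using nrm_star[of \<one>] by simp
  then have "nrm A \<one> \<le> 1"
    by (cases "nrm A \<one> = 0") (auto simp: power2_eq_square)
  then have "(nrm A x)\<^sup>2 \<le> 1\<^sup>2" using nrm_star[of x] assms by simp
  then show ?thesis by (rule power2_le_imp_le) simp
qed

lemma nrm_projection_le_1: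
  assumes "x \<in> carrier A" "star A x = x" "x \<otimes> x = x" shows "nrm A x \<le> 1"
proof -
  have *: "(nrm A x)\<^sup>2 = nrm A x" using nrm_star[of x] assms by simp
  then show ?thesis
    by (cases "nrm A x = 0") (auto simp: power2_eq_square)
qed

end

text \<open>Membership in the carrier is built in because outside it the norm and the operations are
  arbitrary.\<close>

definition converges :: "'a cstar_alg \<Rightarrow> (nat \<Rightarrow> 'a) \<Rightarrow> 'a \<Rightarrow> bool" where
  "converges A X x \<longleftrightarrow> range X \<subseteq> carrier A \<and> x \<in> carrier A \<and> (\<lambda>p. nrm A (X p \<ominus>\<^bsub>A\<^esub> x)) \<longlonglongrightarrow> 0"

lemma convergesD:
  assumes "converges A X x"
  shows "X p \<in> carrier A" "x \<in> carrier A" "(\<lambda>p. nrm A (X p \<ominus>\<^bsub>A\<^esub> x)) \<longlonglongrightarrow> 0"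
  using assms unfolding converges_def by auto

lemma cstar_subalgebraI:
  assumes "star_subalgebra A B" "\<And>X x. converges A X x \<Longrightarrow> range X \<subseteq> B \<Longrightarrow> x \<in> B"
  shows "cstar_subalgebra A B"
proof -
  have "B \<subseteq> carrier A" using assms(1) by (simp add: star_subalgebra_def)
  then show ?thesis
    using assms unfolding cstar_subalgebra_def converges_def by blast
qed

lemma cstar_subalgebra_limit:
  "cstar_subalgebra A B \<Longrightarrow> converges A X x \<Longrightarrow> range X \<subseteq> B \<Longrightarrow> x \<in> B"
  unfolding cstar_subalgebra_def converges_def by blast

context cstar_algebra
begin

lemma convergesI:
  assumes "range X \<subseteq> carrier A" "x \<in> carrier A" "b \<longlonglongrightarrow> 0" "\<And>p. nrm A (X p \<ominus> x) \<le> b p"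
  shows "converges A X x"
proof -
  have "(\<lambda>p. nrm A (X p \<ominus> x)) \<longlonglongrightarrow> 0"
    by (rule tendsto_sandwich[OF _ _ tendsto_const assms(3)])
      (use assms in \<open>auto simp: image_subset_iff\<close>)
  then show ?thesis using assms by (simp add: converges_def)
qed

lemma converges_const: "x \<in> carrier A \<Longrightarrow> converges A (\<lambda>_. x) x"
  by (simp add: converges_def)

lemma converges_unique:
  assumes "converges A X x" "converges A X y" shows "x = y"
proof -
  note X = convergesD(1)[OF assms(1)] and x = convergesD(2)[OF assms(1)] convergesD(2)[OF assms(2)]
  have "nrm A (x \<ominus> y) \<le> nrm A (X p \<ominus> x) + nrm A (X p \<ominus> y)" for p
    using nrm_minus_triangle[of x "X p" y] X[of p] x nrm_minus_commute[of x "X p"] by simp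
  moreover have "(\<lambda>p. nrm A (X p \<ominus> x) + nrm A (X p \<ominus> y)) \<longlonglongrightarrow> 0 + 0"
    by (intro tendsto_add convergesD(3) assms)
  ultimately have "nrm A (x \<ominus> y) \<le> 0"
    by (intro LIMSEQ_le_const[of "\<lambda>p. nrm A (X p \<ominus> x) + nrm A (X p \<ominus> y)"]) auto
  then have "nrm A (x \<ominus> y) = 0" using x by (intro antisym) auto
  then show ?thesis using x by (simp add: nrm_eq_0 minus_eq_zeroD)
qed

lemma converges_add:
  assumes "converges A X x" "converges A Y y"
  shows "converges A (\<lambda>p. X p \<oplus> Y p) (x \<oplus> y)"
proof (rule convergesI)
  note c [simp] = convergesD(1,2)[OF assms(1)] convergesD(1,2)[OF assms(2)]
  show "(\<lambda>p. nrm A (X p \<ominus> x) + nrm A (Y p \<ominus> y)) \<longlonglongrightarrow> 0"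
    using tendsto_add[OF assms[THEN convergesD(3)]] by simp
  fix p
  have "(X p \<oplus> Y p) \<ominus> (x \<oplus> y) = (X p \<ominus> x) \<oplus> (Y p \<ominus> y)"
    using c(1)[of p] c(2) c(3)[of p] c(4) by algebra
  then show "nrm A ((X p \<oplus> Y p) \<ominus> (x \<oplus> y)) \<le> nrm A (X p \<ominus> x) + nrm A (Y p \<ominus> y)"
    by (simp add: nrm_triangle)
qed (auto intro!: convergesD(1,2)[OF assms(1)] convergesD(1,2)[OF assms(2)])

lemma converges_smult:
  assumes "converges A X x" shows "converges A (\<lambda>p. c \<odot> X p) (c \<odot> x)"
proof (rule convergesI)
  show "(\<lambda>p. cmod c * nrm A (X p \<ominus> x)) \<longlonglongrightarrow> 0"
    using tendsto_mult_left[OF convergesD(3)[OF assms]] by simp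
  show "nrm A (c \<odot> X p \<ominus> c \<odot> x) \<le> cmod c * nrm A (X p \<ominus> x)" for p
    using convergesD(1,2)[OF assms] by (simp flip: smult_minus_right nrm_smult)
qed (auto intro!: convergesD[OF assms])

lemma converges_star:
  assumes "converges A X x" shows "converges A (\<lambda>p. star A (X p)) (star A x)"
proof (rule convergesI)
  show "nrm A (star A (X p) \<ominus> star A x) \<le> nrm A (X p \<ominus> x)" for p
    using convergesD(1,2)[OF assms] by (simp flip: star_minus)
qed (auto intro!: convergesD[OF assms])

lemma converges_mult:
  assumes "converges A X x" "converges A Y y"
  shows "converges A (\<lambda>p. X p \<otimes> Y p) (x \<otimes> y)"
proof (rule convergesI)
  note c [simp] = convergesD(1,2)[OF assms(1)] convergesD(1,2)[OF assms(2)]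
  have "(\<lambda>p. (nrm A (X p \<ominus> x) + nrm A x) * nrm A (Y p \<ominus> y) + nrm A (X p \<ominus> x) * nrm A y)
      \<longlonglongrightarrow> (0 + nrm A x) * 0 + 0 * nrm A y"
    by (intro tendsto_intros assms[THEN convergesD(3)])
  then show "(\<lambda>p. (nrm A (X p \<ominus> x) + nrm A x) * nrm A (Y p \<ominus> y) + nrm A (X p \<ominus> x) * nrm A y)
      \<longlonglongrightarrow> 0" by simp
  fix p
  have "X p \<otimes> Y p \<ominus> x \<otimes> y = ((X p \<ominus> x) \<otimes> (Y p \<ominus> y) \<oplus> x \<otimes> (Y p \<ominus> y)) \<oplus> (X p \<ominus> x) \<otimes> y"
    using c(1)[of p] c(2) c(3)[of p] c(4) by algebra
  then have "nrm A (X p \<otimes> Y p \<ominus> x \<otimes> y) \<le>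
      nrm A ((X p \<ominus> x) \<otimes> (Y p \<ominus> y)) + nrm A (x \<otimes> (Y p \<ominus> y)) + nrm A ((X p \<ominus> x) \<otimes> y)"
    using nrm_triangle[of "(X p \<ominus> x) \<otimes> (Y p \<ominus> y) \<oplus> x \<otimes> (Y p \<ominus> y)" "(X p \<ominus> x) \<otimes> y"]
      nrm_triangle[of "(X p \<ominus> x) \<otimes> (Y p \<ominus> y)" "x \<otimes> (Y p \<ominus> y)"] by simp
  also have "\<dots> \<le> nrm A (X p \<ominus> x) * nrm A (Y p \<ominus> y) + nrm A x * nrm A (Y p \<ominus> y) +
      nrm A (X p \<ominus> x) * nrm A y"
    by (intro add_mono nrm_mult) auto
  finally show "nrm A (X p \<otimes> Y p \<ominus> x \<otimes> y) \<le>
      (nrm A (X p \<ominus> x) + nrm A x) * nrm A (Y p \<ominus> y) + nrm A (X p \<ominus> x) * nrm A y"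
    by (simp add: algebra_simps)
qed (auto intro!: convergesD(1,2)[OF assms(1)] convergesD(1,2)[OF assms(2)])

lemma converges_Suc: "converges A X x \<Longrightarrow> converges A (\<lambda>p. X (Suc p)) x"
  unfolding converges_def using LIMSEQ_Suc[of "\<lambda>p. nrm A (X p \<ominus> x)" 0] by auto

lemma cauchy_converges:
  assumes "range X \<subseteq> carrier A" "\<forall>e>0. \<exists>N. \<forall>p\<ge>N. \<forall>q\<ge>N. nrm A (X p \<ominus> X q) < e"
  obtains x where "converges A X x"
  using complete[OF assms] assms(1) unfolding converges_def by blast

end

subsection \<open>Homomorphisms are contractive\<close>

text \<open>The square root is \<open>1 - y\<close>, where \<open>y\<close> is the fixed point of the contraction
  \<open>y \<mapsto> (x + y\<^sup>2) / 2\<close> of the ball of radius \<open>1 - sqrt (1 - nrm A x)\<close>.\<close>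

lemma (in cstar_algebra) sqrt_one_minus:
  assumes x: "x \<in> carrier A" "star A x = x" "nrm A x < 1"
  obtains b where "b \<in> carrier A" "star A b = b" "b \<otimes> b = \<one> \<ominus> x"
    "\<And>z. z \<in> carrier A \<Longrightarrow> z \<otimes> x = x \<otimes> z \<Longrightarrow> z \<otimes> b = b \<otimes> z"
proof -
  define Y where "Y = rec_nat \<zero> (\<lambda>_ y. (1/2) \<odot> (x \<oplus> y \<otimes> y))"
  have Y0: "Y 0 = \<zero>" and YS: "\<And>p. Y (Suc p) = (1/2) \<odot> (x \<oplus> Y p \<otimes> Y p)"
    by (simp_all add: Y_def)
  \<comment> \<open>\<open>r\<close> is the smaller root of \<open>nrm A x + r * r = 2 * r\<close>:
    the ball of radius \<open>r\<close> is mapped into itself, and \<open>r < 1\<close> serves as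
    contraction constant.\<close>
  define r where "r = 1 - sqrt (1 - nrm A x)"
  have r: "0 \<le> r" "r < 1" "nrm A x + r * r = 2 * r"
    using x nrm_nonneg[OF x(1)] by (auto simp: r_def algebra_simps)
  have Yc [simp]: "Y p \<in> carrier A" for p
    by (induction p) (auto simp: Y0 YS x)
  have Ys: "star A (Y p) = Y p" for p
    by (induction p) (auto simp: Y0 YS x star_smult star_add star_mult)
  \<comment> \<open>The iterates are polynomials in \<open>x\<close>, so they and their limit
    commute with whatever commutes with \<open>x\<close>.\<close>
  have Ycomm: "z \<otimes> Y p = Y p \<otimes> z" if z: "z \<in> carrier A" "z \<otimes> x = x \<otimes> z" for z p
  proof (induction p)
    case (Suc p)
    have "z \<otimes> (Y p \<otimes> Y p) = (Y p \<otimes> Y p) \<otimes> z"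
      using z Suc by (metis Yc m_assoc)
    then show ?case using z x by (simp add: YS smult_mult_left smult_mult_right l_distr r_distr)
  qed (use z in \<open>simp add: Y0\<close>)
  have Yn: "nrm A (Y p) \<le> r" for p
  proof (induction p)
    case (Suc p)
    have "nrm A (Y (Suc p)) \<le> 1/2 * (nrm A x + nrm A (Y p) * nrm A (Y p))"
      using nrm_triangle[of x "Y p \<otimes> Y p"] nrm_mult[of "Y p" "Y p"] x by (simp add: YS nrm_smult)
    also have "\<dots> \<le> 1/2 * (nrm A x + r * r)"
      using Suc r by (intro mult_left_mono add_left_mono mult_mono) auto
    finally show ?case using r by simp
  qed (simp add: Y0 r)
  have step: "nrm A (Y (Suc p) \<ominus> Y (Suc q)) \<le> r * nrm A (Y p \<ominus> Y q)" for p q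
  proof -
    have "Y (Suc p) \<ominus> Y (Suc q) = (1/2) \<odot> (Y p \<otimes> (Y p \<ominus> Y q) \<oplus> (Y p \<ominus> Y q) \<otimes> Y q)"
    proof -
      have "(x \<oplus> Y p \<otimes> Y p) \<ominus> (x \<oplus> Y q \<otimes> Y q) = Y p \<otimes> (Y p \<ominus> Y q) \<oplus> (Y p \<ominus> Y q) \<otimes> Y q"
        using x Yc[of p] Yc[of q] by algebra
      then show ?thesis using x by (simp add: YS flip: smult_minus_right)
    qed
    then have "nrm A (Y (Suc p) \<ominus> Y (Suc q)) \<le>
        1/2 * (nrm A (Y p) * nrm A (Y p \<ominus> Y q) + nrm A (Y p \<ominus> Y q) * nrm A (Y q))"
      using nrm_triangle[of "Y p \<otimes> (Y p \<ominus> Y q)" "(Y p \<ominus> Y q) \<otimes> Y q"]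
        nrm_mult[of "Y p" "Y p \<ominus> Y q"] nrm_mult[of "Y p \<ominus> Y q" "Y q"] by (simp add: nrm_smult)
    also have "\<dots> \<le> 1/2 * (r * nrm A (Y p \<ominus> Y q) + nrm A (Y p \<ominus> Y q) * r)"
      using Yn r by (intro mult_left_mono add_mono mult_mono) auto
    finally show ?thesis by (simp add: mult.commute)
  qed
  \<comment> \<open>Any two iterates differ by at most 2, and \<open>N\<close> further steps shrink
    this by \<open>r ^ N\<close>. The estimate is uniform in \<open>p\<close> and \<open>q\<close>,
    so the sequence is Cauchy.\<close>
  have bound: "nrm A (Y (N + p) \<ominus> Y (N + q)) \<le> r ^ N * 2" for N p q
  proof (induction N)
    case 0
    show ?case using nrm_minus_le[of "Y p" "Y q"] Yn[of p] Yn[of q] r by simp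
  next
    case (Suc N)
    have "nrm A (Y (Suc N + p) \<ominus> Y (Suc N + q)) \<le> r * nrm A (Y (N + p) \<ominus> Y (N + q))"
      using step[of "N + p" "N + q"] by simp
    also have "\<dots> \<le> r * (r ^ N * 2)" using Suc r by (intro mult_left_mono)
    finally show ?case by simp
  qed
  have "\<exists>N. \<forall>p\<ge>N. \<forall>q\<ge>N. nrm A (Y p \<ominus> Y q) < e" if "e > 0" for e
  proof -
    have "(\<lambda>N. r ^ N * 2) \<longlonglongrightarrow> 0 * 2"
      using r by (intro tendsto_mult LIMSEQ_realpow_zero tendsto_const)
    then have "eventually (\<lambda>N. r ^ N * 2 < e) sequentially"
      using that by (intro order_tendstoD) auto
    then obtain N where N: "r ^ N * 2 < e"
      by (auto simp: eventually_sequentially)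
    have "nrm A (Y p \<ominus> Y q) < e" if "p \<ge> N" "q \<ge> N" for p q
      using bound[of N "p - N" "q - N"] N that by simp
    then show ?thesis by blast
  qed
  then obtain y where y: "converges A Y y"
    by (rule cauchy_converges[of Y, rotated, OF allI, OF impI]) auto
  note yc [simp] = convergesD(2)[OF y]
  have ys: "star A y = y"
    using converges_star[OF y] y by (intro converges_unique[of Y]) (simp_all only: Ys)
  have "converges A (\<lambda>p. (1/2) \<odot> (x \<oplus> Y p \<otimes> Y p)) ((1/2) \<odot> (x \<oplus> y \<otimes> y))"
    by (intro converges_smult converges_add converges_mult converges_const y x)
  then have fix_eq: "y = (1/2) \<odot> (x \<oplus> y \<otimes> y)"
    by (intro converges_unique[OF converges_Suc[OF y]]) (simp only: YS)
  have eq: "y \<oplus> y = x \<oplus> y \<otimes> y"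
  proof -
    have "y \<oplus> y = (1/2 + 1/2) \<odot> (x \<oplus> y \<otimes> y)"
      using x fix_eq smult_add_left[of "x \<oplus> y \<otimes> y" "1/2" "1/2"] by simp
    then show ?thesis using x by simp
  qed
  have ycomm: "z \<otimes> y = y \<otimes> z" if "z \<in> carrier A" "z \<otimes> x = x \<otimes> z" for z
    using converges_mult[OF converges_const[OF that(1)] y]
      converges_mult[OF y converges_const[OF that(1)]]
    by (intro converges_unique[of "\<lambda>p. z \<otimes> Y p"]) (simp_all only: Ycomm[OF that])
  show thesis
  proof (rule that[of "\<one> \<ominus> y"])
    \<comment> \<open>The fixed-point equation replaces the term \<open>y \<oplus> y\<close> by
      \<open>x \<oplus> y \<otimes> y\<close>, and the squares cancel.\<close>
    have "(\<one> \<ominus> y) \<otimes> (\<one> \<ominus> y) = (\<one> \<oplus> y \<otimes> y) \<ominus> (y \<oplus> y)"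
      using yc by (simp add: ring_simprules)
    also have "\<dots> = \<one> \<ominus> x"
      unfolding eq using yc x(1) by (simp add: ring_simprules)
    finally show "(\<one> \<ominus> y) \<otimes> (\<one> \<ominus> y) = \<one> \<ominus> x" .
    show "z \<otimes> (\<one> \<ominus> y) = (\<one> \<ominus> y) \<otimes> z" if z: "z \<in> carrier A" "z \<otimes> x = x \<otimes> z" for z
    proof -
      have "z \<otimes> (\<one> \<ominus> y) = z \<ominus> z \<otimes> y" using z(1) yc by (simp add: ring_simprules)
      also have "\<dots> = z \<ominus> y \<otimes> z" by (simp add: ycomm[OF z])
      also have "\<dots> = (\<one> \<ominus> y) \<otimes> z" using z(1) yc by (simp add: ring_simprules)
      finally show ?thesis .
    qed
  qed (simp_all add: star_minus ys)
qed

text \<open>A self-adjoint element \<open>h\<close> of norm less than one is the average of the unitaries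
  \<open>h \<plusminus> i sqrt (1 - h\<^sup>2)\<close>.\<close>

lemma (in cstar_algebra) selfadjoint_average_unitaries:
  assumes h: "h \<in> carrier A" "star A h = h" "nrm A h < 1"
  obtains w where "w \<in> carrier A" "star A w \<otimes> w = \<one>" "h = (1/2) \<odot> (w \<oplus> star A w)"
proof -
  have "nrm A (h \<otimes> h) < 1"
    using nrm_star[OF h(1)] h nrm_nonneg[OF h(1)] by (simp add: abs_square_less_1)
  then obtain b where b: "b \<in> carrier A" "star A b = b" "b \<otimes> b = \<one> \<ominus> h \<otimes> h"
    and comm: "h \<otimes> b = b \<otimes> h"
    using sqrt_one_minus[of "h \<otimes> h"] h by (metis m_assoc m_closed star_mult)
  define w where "w = h \<oplus> \<i> \<odot> b"
  have wc: "w \<in> carrier A" using h b by (simp add: w_def)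
  have ws: "star A w = h \<oplus> (- \<i>) \<odot> b" using h b by (simp add: w_def star_add star_smult)
  \<comment> \<open>The mixed terms cancel because \<open>b\<close> commutes with
    \<open>h\<close>.\<close>
  have "star A w \<otimes> w = (h \<otimes> h \<oplus> b \<otimes> b) \<oplus> (\<i> \<odot> (b \<otimes> h) \<oplus> (- \<i>) \<odot> (b \<otimes> h))"
    unfolding ws unfolding w_def using h(1) b(1)
    by (simp add: l_distr r_distr smult_mult_left smult_mult_right smult_add_right smult_smult comm a_ac)
  also have "\<i> \<odot> (b \<otimes> h) \<oplus> (- \<i>) \<odot> (b \<otimes> h) = \<zero>"
    using h(1) b(1) smult_add_left[of "b \<otimes> h" "\<i>" "-\<i>"] by simp
  also have "h \<otimes> h \<oplus> b \<otimes> b = \<one>" unfolding b using h(1) by (simp add: ring_simprules)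
  finally have "star A w \<otimes> w = \<one>" by simp
  moreover have "h = (1/2) \<odot> (w \<oplus> star A w)"
  proof -
    have "w \<oplus> star A w = (h \<oplus> h) \<oplus> (\<i> \<odot> b \<oplus> (- \<i>) \<odot> b)"
      unfolding ws unfolding w_def using h(1) b(1) by (simp add: a_ac)
    also have "\<i> \<odot> b \<oplus> (- \<i>) \<odot> b = \<zero>"
      using b(1) smult_add_left[of b "\<i>" "-\<i>"] by simp
    finally have "w \<oplus> star A w = h \<oplus> h" using h by simp
    then show ?thesis
      using h smult_add_left[of h "1/2" "1/2"] by (simp add: smult_add_right)
  qed
  ultimately show thesis using wc that by blast
qed

locale cstar_algebra_hom = star_algebra_hom A B \<phi> + A: cstar_algebra A + B: cstar_algebra B
  for A :: "'a cstar_alg" and B :: "'b cstar_alg" and \<phi>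
begin

text \<open>A homomorphism preserves the relation \<open>star A w \<otimes> w = \<one>\<close>, and
  elements satisfying it have norm at most one in any C*-algebra. Averaging \<open>w\<close> with
  its adjoint bounds the image of a self-adjoint element of norm below one; scaling gives all
  self-adjoint elements, and the C*-identity gives the rest.\<close>

lemma nrm_hom_le:
  assumes x: "x \<in> carrier A"
  shows "nrm B (\<phi> x) \<le> nrm A x"
proof -
  have *: "nrm B (\<phi> h) \<le> 1" if h: "h \<in> carrier A" "star A h = h" "nrm A h < 1" for h
  proof -
    obtain w where w: "w \<in> carrier A" "star A w \<otimes>\<^bsub>A\<^esub> w = \<one>\<^bsub>A\<^esub>"
        "h = (1/2) \<odot>\<^bsub>A\<^esub> (w \<oplus>\<^bsub>A\<^esub> star A w)"
      using A.selfadjoint_average_unitaries[OF h] by blast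
    have "star B (\<phi> w) \<otimes>\<^bsub>B\<^esub> \<phi> w = \<one>\<^bsub>B\<^esub>"
      using w by (metis A.star_closed hom_mult hom_one hom_star)
    then have "nrm B (\<phi> w) \<le> 1"
      using w by (intro B.nrm_isometry_le_1) auto
    moreover have "\<phi> h = (1/2) \<odot>\<^bsub>B\<^esub> (\<phi> w \<oplus>\<^bsub>B\<^esub> star B (\<phi> w))"
      unfolding w(3) using w(1) by (simp add: hom_smult hom_add hom_star)
    ultimately show ?thesis
      using w(1) B.nrm_triangle[of "\<phi> w" "star B (\<phi> w)"] by (simp add: B.nrm_smult)
  qed
  have **: "nrm B (\<phi> h) \<le> nrm A h" if h: "h \<in> carrier A" "star A h = h" for h
  \<comment> \<open>Dividing by some \<open>t\<close> strictly above the norm yields norm below one,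
    also when the norm of \<open>h\<close> is 0; then \<open>t\<close> decreases to the
    norm.\<close>
  proof (rule dense_ge)
    fix t assume t: "nrm A h < t"
    then have "0 < t" using A.nrm_nonneg[OF h(1)] by linarith
    let ?c = "complex_of_real (1 / t)"
    have "nrm B (\<phi> (?c \<odot>\<^bsub>A\<^esub> h)) \<le> 1"
      using h t \<open>0 < t\<close> by (intro *) (auto simp: A.star_smult A.nrm_smult norm_divide)
    then show "nrm B (\<phi> h) \<le> t"
      using h \<open>0 < t\<close> by (simp add: hom_smult B.nrm_smult norm_divide)
  qed
  have "(nrm B (\<phi> x))\<^sup>2 = nrm B (\<phi> (star A x \<otimes>\<^bsub>A\<^esub> x))"
    using x by (simp add: hom_mult hom_star B.nrm_star)
  also have "\<dots> \<le> nrm A (star A x \<otimes>\<^bsub>A\<^esub> x)"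
    using x by (intro **) (auto simp: A.star_mult)
  also have "\<dots> = (nrm A x)\<^sup>2" using x by (rule A.nrm_star)
  finally show ?thesis by (rule power2_le_imp_le) (use x in simp)
qed

lemma converges_hom:
  assumes "converges A X x" shows "converges B (\<lambda>p. \<phi> (X p)) (\<phi> x)"
proof (rule B.convergesI)
  show "nrm B (\<phi> (X p) \<ominus>\<^bsub>B\<^esub> \<phi> x) \<le> nrm A (X p \<ominus>\<^bsub>A\<^esub> x)" for p
    using convergesD(1,2)[OF assms] nrm_hom_le[of "X p \<ominus>\<^bsub>A\<^esub> x"] by (simp add: hom_minus)
qed (auto intro!: convergesD[OF assms])

end

lemma cstar_algebra_homI:
  "cstar_algebra A \<Longrightarrow> cstar_algebra B \<Longrightarrow> \<phi> \<in> star_hom A B \<Longrightarrow> cstar_algebra_hom A B \<phi>"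
  unfolding cstar_algebra_hom_def star_algebra_hom_def star_algebra_hom_axioms_def
  by (simp add: cstar_algebra_def)

text \<open>Contractivity makes the equalizer of the two homomorphisms closed, so it is a
  C*-subalgebra as soon as it contains the generators.\<close>

lemma star_hom_eq_on_cstar_gen:
  assumes "cstar_algebra A" "cstar_algebra B" "\<phi> \<in> star_hom A B" "\<psi> \<in> star_hom A B"
    and "X \<subseteq> carrier A" "\<And>x. x \<in> X \<Longrightarrow> \<phi> x = \<psi> x" "x \<in> cstar_gen A X"
  shows "\<phi> x = \<psi> x"
proof -
  interpret \<phi>: cstar_algebra_hom A B \<phi> using assms cstar_algebra_homI by blast
  interpret \<psi>: cstar_algebra_hom A B \<psi> using assms cstar_algebra_homI by blast
  have "cstar_subalgebra A {x \<in> carrier A. \<phi> x = \<psi> x}"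
  proof (rule cstar_subalgebraI)
    fix Y y assume Y: "converges A Y y" "range Y \<subseteq> {x \<in> carrier A. \<phi> x = \<psi> x}"
    then have "\<phi> (Y p) = \<psi> (Y p)" for p by blast
    then show "y \<in> {x \<in> carrier A. \<phi> x = \<psi> x}"
      using \<phi>.B.converges_unique[OF \<phi>.converges_hom[OF Y(1)]] \<psi>.converges_hom[OF Y(1)] convergesD(2)[OF Y(1)]
      by simp
  qed (use assms \<phi>.A.star_algebra_axioms star_subalgebra_equalizer in blast)
  then show ?thesis using assms cstar_gen_subset by blast
qed

section \<open>Constructions of C*-algebras\<close>

text \<open>Every axiom that is an equation can be checked after applying the maps
  \<open>\<phi> i\<close>, since together they separate points. Subalgebras, transported copies and
  products are all instances.\<close>

lemma star_algebra_family:
  fixes A :: "'a cstar_alg" (structure) and B :: "'i \<Rightarrow> 'b cstar_alg"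
  assumes B: "\<And>i. i \<in> I \<Longrightarrow> star_algebra (B i)"
    and closed: "\<zero> \<in> carrier A" "\<one> \<in> carrier A"
      "\<And>x y. x \<in> carrier A \<Longrightarrow> y \<in> carrier A \<Longrightarrow> x \<oplus> y \<in> carrier A"
      "\<And>x y. x \<in> carrier A \<Longrightarrow> y \<in> carrier A \<Longrightarrow> x \<otimes> y \<in> carrier A"
      "\<And>c x. x \<in> carrier A \<Longrightarrow> c \<odot> x \<in> carrier A"
      "\<And>x. x \<in> carrier A \<Longrightarrow> star A x \<in> carrier A"
    and hom: "\<And>i. i \<in> I \<Longrightarrow> \<phi> i \<in> star_hom A (B i)"
    and zero: "\<And>i. i \<in> I \<Longrightarrow> \<phi> i \<zero> = \<zero>\<^bsub>B i\<^esub>"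
    and inj: "\<And>x y. x \<in> carrier A \<Longrightarrow> y \<in> carrier A \<Longrightarrow> (\<And>i. i \<in> I \<Longrightarrow> \<phi> i x = \<phi> i y) \<Longrightarrow> x = y"
  shows "star_algebra A"
proof -
  note ring = ring.ring_simprules[OF star_algebra.axioms(1)[OF B]]
    monoid.r_one[OF ring.is_monoid[OF star_algebra.axioms(1)[OF B]]]
  note [simp] = closed star_homD[OF hom] zero
  note smult = star_algebra.smult_closed[OF B] star_algebra.smult_add_left[OF B]
    star_algebra.smult_add_right[OF B] star_algebra.smult_smult[OF B]
    star_algebra.smult_one[OF B] star_algebra.smult_mult_left[OF B]
    star_algebra.smult_mult_right[OF B] star_algebra.star_closed[OF B]
    star_algebra.star_star[OF B] star_algebra.star_add[OF B] star_algebra.star_mult[OF B]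
    star_algebra.star_smult[OF B]
  have neg: "(- 1) \<odot>\<^bsub>B i\<^esub> x \<oplus>\<^bsub>B i\<^esub> x = \<zero>\<^bsub>B i\<^esub>" if "i \<in> I" "x \<in> carrier (B i)" for i x
    using star_algebra.a_inv_eq_smult[OF B[OF that(1)] that(2), symmetric] that
    by (simp add: ring)
  have neg': "x \<oplus>\<^bsub>B i\<^esub> (- 1) \<odot>\<^bsub>B i\<^esub> x = \<zero>\<^bsub>B i\<^esub>" if "i \<in> I" "x \<in> carrier (B i)" for i x
    using star_algebra.a_inv_eq_smult[OF B[OF that(1)] that(2), symmetric] that
    by (simp add: ring)
  show ?thesis
    by (rule star_algebraI; (rule closed; assumption)?;
        (rule inj, simp, simp, simp add: ring smult neg neg')?)
qed

subsection \<open>Subalgebras\<close>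

lemma star_hom_inclusion:
  assumes "star_subalgebra A S" shows "(\<lambda>x. x) \<in> star_hom (A\<lparr>carrier := S\<rparr>) A"
  using star_subalgebraD(1)[OF assms] by (intro star_homI) auto

lemma star_subalgebra_zero:
  assumes "star_algebra A" "star_subalgebra A S" shows "\<zero>\<^bsub>A\<^esub> \<in> S"
proof -
  interpret star_algebra A by fact
  show ?thesis using star_subalgebraD(5)[OF assms(2), of "\<one>\<^bsub>A\<^esub>" 0] star_subalgebraD(2)[OF assms(2)] by simp
qed

lemma star_algebra_subalgebra:
  assumes "star_algebra A" "star_subalgebra A S"
  shows "star_algebra (A\<lparr>carrier := S\<rparr>)"
proof (rule star_algebra_family[where I = "{()}" and B = "\<lambda>_. A" and \<phi> = "\<lambda>_ x. x"])
qed (use assms star_hom_inclusion[OF assms(2)] star_subalgebra_zero[OF assms]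
      star_subalgebraD[OF assms(2)] in auto)

lemma minus_subalgebra:
  assumes "star_algebra A" "star_subalgebra A S" "y \<in> S"
  shows "x \<ominus>\<^bsub>A\<lparr>carrier := S\<rparr>\<^esub> y = x \<ominus>\<^bsub>A\<^esub> y"
  using star_algebra.minus_eq_smult[OF star_algebra_subalgebra[OF assms(1,2)], of y x]
    star_algebra.minus_eq_smult[OF assms(1), of y x] assms star_subalgebraD(1)[OF assms(2)]
  by simp

lemma converges_subalgebra:
  assumes "star_algebra A" "star_subalgebra A S"
  shows "converges (A\<lparr>carrier := S\<rparr>) X x \<longleftrightarrow> converges A X x \<and> range X \<subseteq> S \<and> x \<in> S"
  using star_subalgebraD(1)[OF assms(2)] minus_subalgebra[OF assms]
  by (auto simp: converges_def)

lemma cstar_algebra_subalgebra: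
  fixes A :: "'a cstar_alg"
  assumes "cstar_algebra A" "cstar_subalgebra A S"
  shows "cstar_algebra (A\<lparr>carrier := S\<rparr>)"
proof -
  interpret cstar_algebra A by fact
  have S: "star_subalgebra A S" using assms by (simp add: cstar_subalgebra_def)
  note sub = star_subalgebraD[OF S] and minus = minus_subalgebra[OF star_algebra_axioms S]
  show ?thesis
  proof (intro cstar_algebra.intro cstar_algebra_axioms.intro)
    show "star_algebra (A\<lparr>carrier := S\<rparr>)" by (rule star_algebra_subalgebra) (unfold_locales, rule S)
    fix X :: "nat \<Rightarrow> 'a" assume X: "range X \<subseteq> carrier (A\<lparr>carrier := S\<rparr>)"
      "\<forall>e>0. \<exists>N. \<forall>p\<ge>N. \<forall>q\<ge>N. nrm (A\<lparr>carrier := S\<rparr>) (X p \<ominus>\<^bsub>A\<lparr>carrier := S\<rparr>\<^esub> X q) < e"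
    then have XS: "X p \<in> S" for p by auto
    have "range X \<subseteq> carrier A" using XS sub(1) by blast
    moreover have "\<forall>e>0. \<exists>N. \<forall>p\<ge>N. \<forall>q\<ge>N. nrm A (X p \<ominus>\<^bsub>A\<^esub> X q) < e"
      using X(2) by (simp add: minus XS)
    ultimately obtain x where x: "converges A X x"
      by (rule cauchy_converges)
    then have "x \<in> S" using cstar_subalgebra_limit[OF assms(2) x] XS by blast
    then show "\<exists>x\<in>carrier (A\<lparr>carrier := S\<rparr>).
        (\<lambda>p. nrm (A\<lparr>carrier := S\<rparr>) (X p \<ominus>\<^bsub>A\<lparr>carrier := S\<rparr>\<^esub> x)) \<longlonglongrightarrow> 0"
      using convergesD(3)[OF x] by (auto simp: minus)
  qed (auto simp: sub nrm_eq_0 nrm_triangle nrm_smult nrm_mult nrm_star)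
qed

text \<open>A closed subalgebra of a closed subalgebra is closed in the ambient algebra, so
  generating inside or outside gives the same set.\<close>

lemma cstar_gen_subalgebra:
  assumes "cstar_algebra A" "X \<subseteq> carrier A"
  shows "cstar_gen (A\<lparr>carrier := cstar_gen A X\<rparr>) X = cstar_gen A X"
proof -
  interpret cstar_algebra A by fact
  let ?S = "cstar_gen A X"
  have cS: "cstar_subalgebra A ?S" using assms(2) by (rule cstar_subalgebra_cstar_gen)
  then have S: "star_subalgebra A ?S" by (simp add: cstar_subalgebra_def)
  interpret S: cstar_algebra "A\<lparr>carrier := ?S\<rparr>" using assms(1) cS by (rule cstar_algebra_subalgebra)
  have "cstar_subalgebra A T" if T: "cstar_subalgebra (A\<lparr>carrier := ?S\<rparr>) T" for T
  proof (rule cstar_subalgebraI)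
    have T': "star_subalgebra (A\<lparr>carrier := ?S\<rparr>) T" using T by (simp add: cstar_subalgebra_def)
    then show "star_subalgebra A T"
      using star_subalgebraD(1)[OF S] unfolding star_subalgebra_def by auto
    fix Y y assume Y: "converges A Y y" "range Y \<subseteq> T"
    then have "range Y \<subseteq> ?S" using T' by (auto simp: star_subalgebra_def)
    then show "y \<in> T"
      using Y cstar_subalgebra_limit[OF cS Y(1)]
      by (intro cstar_subalgebra_limit[OF T]) (simp add: converges_subalgebra[OF star_algebra_axioms S])
  qed
  then have "?S \<subseteq> cstar_gen (A\<lparr>carrier := ?S\<rparr>) X"
    by (subst (2) cstar_gen_def) (auto dest: cstar_gen_subset)
  then show ?thesis using S.cstar_gen_closed[of X] cstar_gen_superset[of X A] by auto
qed

lemma (in cstar_algebra_hom) cstar_subalgebra_vimage: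
  assumes "cstar_subalgebra B T" shows "cstar_subalgebra A {x \<in> carrier A. \<phi> x \<in> T}"
proof (rule cstar_subalgebraI)
  show "star_subalgebra A {x \<in> carrier A. \<phi> x \<in> T}"
    using assms by (intro star_subalgebra_vimage) (simp add: cstar_subalgebra_def)
  fix X x assume X: "converges A X x" "range X \<subseteq> {x \<in> carrier A. \<phi> x \<in> T}"
  then show "x \<in> {x \<in> carrier A. \<phi> x \<in> T}"
    using cstar_subalgebra_limit[OF assms converges_hom[OF X(1)]] convergesD(2)[OF X(1)] by blast
qed

text \<open>The preimage of a closed subalgebra containing the image of \<open>X\<close> is closed
  and contains \<open>X\<close>, hence is everything.\<close>

lemma (in cstar_algebra_hom) cstar_gen_image:
  assumes "\<phi> ` carrier A = carrier B" "X \<subseteq> carrier A" "cstar_gen A X = carrier A"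
  shows "cstar_gen B (\<phi> ` X) = carrier B"
proof
  show "cstar_gen B (\<phi> ` X) \<subseteq> carrier B" using assms by (intro B.cstar_gen_closed) auto
  have "carrier B \<subseteq> T" if T: "cstar_subalgebra B T" "\<phi> ` X \<subseteq> T" for T
  proof -
    have "cstar_gen A X \<subseteq> {x \<in> carrier A. \<phi> x \<in> T}"
      using T assms(2) by (intro cstar_gen_subset cstar_subalgebra_vimage) auto
    then have "\<phi> ` carrier A \<subseteq> T" unfolding assms(3) by auto
    then show ?thesis unfolding assms(1) .
  qed
  then show "carrier B \<subseteq> cstar_gen B (\<phi> ` X)" unfolding cstar_gen_def by blast
qed

subsection \<open>Transport along an injection\<close>

text \<open>Meant for \<open>f\<close> injective on the carrier: decoding by
  \<open>the_inv_into\<close> moves an algebra into a prescribed type such as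
  \<open>univ\<close>.\<close>

definition transport :: "('a \<Rightarrow> 'b) \<Rightarrow> 'a cstar_alg \<Rightarrow> 'b cstar_alg" where
  "transport f A = (let g = the_inv_into (carrier A) f in
    \<lparr>carrier = f ` carrier A, mult = \<lambda>x y. f (g x \<otimes>\<^bsub>A\<^esub> g y), one = f \<one>\<^bsub>A\<^esub>, zero = f \<zero>\<^bsub>A\<^esub>,
     add = \<lambda>x y. f (g x \<oplus>\<^bsub>A\<^esub> g y), smult = \<lambda>c x. f (c \<odot>\<^bsub>A\<^esub> g x), star = \<lambda>x. f (star A (g x)),
     nrm = \<lambda>x. nrm A (g x)\<rparr>)"

lemma transport:
  fixes A :: "'a cstar_alg" and f :: "'a \<Rightarrow> 'b"
  assumes "cstar_algebra A" "inj_on f (carrier A)"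
  shows "cstar_algebra (transport f A)" "f \<in> star_hom A (transport f A)"
    "the_inv_into (carrier A) f \<in> star_hom (transport f A) A"
proof -
  interpret cstar_algebra A by fact
  let ?T = "transport f A" and ?g = "the_inv_into (carrier A) f"
  have g [simp]: "?g (f x) = x" if "x \<in> carrier A" for x
    using assms(2) that by (rule the_inv_into_f_f)
  have carr: "carrier ?T = f ` carrier A" by (simp add: transport_def Let_def)
  have gc: "?g x \<in> carrier A" and fg: "f (?g x) = x" if "x \<in> carrier ?T" for x
    using that by (auto simp: carr)
  show f: "f \<in> star_hom A ?T"
    by (intro star_homI) (auto simp: transport_def Let_def)
  show hom: "?g \<in> star_hom ?T A"
    using gc by (intro star_homI) (auto simp: transport_def Let_def)
  have T: "star_algebra ?T"
  proof (rule star_algebra_family[where I = "{()}" and B = "\<lambda>_. A" and \<phi> = "\<lambda>_. ?g"])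
    show "x = y" if "x \<in> carrier ?T" "y \<in> carrier ?T" "\<And>i. i \<in> {()} \<Longrightarrow> ?g x = ?g y" for x y
      using that fg by (metis insertI1)
  qed (use hom gc star_algebra_axioms in \<open>auto simp: transport_def Let_def\<close>)
  interpret T: star_algebra ?T by (rule T)
  interpret g: star_algebra_hom ?T A ?g by unfold_locales (rule hom)
  have nrm: "nrm ?T x = nrm A (?g x)" for x by (simp add: transport_def Let_def)
  show "cstar_algebra ?T"
  proof (intro cstar_algebra.intro cstar_algebra_axioms.intro)
    fix x assume x: "x \<in> carrier ?T"
    show "nrm ?T x = 0 \<longleftrightarrow> x = \<zero>\<^bsub>?T\<^esub>"
      using x gc[OF x] fg[OF x] fg[OF T.zero_closed] g.hom_zero by (metis nrm nrm_eq_0)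
  next
    fix X :: "nat \<Rightarrow> 'b" assume X: "range X \<subseteq> carrier ?T"
      "\<forall>e>0. \<exists>N. \<forall>p\<ge>N. \<forall>q\<ge>N. nrm ?T (X p \<ominus>\<^bsub>?T\<^esub> X q) < e"
    then have Xc: "X p \<in> carrier ?T" for p by auto
    have "range (\<lambda>p. ?g (X p)) \<subseteq> carrier A" using gc[OF Xc] by blast
    moreover have "\<forall>e>0. \<exists>N. \<forall>p\<ge>N. \<forall>q\<ge>N. nrm A (?g (X p) \<ominus>\<^bsub>A\<^esub> ?g (X q)) < e"
      using X(2) by (simp add: nrm g.hom_minus Xc)
    ultimately obtain y where y: "converges A (\<lambda>p. ?g (X p)) y"
      by (rule cauchy_converges)
    have fy: "f y \<in> carrier ?T" using convergesD(2)[OF y] by (simp add: carr)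
    have "(\<lambda>p. nrm ?T (X p \<ominus>\<^bsub>?T\<^esub> f y)) \<longlonglongrightarrow> 0"
      using convergesD(2,3)[OF y] by (simp add: nrm g.hom_minus Xc fy)
    then show "\<exists>x\<in>carrier ?T. (\<lambda>p. nrm ?T (X p \<ominus>\<^bsub>?T\<^esub> x)) \<longlonglongrightarrow> 0"
      using fy by blast
  qed (use T in \<open>auto simp: nrm g.hom_add g.hom_mult g.hom_smult g.hom_star nrm_triangle nrm_smult nrm_mult nrm_star\<close>)
qed

subsection \<open>Products\<close>

text \<open>The bounded product with the supremum norm. The inserted 0 fixes the norm when
  \<open>I\<close> is empty, where the supremum would be unspecified; extensional functions make
  equality componentwise.\<close>

definition prod_alg :: "'i set \<Rightarrow> ('i \<Rightarrow> 'b cstar_alg) \<Rightarrow> ('i \<Rightarrow> 'b) cstar_alg" where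
  "prod_alg I B =
    \<lparr>carrier = {x \<in> Pi\<^sub>E I (\<lambda>i. carrier (B i)). \<exists>C. \<forall>i\<in>I. nrm (B i) (x i) \<le> C},
     mult = \<lambda>x y. \<lambda>i\<in>I. x i \<otimes>\<^bsub>B i\<^esub> y i, one = \<lambda>i\<in>I. \<one>\<^bsub>B i\<^esub>, zero = \<lambda>i\<in>I. \<zero>\<^bsub>B i\<^esub>,
     add = \<lambda>x y. \<lambda>i\<in>I. x i \<oplus>\<^bsub>B i\<^esub> y i, smult = \<lambda>c x. \<lambda>i\<in>I. c \<odot>\<^bsub>B i\<^esub> x i,
     star = \<lambda>x. \<lambda>i\<in>I. star (B i) (x i),
     nrm = \<lambda>x. Sup (insert 0 ((\<lambda>i. nrm (B i) (x i)) ` I))\<rparr>"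

context
  fixes I :: "'i set" and B :: "'i \<Rightarrow> 'b cstar_alg"
  assumes B: "\<And>i. i \<in> I \<Longrightarrow> cstar_algebra (B i)"
begin

lemma prod_alg_carrierI:
  assumes "\<And>i. i \<in> I \<Longrightarrow> f i \<in> carrier (B i)" "\<And>i. i \<in> I \<Longrightarrow> nrm (B i) (f i) \<le> C"
  shows "(\<lambda>i\<in>I. f i) \<in> carrier (prod_alg I B)"
  using assms by (auto simp: prod_alg_def)

lemma prod_alg_nrm_le_iff:
  assumes "x \<in> carrier (prod_alg I B)" "0 \<le> c"
  shows "nrm (prod_alg I B) x \<le> c \<longleftrightarrow> (\<forall>i\<in>I. nrm (B i) (x i) \<le> c)"
proof -
  obtain C where "\<forall>i\<in>I. nrm (B i) (x i) \<le> C" using assms(1) by (auto simp: prod_alg_def)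
  then have "bdd_above (insert 0 ((\<lambda>i. nrm (B i) (x i)) ` I))"
    by (intro bdd_aboveI[of _ "max 0 C"]) (auto simp: le_max_iff_disj)
  then show ?thesis using assms(2) by (subst prod_alg_def) (simp add: cSup_le_iff)
qed

lemma prod_alg_nrm_nonneg:
  assumes "x \<in> carrier (prod_alg I B)" shows "0 \<le> nrm (prod_alg I B) x"
proof -
  obtain C where "\<forall>i\<in>I. nrm (B i) (x i) \<le> C" using assms(1) by (auto simp: prod_alg_def)
  then have "bdd_above (insert 0 ((\<lambda>i. nrm (B i) (x i)) ` I))"
    by (intro bdd_aboveI[of _ "max 0 C"]) (auto simp: le_max_iff_disj)
  then show ?thesis by (simp add: prod_alg_def cSup_upper)
qed

lemma prod_alg_nrm_component:
  assumes "x \<in> carrier (prod_alg I B)" "i \<in> I"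
  shows "nrm (B i) (x i) \<le> nrm (prod_alg I B) x"
  using prod_alg_nrm_le_iff[OF assms(1) prod_alg_nrm_nonneg[OF assms(1)]] assms(2) by simp

lemma prod_alg_component: "x \<in> carrier (prod_alg I B) \<Longrightarrow> i \<in> I \<Longrightarrow> x i \<in> carrier (B i)"
  by (auto simp: prod_alg_def)

lemma prod_alg_ext:
  assumes "x \<in> carrier (prod_alg I B)" "y \<in> carrier (prod_alg I B)" "\<And>i. i \<in> I \<Longrightarrow> x i = y i"
  shows "x = y"
  using assms by (auto simp: prod_alg_def intro: PiE_ext)

lemma prod_alg_projection:
  assumes "i \<in> I" shows "(\<lambda>x. x i) \<in> star_hom (prod_alg I B) (B i)"
  using assms by (intro star_homI) (auto simp: prod_alg_def)

text \<open>Algebraic laws are read off the coordinates. For completeness, coordinatewise limits are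
  not enough by themselves: the Cauchy rate is independent of the coordinate, which makes the limit
  bounded and the convergence uniform.\<close>

lemma cstar_algebra_prod_alg: "cstar_algebra (prod_alg I B)"
proof -
  let ?P = "prod_alg I B"
  note comp = prod_alg_component and le = prod_alg_nrm_component
  note C = B[THEN cstar_algebra.axioms(1)]
  note alg = star_algebra.axioms(1)[OF C, THEN ring.ring_simprules(1)]
    star_algebra.axioms(1)[OF C, THEN ring.ring_simprules(2)]
    star_algebra.axioms(1)[OF C, THEN ring.ring_simprules(5)]
    star_algebra.axioms(1)[OF C, THEN ring.ring_simprules(6)]
    star_algebra.smult_closed[OF C] star_algebra.star_closed[OF C]
  note nn = cstar_algebra.nrm_nonneg[OF B]
  have P: "star_algebra ?P"
  proof (rule star_algebra_family[where I = I and B = B and \<phi> = "\<lambda>i x. x i"])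
    fix x y c assume x: "x \<in> carrier ?P"
    show "c \<odot>\<^bsub>?P\<^esub> x \<in> carrier ?P"
      using prod_alg_carrierI[of "\<lambda>i. c \<odot>\<^bsub>B i\<^esub> x i" "cmod c * nrm ?P x"] comp[OF x] le[OF x]
      by (simp add: prod_alg_def alg cstar_algebra.nrm_smult[OF B] mult_left_mono)
    show "star ?P x \<in> carrier ?P"
      using prod_alg_carrierI[of "\<lambda>i. star (B i) (x i)" "nrm ?P x"] comp[OF x] le[OF x]
      by (simp add: prod_alg_def alg cstar_algebra.nrm_star_eq[OF B])
    assume y: "y \<in> carrier ?P"
    show "x \<oplus>\<^bsub>?P\<^esub> y \<in> carrier ?P"
    proof -
      have "nrm (B i) (x i \<oplus>\<^bsub>B i\<^esub> y i) \<le> nrm ?P x + nrm ?P y" if "i \<in> I" for i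
        using cstar_algebra.nrm_triangle[OF B[OF that] comp[OF x that] comp[OF y that]]
          le[OF x that] le[OF y that] by linarith
      then show ?thesis
        using prod_alg_carrierI[of "\<lambda>i. x i \<oplus>\<^bsub>B i\<^esub> y i" "nrm ?P x + nrm ?P y"] comp[OF x] comp[OF y]
        by (simp add: prod_alg_def alg)
    qed
    show "x \<otimes>\<^bsub>?P\<^esub> y \<in> carrier ?P"
    proof -
      have "nrm (B i) (x i \<otimes>\<^bsub>B i\<^esub> y i) \<le> nrm ?P x * nrm ?P y" if "i \<in> I" for i
        using cstar_algebra.nrm_mult[OF B[OF that] comp[OF x that] comp[OF y that]]
          mult_mono[OF le[OF x that] le[OF y that] prod_alg_nrm_nonneg[OF x] nn[OF that comp[OF y that]]]
        by linarith
      then show ?thesis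
        using prod_alg_carrierI[of "\<lambda>i. x i \<otimes>\<^bsub>B i\<^esub> y i" "nrm ?P x * nrm ?P y"] comp[OF x] comp[OF y]
        by (simp add: prod_alg_def alg)
    qed
  next
    show "\<zero>\<^bsub>?P\<^esub> i = \<zero>\<^bsub>B i\<^esub>" if "i \<in> I" for i
      using that by (simp add: prod_alg_def)
    show "\<zero>\<^bsub>?P\<^esub> \<in> carrier ?P"
      using prod_alg_carrierI[of "\<lambda>i. \<zero>\<^bsub>B i\<^esub>" 0]
      by (simp add: prod_alg_def alg cstar_algebra.nrm_zero[OF B])
    show "\<one>\<^bsub>?P\<^esub> \<in> carrier ?P"
    proof -
      have "nrm (B i) \<one>\<^bsub>B i\<^esub> \<le> 1" if "i \<in> I" for i
      proof -
        interpret cstar_algebra "B i" using that by (rule B)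
        show ?thesis by (rule nrm_isometry_le_1) auto
      qed
      then show ?thesis
        using prod_alg_carrierI[of "\<lambda>i. \<one>\<^bsub>B i\<^esub>" 1] by (simp add: prod_alg_def alg)
    qed
  qed (auto simp: C prod_alg_projection intro: prod_alg_ext)
  interpret P: star_algebra ?P by (rule P)
  have proj: "star_algebra_hom ?P (B i) (\<lambda>x. x i)" if "i \<in> I" for i
    using that P C prod_alg_projection by (simp add: star_algebra_hom_def star_algebra_hom_axioms_def)
  note [simp] = star_algebra_hom.hom_minus[OF proj] star_algebra_hom.hom_add[OF proj]
    star_algebra_hom.hom_mult[OF proj] star_algebra_hom.hom_smult[OF proj]
    star_algebra_hom.hom_star[OF proj] star_algebra_hom.hom_zero[OF proj]
    and pos [simp] = prod_alg_nrm_nonneg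
  show ?thesis
  proof (intro cstar_algebra.intro cstar_algebra_axioms.intro P)
    fix x y c assume x: "x \<in> carrier ?P"
    show "nrm ?P x = 0 \<longleftrightarrow> x = \<zero>\<^bsub>?P\<^esub>"
    proof
      assume "nrm ?P x = 0"
      then have "nrm (B i) (x i) = 0" if "i \<in> I" for i
        using le[OF x that] nn[OF that comp[OF x that]] by simp
      then show "x = \<zero>\<^bsub>?P\<^esub>"
        using x comp[OF x] by (intro prod_alg_ext) (auto simp: cstar_algebra.nrm_eq_0[OF B])
    next
      assume "x = \<zero>\<^bsub>?P\<^esub>"
      then have "nrm ?P x \<le> 0" by (subst prod_alg_nrm_le_iff) (auto simp: cstar_algebra.nrm_zero[OF B])
      then show "nrm ?P x = 0" using pos[OF x] by simp
    qed
    \<comment> \<open>The reverse inequality is this one for the scalar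
      \<open>1 / c\<close>.\<close>
    have smult_le: "nrm ?P (c \<odot>\<^bsub>?P\<^esub> x) \<le> cmod c * nrm ?P x" if "x \<in> carrier ?P" for c x
      using that le[OF that] comp[OF that]
      by (subst prod_alg_nrm_le_iff) (auto simp: cstar_algebra.nrm_smult[OF B] mult_left_mono)
    show "nrm ?P (c \<odot>\<^bsub>?P\<^esub> x) = cmod c * nrm ?P x"
    proof (cases "c = 0")
      case True
      then show ?thesis using smult_le[OF x, of 0] pos[of "0 \<odot>\<^bsub>?P\<^esub> x"] x
        by (metis P.smult_closed mult_zero_left norm_zero order_antisym)
    next
      case False
      have "nrm ?P x \<le> cmod (1 / c) * nrm ?P (c \<odot>\<^bsub>?P\<^esub> x)"
        using smult_le[of "c \<odot>\<^bsub>?P\<^esub> x" "1 / c"] x False by (simp add: P.smult_smult)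
      then show ?thesis
        using smult_le[OF x, of c] False by (simp add: norm_divide field_simps)
    qed
    have "nrm (B i) (star (B i) (x i) \<otimes>\<^bsub>B i\<^esub> x i) = (nrm (B i) (x i))\<^sup>2" if "i \<in> I" for i
      using cstar_algebra.nrm_star[OF B[OF that] comp[OF x that]] .
    note st = this
    show "nrm ?P (star ?P x \<otimes>\<^bsub>?P\<^esub> x) = (nrm ?P x)\<^sup>2"
    proof (rule antisym)
      show "nrm ?P (star ?P x \<otimes>\<^bsub>?P\<^esub> x) \<le> (nrm ?P x)\<^sup>2"
        using x le[OF x] nn[OF _ comp[OF x]]
        by (subst prod_alg_nrm_le_iff) (auto simp: st intro!: power_mono)
      have "nrm (B i) (x i) \<le> sqrt (nrm ?P (star ?P x \<otimes>\<^bsub>?P\<^esub> x))" if "i \<in> I" for i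
        using le[OF _ that, of "star ?P x \<otimes>\<^bsub>?P\<^esub> x"] x that by (simp add: st real_le_rsqrt)
      then have "nrm ?P x \<le> sqrt (nrm ?P (star ?P x \<otimes>\<^bsub>?P\<^esub> x))"
        using x by (subst prod_alg_nrm_le_iff) auto
      then show "(nrm ?P x)\<^sup>2 \<le> nrm ?P (star ?P x \<otimes>\<^bsub>?P\<^esub> x)"
        using x pos[OF x] by (metis P.m_closed P.star_closed pos power_mono real_sqrt_pow2)
    qed
    assume y: "y \<in> carrier ?P"
    show "nrm ?P (x \<oplus>\<^bsub>?P\<^esub> y) \<le> nrm ?P x + nrm ?P y"
    proof -
      have "nrm (B i) (x i \<oplus>\<^bsub>B i\<^esub> y i) \<le> nrm ?P x + nrm ?P y" if "i \<in> I" for i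
        using cstar_algebra.nrm_triangle[OF B[OF that] comp[OF x that] comp[OF y that]]
          le[OF x that] le[OF y that] by linarith
      then show ?thesis using x y by (subst prod_alg_nrm_le_iff) auto
    qed
    show "nrm ?P (x \<otimes>\<^bsub>?P\<^esub> y) \<le> nrm ?P x * nrm ?P y"
    proof -
      have "nrm (B i) (x i \<otimes>\<^bsub>B i\<^esub> y i) \<le> nrm ?P x * nrm ?P y" if "i \<in> I" for i
        using cstar_algebra.nrm_mult[OF B[OF that] comp[OF x that] comp[OF y that]]
          mult_mono[OF le[OF x that] le[OF y that] prod_alg_nrm_nonneg[OF x] nn[OF that comp[OF y that]]]
        by linarith
      then show ?thesis using x y by (subst prod_alg_nrm_le_iff) auto
    qed
  next
    fix X :: "nat \<Rightarrow> 'i \<Rightarrow> 'b" assume X: "range X \<subseteq> carrier ?P"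
      "\<forall>e>0. \<exists>N. \<forall>p\<ge>N. \<forall>q\<ge>N. nrm ?P (X p \<ominus>\<^bsub>?P\<^esub> X q) < e"
    have Xc: "X p \<in> carrier ?P" for p using X(1) by auto
    have "\<exists>y. converges (B i) (\<lambda>p. X p i) y" if "i \<in> I" for i
    proof -
      interpret cstar_algebra "B i" using that by (rule B)
      have "\<exists>N. \<forall>p\<ge>N. \<forall>q\<ge>N. nrm (B i) (X p i \<ominus>\<^bsub>B i\<^esub> X q i) < e" if "e > 0" for e
      proof -
        obtain N where N: "\<forall>p\<ge>N. \<forall>q\<ge>N. nrm ?P (X p \<ominus>\<^bsub>?P\<^esub> X q) < e" using X(2) \<open>e > 0\<close> by blast
        have "nrm (B i) (X p i \<ominus>\<^bsub>B i\<^esub> X q i) < e" if "p \<ge> N" "q \<ge> N" for p q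
          using N[rule_format, OF that] le[OF _ \<open>i \<in> I\<close>, of "X p \<ominus>\<^bsub>?P\<^esub> X q"] \<open>i \<in> I\<close> Xc by simp
        then show ?thesis by blast
      qed
      then show ?thesis
        using comp[OF Xc that] by (metis cauchy_converges image_subsetI)
    qed
    then obtain y' where y': "\<And>i. i \<in> I \<Longrightarrow> converges (B i) (\<lambda>p. X p i) (y' i)" by metis
    define y where "y = (\<lambda>i\<in>I. y' i)"
    have y: "converges (B i) (\<lambda>p. X p i) (y i)" if "i \<in> I" for i using y'[OF that] that by (simp add: y_def)
    \<comment> \<open>Letting \<open>q\<close> tend to infinity in the Cauchy estimate keeps a bound
      that does not depend on \<open>i\<close>.\<close>
    have near: "nrm (B i) (X p i \<ominus>\<^bsub>B i\<^esub> y i) \<le> e"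
      if "i \<in> I" and N: "\<forall>p\<ge>N. \<forall>q\<ge>N. nrm ?P (X p \<ominus>\<^bsub>?P\<^esub> X q) < e" and "p \<ge> N" for i e N p
    proof -
      interpret cstar_algebra "B i" using that(1) by (rule B)
      note [simp] = comp[OF Xc that(1)] convergesD(2)[OF y[OF that(1)]]
      have "nrm (B i) (X p i \<ominus>\<^bsub>B i\<^esub> y i) \<le> e + nrm (B i) (X q i \<ominus>\<^bsub>B i\<^esub> y i)" if "q \<ge> N" for q
      proof -
        have "nrm (B i) (X p i \<ominus>\<^bsub>B i\<^esub> X q i) \<le> e"
          using N[rule_format, OF \<open>p \<ge> N\<close> that] le[OF _ \<open>i \<in> I\<close>, of "X p \<ominus>\<^bsub>?P\<^esub> X q"] \<open>i \<in> I\<close> Xc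
          by simp
        then show ?thesis using nrm_minus_triangle[of "X p i" "X q i" "y i"] by simp
      qed
      moreover have "(\<lambda>q. e + nrm (B i) (X q i \<ominus>\<^bsub>B i\<^esub> y i)) \<longlonglongrightarrow> e + 0"
        by (intro tendsto_intros convergesD(3) y that)
      ultimately show ?thesis
        by (intro LIMSEQ_le_const[of "\<lambda>q. e + nrm (B i) (X q i \<ominus>\<^bsub>B i\<^esub> y i)"]) auto
    qed
    obtain N where N: "\<forall>p\<ge>N. \<forall>q\<ge>N. nrm ?P (X p \<ominus>\<^bsub>?P\<^esub> X q) < 1" using X(2) zero_less_one by blast
    have yc: "y \<in> carrier ?P"
      unfolding y_def
    proof (rule prod_alg_carrierI)
      fix i assume i: "i \<in> I"
      interpret cstar_algebra "B i" using i by (rule B)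
      note [simp] = comp[OF Xc i] convergesD(2)[OF y'[OF i]]
      show "y' i \<in> carrier (B i)" by simp
      have "y' i = X N i \<ominus>\<^bsub>B i\<^esub> (X N i \<ominus>\<^bsub>B i\<^esub> y' i)"
        using comp[OF Xc i, of N] convergesD(2)[OF y'[OF i]] by algebra
      then show "nrm (B i) (y' i) \<le> nrm ?P (X N) + 1"
        using nrm_minus_le[of "X N i" "X N i \<ominus>\<^bsub>B i\<^esub> y' i"] le[OF Xc i, of N] near[OF i N, of N] i
        by (simp add: y_def)
    qed
    have "(\<lambda>p. nrm ?P (X p \<ominus>\<^bsub>?P\<^esub> y)) \<longlonglongrightarrow> 0"
    proof (rule LIMSEQ_I)
      fix r :: real assume r: "r > 0"
      \<comment> \<open>Passing to the limit weakens the strict inequality, hence the half.\<close>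
      then obtain N where N: "\<forall>p\<ge>N. \<forall>q\<ge>N. nrm ?P (X p \<ominus>\<^bsub>?P\<^esub> X q) < r/2" using X(2) half_gt_zero by blast
      have "nrm ?P (X p \<ominus>\<^bsub>?P\<^esub> y) < r" if "p \<ge> N" for p
      proof -
        have "nrm ?P (X p \<ominus>\<^bsub>?P\<^esub> y) \<le> r/2"
          using near[OF _ N that] Xc yc r by (subst prod_alg_nrm_le_iff) auto
        then show ?thesis using r by simp
      qed
      then show "\<exists>N. \<forall>p\<ge>N. norm (nrm ?P (X p \<ominus>\<^bsub>?P\<^esub> y) - 0) < r"
        using r Xc yc by (intro exI[of _ N]) auto
    qed
    then show "\<exists>y\<in>carrier ?P. (\<lambda>p. nrm ?P (X p \<ominus>\<^bsub>?P\<^esub> y)) \<longlonglongrightarrow> 0" using yc by blast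
  qed
qed

end

subsection \<open>The opposite algebra and the complex numbers\<close>

lemma opposite_simps [simp]:
  "carrier (opposite A) = carrier A" "\<one>\<^bsub>opposite A\<^esub> = \<one>\<^bsub>A\<^esub>" "\<zero>\<^bsub>opposite A\<^esub> = \<zero>\<^bsub>A\<^esub>"
  "x \<otimes>\<^bsub>opposite A\<^esub> y = y \<otimes>\<^bsub>A\<^esub> x" "x \<oplus>\<^bsub>opposite A\<^esub> y = x \<oplus>\<^bsub>A\<^esub> y"
  "c \<odot>\<^bsub>opposite A\<^esub> x = c \<odot>\<^bsub>A\<^esub> x" "star (opposite A) x = star A x" "nrm (opposite A) x = nrm A x"
  "x \<ominus>\<^bsub>opposite A\<^esub> y = x \<ominus>\<^bsub>A\<^esub> y" "finsum (opposite A) f I = finsum A f I"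
  by (simp_all add: opposite_def a_minus_def a_inv_def finsum_def)

lemma cstar_algebra_opposite:
  assumes "cstar_algebra A" shows "cstar_algebra (opposite A)"
proof -
  interpret cstar_algebra A by fact
  have S: "star_algebra (opposite A)"
    by (rule star_algebraI)
      (simp_all add: ring_simprules smult_add_left smult_add_right smult_smult
        smult_mult_left smult_mult_right star_add star_smult star_mult flip: a_inv_eq_smult)
  show ?thesis
  proof (intro cstar_algebra.intro cstar_algebra_axioms.intro S)
    fix x assume "x \<in> carrier (opposite A)"
    then show "nrm (opposite A) (star (opposite A) x \<otimes>\<^bsub>opposite A\<^esub> x) = (nrm (opposite A) x)\<^sup>2"
      \<comment> \<open>In the opposite product the C*-identity for \<open>x\<close> is the original
        one for \<open>star A x\<close>, which has the same norm.\<close>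
      using nrm_star[of "star A x"] by simp
  next
    fix x y assume "x \<in> carrier (opposite A)" "y \<in> carrier (opposite A)"
    then show "nrm (opposite A) (x \<otimes>\<^bsub>opposite A\<^esub> y) \<le> nrm (opposite A) x * nrm (opposite A) y"
      using nrm_mult[of y x] by (simp add: mult.commute)
  qed (use complete in \<open>simp_all add: nrm_eq_0 nrm_triangle nrm_smult\<close>)
qed

lemma complex_alg_simps [simp]:
  "carrier complex_alg = UNIV" "\<one>\<^bsub>complex_alg\<^esub> = 1" "\<zero>\<^bsub>complex_alg\<^esub> = 0"
  "x \<otimes>\<^bsub>complex_alg\<^esub> y = x * y" "x \<oplus>\<^bsub>complex_alg\<^esub> y = x + y"
  "c \<odot>\<^bsub>complex_alg\<^esub> x = c * x" "star complex_alg x = cnj x" "nrm complex_alg x = cmod x"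
  by (simp_all add: complex_alg_def)

lemma star_algebra_complex_alg: "star_algebra complex_alg"
  by (rule star_algebraI) (simp_all add: algebra_simps)

lemma minus_complex_alg [simp]: "x \<ominus>\<^bsub>complex_alg\<^esub> y = x - y"
  by (simp add: star_algebra.minus_eq_smult[OF star_algebra_complex_alg])

lemma finsum_complex_alg [simp]: "finsum complex_alg f I = sum f I"
proof -
  interpret star_algebra complex_alg by (rule star_algebra_complex_alg)
  show ?thesis
    by (induction I rule: infinite_finite_induct) simp_all
qed

lemma cstar_algebra_complex_alg: "cstar_algebra complex_alg"
proof (intro cstar_algebra.intro cstar_algebra_axioms.intro star_algebra_complex_alg)
  fix X :: "nat \<Rightarrow> complex"
  assume *: "\<forall>e>0. \<exists>N. \<forall>p\<ge>N. \<forall>q\<ge>N. nrm complex_alg (X p \<ominus>\<^bsub>complex_alg\<^esub> X q) < e"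
  then have "Cauchy X" unfolding Cauchy_def dist_norm by simp
  then obtain x where "X \<longlonglongrightarrow> x" using Cauchy_convergent_iff convergent_def by blast
  then show "\<exists>x\<in>carrier complex_alg. (\<lambda>p. nrm complex_alg (X p \<ominus>\<^bsub>complex_alg\<^esub> x)) \<longlonglongrightarrow> 0"
    by (auto simp: tendsto_norm_zero_iff LIM_zero_iff)
qed (auto simp: norm_mult norm_triangle_ineq power2_eq_square)

subsection \<open>Countably generated algebras\<close>

text \<open>Formal *-polynomials in countably many generators; the two rationals in
  \<open>Smult\<close> are the real and imaginary parts of the coefficient. There are countably
  many, yet their values are dense in the generated C*-algebra.\<close>

datatype sterm = Gen nat | One | Add sterm sterm | Mult sterm sterm | Star sterm | Smult rat rat sterm

instance sterm :: countable by countable_datatype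

primrec sterm_val :: "'a cstar_alg \<Rightarrow> (nat \<Rightarrow> 'a) \<Rightarrow> sterm \<Rightarrow> 'a" where
  "sterm_val A e (Gen m) = e m"
| "sterm_val A e One = \<one>\<^bsub>A\<^esub>"
| "sterm_val A e (Add s t) = sterm_val A e s \<oplus>\<^bsub>A\<^esub> sterm_val A e t"
| "sterm_val A e (Mult s t) = sterm_val A e s \<otimes>\<^bsub>A\<^esub> sterm_val A e t"
| "sterm_val A e (Star t) = star A (sterm_val A e t)"
| "sterm_val A e (Smult a b t) = Complex (of_rat a) (of_rat b) \<odot>\<^bsub>A\<^esub> sterm_val A e t"

lemma of_rat_approx: "\<exists>a :: nat \<Rightarrow> rat. (\<lambda>p. of_rat (a p)) \<longlonglongrightarrow> (x :: real)"
proof -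
  have "\<exists>a :: rat. x < of_rat a \<and> of_rat a < x + 1 / real (Suc p)" for p
    by (rule of_rat_dense) simp
  then obtain a :: "nat \<Rightarrow> rat" where a: "\<And>p. x < of_rat (a p)" "\<And>p. of_rat (a p) < x + 1 / real (Suc p)"
    by metis
  have "(\<lambda>p. x + 1 / real (Suc p)) \<longlonglongrightarrow> x + 0"
    by (intro tendsto_intros LIMSEQ_Suc[OF lim_1_over_n])
  then have lim: "(\<lambda>p. x + 1 / real (Suc p)) \<longlonglongrightarrow> x" by simp
  have "(\<lambda>p. of_rat (a p)) \<longlonglongrightarrow> x"
    by (rule real_tendsto_sandwich[OF _ _ tendsto_const[of x] lim])
      (intro always_eventually allI less_imp_le a)+
  then show ?thesis by blast
qed

lemma (in cstar_algebra) converges_smult_var: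
  assumes "converges A X x" "c \<longlonglongrightarrow> d"
  shows "converges A (\<lambda>p. c p \<odot> X p) (d \<odot> x)"
proof (rule convergesI)
  note [simp] = convergesD(1,2)[OF assms(1)]
  have "(\<lambda>p. cmod (c p) * nrm A (X p \<ominus> x) + cmod (c p - d) * nrm A x) \<longlonglongrightarrow>
      cmod d * 0 + 0 * nrm A x"
    using assms(2) by (intro tendsto_intros convergesD(3)[OF assms(1)] tendsto_norm_zero LIM_zero)
  then show "(\<lambda>p. cmod (c p) * nrm A (X p \<ominus> x) + cmod (c p - d) * nrm A x) \<longlonglongrightarrow> 0" by simp
  fix p
  have "c p \<odot> X p \<ominus> d \<odot> x = c p \<odot> (X p \<ominus> x) \<oplus> (c p - d) \<odot> x"
  proof -
    have "c p \<odot> x = (c p - d) \<odot> x \<oplus> d \<odot> x"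
      using smult_add_left[of x "c p - d" d] by simp
    then have "c p \<odot> (X p \<ominus> x) \<oplus> (c p - d) \<odot> x =
        (c p \<odot> X p \<ominus> ((c p - d) \<odot> x \<oplus> d \<odot> x)) \<oplus> (c p - d) \<odot> x"
      by (simp add: smult_minus_right)
    also have "\<dots> = c p \<odot> X p \<ominus> d \<odot> x"
      by (simp add: ring_simprules)
    finally show ?thesis ..
  qed
  then show "nrm A (c p \<odot> X p \<ominus> d \<odot> x) \<le> cmod (c p) * nrm A (X p \<ominus> x) + cmod (c p - d) * nrm A x"
    using nrm_triangle[of "c p \<odot> (X p \<ominus> x)" "(c p - d) \<odot> x"] by (simp add: nrm_smult)
qed (auto intro!: convergesD(1,2)[OF assms(1)])

text \<open>The limits of sequences of term values form a C*-subalgebra. Continuity of the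
  operations handles the algebraic closure, where a complex scalar is approximated along with the
  element it multiplies.\<close>

lemma (in cstar_algebra) sterm_val_dense:
  assumes e: "\<And>m. e m \<in> carrier A" and x: "x \<in> cstar_gen A (range e)"
  shows "\<exists>t. converges A (\<lambda>p. sterm_val A e (t p)) x"
proof -
  have val [simp]: "sterm_val A e t \<in> carrier A" for t by (induction t) (auto simp: e)
  define S where "S = {x. \<exists>t. converges A (\<lambda>p. sterm_val A e (t p)) x}"
  have "star_subalgebra A S"
    unfolding star_subalgebra_def
  proof (intro conjI ballI allI)
    show "S \<subseteq> carrier A" by (auto simp: S_def dest: convergesD(2))
    show "\<one> \<in> S" unfolding S_def using converges_const[of \<one>] by (auto intro!: exI[of _ "\<lambda>_. One"])
    fix x c assume "x \<in> S"
    then obtain s where s: "converges A (\<lambda>p. sterm_val A e (s p)) x" by (auto simp: S_def)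
    show "star A x \<in> S" unfolding S_def using converges_star[OF s]
      by (auto intro!: exI[of _ "\<lambda>p. Star (s p)"])
    obtain a b where a: "(\<lambda>p. of_rat (a p)) \<longlonglongrightarrow> Re c" and b: "(\<lambda>p. of_rat (b p)) \<longlonglongrightarrow> Im c"
      using of_rat_approx by blast
    have "(\<lambda>p. Complex (of_rat (a p)) (of_rat (b p))) \<longlonglongrightarrow> c"
      using tendsto_Complex[OF a b] by simp
    then show "c \<odot> x \<in> S" unfolding S_def using converges_smult_var[OF s]
      by (auto intro!: exI[of _ "\<lambda>p. Smult (a p) (b p) (s p)"])
    fix y assume "y \<in> S"
    then obtain t where t: "converges A (\<lambda>p. sterm_val A e (t p)) y" by (auto simp: S_def)
    show "x \<oplus> y \<in> S" unfolding S_def using converges_add[OF s t]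
      by (auto intro!: exI[of _ "\<lambda>p. Add (s p) (t p)"])
    show "x \<otimes> y \<in> S" unfolding S_def using converges_mult[OF s t]
      by (auto intro!: exI[of _ "\<lambda>p. Mult (s p) (t p)"])
  qed
  moreover have "y \<in> S" if Y: "converges A Y y" "range Y \<subseteq> S" for Y y
  proof -
    \<comment> \<open>Diagonal choice: one term close to each \<open>Y p\<close> gives a sequence of
      terms with the same limit as \<open>Y\<close>.\<close>
    have "\<exists>t. nrm A (sterm_val A e t \<ominus> Y p) < 1 / real (Suc p)" for p
    proof -
      obtain t where t: "converges A (\<lambda>q. sterm_val A e (t q)) (Y p)" using Y(2) by (auto simp: S_def)
      have "eventually (\<lambda>q. nrm A (sterm_val A e (t q) \<ominus> Y p) < 1 / real (Suc p)) sequentially"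
        by (intro order_tendstoD[OF convergesD(3)[OF t]]) simp
      then show ?thesis by (auto simp: eventually_sequentially)
    qed
    then obtain t where t: "\<And>p. nrm A (sterm_val A e (t p) \<ominus> Y p) < 1 / real (Suc p)" by metis
    have "converges A (\<lambda>p. sterm_val A e (t p)) y"
    proof (rule convergesI)
      have "(\<lambda>p. 1 / real (Suc p) + nrm A (Y p \<ominus> y)) \<longlonglongrightarrow> 0 + 0"
        by (intro tendsto_add convergesD(3)[OF Y(1)] LIMSEQ_Suc[OF lim_1_over_n])
      then show "(\<lambda>p. 1 / real (Suc p) + nrm A (Y p \<ominus> y)) \<longlonglongrightarrow> 0" by simp
      show "nrm A (sterm_val A e (t p) \<ominus> y) \<le> 1 / real (Suc p) + nrm A (Y p \<ominus> y)" for p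
        using nrm_minus_triangle[OF val[of "t p"] convergesD(1)[OF Y(1), of p] convergesD(2)[OF Y(1)]] t[of p]
        by linarith
    qed (auto intro: convergesD(2)[OF Y(1)])
    then show ?thesis by (auto simp: S_def)
  qed
  ultimately have "cstar_subalgebra A S" by (rule cstar_subalgebraI)
  moreover have "range e \<subseteq> S"
  proof clarify
    fix m show "e m \<in> S"
      unfolding S_def using converges_const[OF e[of m]] by (auto intro!: exI[of _ "\<lambda>_. Gen m"])
  qed
  ultimately show ?thesis using x cstar_gen_subset unfolding S_def by blast
qed

text \<open>An element is coded by the numbers of the terms in a chosen sequence converging to it.
  Limits are unique, so the code determines the element.\<close>

lemma countably_generated_embedding:
  fixes A :: "'a cstar_alg"
  assumes "cstar_algebra A" "countable X" "X \<subseteq> carrier A"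
  obtains f :: "'a \<Rightarrow> univ" where "inj_on f (cstar_gen A X)"
proof -
  interpret cstar_algebra A by fact
  \<comment> \<open>The unit makes the enumerated set nonempty, and it belongs to every generated
    subalgebra anyway.\<close>
  define e where "e = from_nat_into (insert \<one>\<^bsub>A\<^esub> X)"
  have range_e: "range e = insert \<one>\<^bsub>A\<^esub> X"
    using assms(2) unfolding e_def by (intro range_from_nat_into) auto
  have e: "e m \<in> carrier A" for m using rangeI[of e m] assms(3) unfolding range_e by auto
  have "\<exists>t. converges A (\<lambda>p. sterm_val A e (t p)) x" if "x \<in> cstar_gen A X" for x
  proof (rule sterm_val_dense[OF e])
    show "x \<in> cstar_gen A (range e)"
      unfolding range_e using that cstar_gen_mono[of X "insert \<one>\<^bsub>A\<^esub> X"] by blast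
  qed
  then obtain t where t: "\<And>x. x \<in> cstar_gen A X \<Longrightarrow> converges A (\<lambda>p. sterm_val A e (t x p)) x" by metis
  have "inj_on (\<lambda>x p. of_nat (to_nat (t x p)) :: complex) (cstar_gen A X)"
  proof (rule inj_onI)
    fix x y assume xy: "x \<in> cstar_gen A X" "y \<in> cstar_gen A X"
      "(\<lambda>p. of_nat (to_nat (t x p)) :: complex) = (\<lambda>p. of_nat (to_nat (t y p)))"
    then have "t x p = t y p" for p by (simp add: fun_eq_iff)
    then show "x = y" using t[OF xy(1)] t[OF xy(2)] converges_unique by simp
  qed
  then show thesis by (rule that)
qed

subsection \<open>Universal algebras\<close>

text \<open>The algebra generated by the diagonal images of the generators in the product of all models.
  It is countably generated, hence can be moved to \<open>univ\<close>, although the index set of the product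
  may be larger.\<close>

lemma universal_family:
  fixes B :: "'k \<Rightarrow> 'b cstar_alg" and v :: "'k \<Rightarrow> 'g \<Rightarrow> 'b"
  assumes B: "\<And>k. k \<in> K \<Longrightarrow> cstar_algebra (B k)"
    and v: "\<And>k g. k \<in> K \<Longrightarrow> g \<in> J \<Longrightarrow> v k g \<in> carrier (B k)"
      "\<And>k g. k \<in> K \<Longrightarrow> g \<in> J \<Longrightarrow> nrm (B k) (v k g) \<le> 1"
    and J: "countable J"
  obtains U :: "univ cstar_alg" and w p where "cstar_algebra U" "w ` J \<subseteq> carrier U"
    "cstar_gen U (w ` J) = carrier U"
    "\<And>k. k \<in> K \<Longrightarrow> p k \<in> star_hom U (B k)"
    "\<And>k g. k \<in> K \<Longrightarrow> g \<in> J \<Longrightarrow> p k (w g) = v k g"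
    "\<And>x y. x \<in> carrier U \<Longrightarrow> y \<in> carrier U \<Longrightarrow> (\<And>k. k \<in> K \<Longrightarrow> p k x = p k y) \<Longrightarrow> x = y"
proof -
  define P where "P = prod_alg K B"
  define d where "d g = (\<lambda>k\<in>K. v k g)" for g
  interpret P: cstar_algebra P unfolding P_def using B by (rule cstar_algebra_prod_alg)
  \<comment> \<open>The uniform bound on the generators is what places the diagonal families in the
    bounded product.\<close>
  have d: "d ` J \<subseteq> carrier P"
    unfolding d_def P_def using v by (auto intro!: prod_alg_carrierI[of K B, OF B])
  define C where "C = P\<lparr>carrier := cstar_gen P (d ` J)\<rparr>"
  have sub: "cstar_subalgebra P (cstar_gen P (d ` J))" using d by (rule P.cstar_subalgebra_cstar_gen)
  have C: "cstar_algebra C" unfolding C_def using sub by (intro cstar_algebra_subalgebra) unfold_locales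
  have incl: "(\<lambda>x. x) \<in> star_hom C P"
    unfolding C_def using sub by (intro star_hom_inclusion) (simp add: cstar_subalgebra_def)
  obtain f :: "('k \<Rightarrow> 'b) \<Rightarrow> univ" where "inj_on f (cstar_gen P (d ` J))"
    by (rule countably_generated_embedding[OF P.cstar_algebra_axioms countable_image[OF J] d])
  then have f: "inj_on f (carrier C)" by (simp add: C_def)
  let ?U = "transport f C" and ?g = "the_inv_into (carrier C) f"
  note T = transport[OF C f]
  interpret f: cstar_algebra_hom C ?U f by (intro cstar_algebra_homI C T)
  have dJ: "d ` J \<subseteq> carrier C" by (simp add: C_def cstar_gen_superset)
  have carr: "f ` carrier C = carrier ?U" by (simp add: transport_def Let_def)
  show thesis
  proof (rule that[of ?U "\<lambda>g. f (d g)" "\<lambda>k x. ?g x k"])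
    show "cstar_algebra ?U" by (rule T)
    show "(\<lambda>g. f (d g)) ` J \<subseteq> carrier ?U" using dJ by auto
    have "cstar_gen C (d ` J) = carrier C"
      unfolding C_def using cstar_gen_subalgebra[OF P.cstar_algebra_axioms d] by simp
    then show "cstar_gen ?U ((\<lambda>g. f (d g)) ` J) = carrier ?U"
      using f.cstar_gen_image[OF carr dJ] by (simp add: image_image)
    show "(\<lambda>x. ?g x k) \<in> star_hom ?U (B k)" if "k \<in> K" for k
      using star_hom_comp[OF star_hom_comp[OF T(3) incl], of "\<lambda>x. x k" "B k"]
        prod_alg_projection[of K B, OF B that] by (simp add: P_def)
    show "?g (f (d g)) k = v k g" if "k \<in> K" "g \<in> J" for k g
      using the_inv_into_f_f[OF f, of "d g"] dJ that by (auto simp: d_def)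
    show "x = y" if "x \<in> carrier ?U" "y \<in> carrier ?U" "\<And>k. k \<in> K \<Longrightarrow> ?g x k = ?g y k" for x y
    proof -
      have "?g x \<in> carrier P" "?g y \<in> carrier P" using that star_homD(1)[OF star_hom_comp[OF T(3) incl]] by auto
      then have "?g x = ?g y"
        unfolding P_def using that(3) by (intro prod_alg_ext[of K B, OF B]) auto
      then show ?thesis using that f by (metis carr f_the_inv_into_f)
    qed
  qed
qed

section \<open>Magic unitaries and intertwiners\<close>

lemma finite_idx [simp, intro]: "finite (idx n k)"
  using finite_lists_length_eq[of "{..<n}" k] by (simp add: idx_def conj_commute)

lemma idx_0 [simp]: "idx n 0 = {[]}"
  by (auto simp: idx_def)

lemma Cons_in_idx [simp]: "i # a \<in> idx n (Suc k) \<longleftrightarrow> i < n \<and> a \<in> idx n k"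
  by (auto simp: idx_def)

lemma idx_SucE:
  assumes "a \<in> idx n (Suc k)" obtains i b where "a = i # b" "i < n" "b \<in> idx n k"
  using assms by (cases a) (auto simp: idx_def)

lemma (in abelian_monoid) finsum_idx_Suc:
  assumes "\<And>i c. i < n \<Longrightarrow> c \<in> idx n k \<Longrightarrow> f (i # c) \<in> carrier G"
  shows "(\<Oplus>c\<in>idx n (Suc k). f c) = (\<Oplus>i\<in>{..<n}. \<Oplus>c\<in>idx n k. f (i # c))"
proof -
  have "idx n (Suc k) = (\<Union>i\<in>{..<n}. (#) i ` idx n k)"
    by (auto elim!: idx_SucE)
  moreover have "(\<Oplus>c\<in>(\<Union>i\<in>{..<n}. (#) i ` idx n k). f c) = (\<Oplus>i\<in>{..<n}. \<Oplus>c\<in>(#) i ` idx n k. f c)"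
    using assms by (intro add.finprod_UN_disjoint) (auto simp: pairwise_def disjnt_def)
  moreover have "\<dots> = (\<Oplus>i\<in>{..<n}. \<Oplus>c\<in>idx n k. f (i # c))"
  proof (rule finsum_cong'[OF refl])
    fix i assume "i \<in> {..<n}"
    then show "(\<Oplus>c\<in>(#) i ` idx n k. f c) = (\<Oplus>c\<in>idx n k. f (i # c))"
      using assms by (intro finsum_reindex) auto
  qed (use assms in \<open>auto intro!: finsum_closed\<close>)
  ultimately show ?thesis by simp
qed

lemma tensor_power_simps [simp]:
  "tensor_power A u [] b = \<one>\<^bsub>A\<^esub>"
  "tensor_power A u (i # a) (j # b) = u i j \<otimes>\<^bsub>A\<^esub> tensor_power A u a b"
  by (simp_all add: tensor_power_def)

lemma tensor_power_cong:
  assumes "a \<in> idx n k" "b \<in> idx n k" "\<And>i j. i < n \<Longrightarrow> j < n \<Longrightarrow> u i j = v i j"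
  shows "tensor_power A u a b = tensor_power A v a b"
  using assms(1,2)
proof (induction k arbitrary: a b)
  case (Suc k)
  then show ?case using assms(3) by (auto elim!: idx_SucE)
qed simp

lemma Hom_in_mats: "T \<in> Hom A n u k l \<Longrightarrow> T \<in> mats n l k"
  by (simp add: Hom_def)

lemma HomD:
  assumes "T \<in> Hom A n u k l" "a \<in> idx n l" "b \<in> idx n k"
  shows "(\<Oplus>\<^bsub>A\<^esub>c\<in>idx n k. T a c \<odot>\<^bsub>A\<^esub> tensor_power A u c b) = (\<Oplus>\<^bsub>A\<^esub>c\<in>idx n l. T c b \<odot>\<^bsub>A\<^esub> tensor_power A u a c)"
  using assms unfolding Hom_def by blast

section \<open>Magic unitaries: rules, congruence, images under homomorphisms\<close>

lemma magic_unitaryD: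
  assumes "magic_unitary A n u" "i < n" "j < n"
  shows "u i j \<in> carrier A" "star A (u i j) = u i j"
    "m < n \<Longrightarrow> u i j \<otimes>\<^bsub>A\<^esub> u i m = (if j = m then u i j else \<zero>\<^bsub>A\<^esub>)"
    "m < n \<Longrightarrow> u i j \<otimes>\<^bsub>A\<^esub> u m j = (if i = m then u i j else \<zero>\<^bsub>A\<^esub>)"
  using assms unfolding magic_unitary_def by auto

lemma magic_unitary_sums:
  assumes "magic_unitary A n u"
  shows "i < n \<Longrightarrow> (\<Oplus>\<^bsub>A\<^esub>j\<in>{..<n}. u i j) = \<one>\<^bsub>A\<^esub>"
    "j < n \<Longrightarrow> (\<Oplus>\<^bsub>A\<^esub>i\<in>{..<n}. u i j) = \<one>\<^bsub>A\<^esub>"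
  using assms unfolding magic_unitary_def by auto

lemma magic_unitaryI:
  assumes "\<And>i j. i < n \<Longrightarrow> j < n \<Longrightarrow> u i j \<in> carrier A"
    and "\<And>i j. i < n \<Longrightarrow> j < n \<Longrightarrow> star A (u i j) = u i j"
    and row: "\<And>i j m. i < n \<Longrightarrow> j < n \<Longrightarrow> m < n \<Longrightarrow> u i j \<otimes>\<^bsub>A\<^esub> u i m = (if j = m then u i j else \<zero>\<^bsub>A\<^esub>)"
    and col: "\<And>i j m. i < n \<Longrightarrow> j < n \<Longrightarrow> m < n \<Longrightarrow> u i j \<otimes>\<^bsub>A\<^esub> u m j = (if i = m then u i j else \<zero>\<^bsub>A\<^esub>)"
    and "\<And>i. i < n \<Longrightarrow> (\<Oplus>\<^bsub>A\<^esub>j\<in>{..<n}. u i j) = \<one>\<^bsub>A\<^esub>"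
    and "\<And>j. j < n \<Longrightarrow> (\<Oplus>\<^bsub>A\<^esub>i\<in>{..<n}. u i j) = \<one>\<^bsub>A\<^esub>"
  shows "magic_unitary A n u"
  unfolding magic_unitary_def using assms by simp

lemma magic_unitary_nrm_le_1:
  assumes "cstar_algebra A" "magic_unitary A n u" "i < n" "j < n"
  shows "nrm A (u i j) \<le> 1"
proof -
  interpret cstar_algebra A by fact
  show ?thesis
    using magic_unitaryD[OF assms(2-4)] assms(4) by (intro nrm_projection_le_1) auto
qed

lemma entries_eq_image: "entries n u = (\<lambda>(i, j). u i j) ` ({..<n} \<times> {..<n})"
  by (auto simp: entries_def)

lemma entries_subset_iff: "entries n u \<subseteq> C \<longleftrightarrow> (\<forall>i<n. \<forall>j<n. u i j \<in> C)"
  by (auto simp: entries_def)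

context star_algebra
begin

lemma tensor_power_closed:
  assumes "\<And>i j. i < n \<Longrightarrow> j < n \<Longrightarrow> u i j \<in> carrier A" "a \<in> idx n k" "b \<in> idx n k"
  shows "tensor_power A u a b \<in> carrier A"
  using assms(2,3)
proof (induction k arbitrary: a b)
  case (Suc k)
  then show ?case using assms(1) by (auto elim!: idx_SucE)
qed simp

lemma Hom_cong:
  assumes eq: "\<And>i j. i < n \<Longrightarrow> j < n \<Longrightarrow> u i j = v i j"
    and closed: "\<And>i j. i < n \<Longrightarrow> j < n \<Longrightarrow> v i j \<in> carrier A"
  shows "Hom A n u k l = Hom A n v k l"
proof -
  note tp = tensor_power_cong[of _ n _ _ u v, OF _ _ eq] and tc = tensor_power_closed[of n v, OF closed]
  have "(\<Oplus>c\<in>idx n k. T a c \<odot> tensor_power A u c b) = (\<Oplus>c\<in>idx n k. T a c \<odot> tensor_power A v c b)"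
      "(\<Oplus>c\<in>idx n l. T c b \<odot> tensor_power A u a c) = (\<Oplus>c\<in>idx n l. T c b \<odot> tensor_power A v a c)"
    if "a \<in> idx n l" "b \<in> idx n k" for a b and T :: multimat
    using that by (intro finsum_cong'; simp add: tp tc Pi_def)+
  then show ?thesis unfolding Hom_def by auto
qed

lemma magic_unitary_cong:
  assumes eq: "\<And>i j. i < n \<Longrightarrow> j < n \<Longrightarrow> u i j = v i j" and v: "magic_unitary A n v"
  shows "magic_unitary A n u"
proof (rule magic_unitaryI)
  note D = magic_unitaryD[OF v]
  show "(\<Oplus>j\<in>{..<n}. u i j) = \<one>" if "i < n" for i
    unfolding magic_unitary_sums(1)[OF v that, symmetric] using eq that D(1) by (intro finsum_cong') auto
  show "(\<Oplus>i\<in>{..<n}. u i j) = \<one>" if "j < n" for j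
    unfolding magic_unitary_sums(2)[OF v that, symmetric] using eq that D(1) by (intro finsum_cong') auto
qed (simp_all add: eq magic_unitaryD[OF v])

end

context star_algebra_hom
begin

lemma hom_tensor_power:
  assumes "\<And>i j. i < n \<Longrightarrow> j < n \<Longrightarrow> u i j \<in> carrier A" "a \<in> idx n k" "b \<in> idx n k"
  shows "\<phi> (tensor_power A u a b) = tensor_power B (\<lambda>i j. \<phi> (u i j)) a b"
  using assms(2,3)
proof (induction k arbitrary: a b)
  case (Suc k)
  then show ?case using assms(1) A.tensor_power_closed[of n u, OF assms(1)]
    by (auto elim!: idx_SucE simp: hom_mult)
qed (simp add: hom_one)

lemma hom_intertwiner:
  assumes u: "\<And>i j. i < n \<Longrightarrow> j < n \<Longrightarrow> u i j \<in> carrier A" and ab: "a \<in> idx n l" "b \<in> idx n k"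
  shows "\<phi> (\<Oplus>\<^bsub>A\<^esub>c\<in>idx n k. T a c \<odot>\<^bsub>A\<^esub> tensor_power A u c b) =
      (\<Oplus>\<^bsub>B\<^esub>c\<in>idx n k. T a c \<odot>\<^bsub>B\<^esub> tensor_power B (\<lambda>i j. \<phi> (u i j)) c b)"
    and "\<phi> (\<Oplus>\<^bsub>A\<^esub>c\<in>idx n l. T c b \<odot>\<^bsub>A\<^esub> tensor_power A u a c) =
      (\<Oplus>\<^bsub>B\<^esub>c\<in>idx n l. T c b \<odot>\<^bsub>B\<^esub> tensor_power B (\<lambda>i j. \<phi> (u i j)) a c)"
proof -
  note tc = A.tensor_power_closed[of n u, OF u]
    and tcB = B.tensor_power_closed[of n "\<lambda>i j. \<phi> (u i j)", OF hom_closed[OF u]]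
  show "\<phi> (\<Oplus>\<^bsub>A\<^esub>c\<in>idx n k. T a c \<odot>\<^bsub>A\<^esub> tensor_power A u c b) =
      (\<Oplus>\<^bsub>B\<^esub>c\<in>idx n k. T a c \<odot>\<^bsub>B\<^esub> tensor_power B (\<lambda>i j. \<phi> (u i j)) c b)"
    using ab by (subst hom_finsum)
      (auto simp: tc hom_smult hom_tensor_power[of n u, OF u] intro!: B.finsum_cong' tcB)
  show "\<phi> (\<Oplus>\<^bsub>A\<^esub>c\<in>idx n l. T c b \<odot>\<^bsub>A\<^esub> tensor_power A u a c) =
      (\<Oplus>\<^bsub>B\<^esub>c\<in>idx n l. T c b \<odot>\<^bsub>B\<^esub> tensor_power B (\<lambda>i j. \<phi> (u i j)) a c)"
    using ab by (subst hom_finsum)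
      (auto simp: tc hom_smult hom_tensor_power[of n u, OF u] intro!: B.finsum_cong' tcB)
qed

lemma Hom_image:
  assumes "\<And>i j. i < n \<Longrightarrow> j < n \<Longrightarrow> u i j \<in> carrier A" "T \<in> Hom A n u k l"
  shows "T \<in> Hom B n (\<lambda>i j. \<phi> (u i j)) k l"
proof -
  have "(\<Oplus>\<^bsub>B\<^esub>c\<in>idx n k. T a c \<odot>\<^bsub>B\<^esub> tensor_power B (\<lambda>i j. \<phi> (u i j)) c b) =
      (\<Oplus>\<^bsub>B\<^esub>c\<in>idx n l. T c b \<odot>\<^bsub>B\<^esub> tensor_power B (\<lambda>i j. \<phi> (u i j)) a c)"
    if ab: "a \<in> idx n l" "b \<in> idx n k" for a b
    using arg_cong[OF HomD[OF assms(2) ab], of \<phi>] by (simp only: hom_intertwiner[of n u, OF assms(1) ab])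
  then show ?thesis using Hom_in_mats[OF assms(2)] by (simp add: Hom_def)
qed

lemma magic_unitary_image:
  assumes "magic_unitary A n u" shows "magic_unitary B n (\<lambda>i j. \<phi> (u i j))"
proof (rule magic_unitaryI)
  note u = magic_unitaryD[OF assms]
  show "(\<Oplus>\<^bsub>B\<^esub>j\<in>{..<n}. \<phi> (u i j)) = \<one>\<^bsub>B\<^esub>" if "i < n" for i
    using hom_finsum[of "{..<n}" "u i"] u magic_unitary_sums(1)[OF assms that] that by (simp add: hom_one)
  show "(\<Oplus>\<^bsub>B\<^esub>i\<in>{..<n}. \<phi> (u i j)) = \<one>\<^bsub>B\<^esub>" if "j < n" for j
    using hom_finsum[of "{..<n}" "\<lambda>i. u i j"] u magic_unitary_sums(2)[OF assms that] that
    by (simp add: hom_one)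
qed (use magic_unitaryD[OF assms] in \<open>simp_all add: hom_zero flip: hom_mult hom_star\<close>)

end

text \<open>Relations between generators may be checked in the target algebras. The family is either
  all models of a universal algebra or a single injective homomorphism.\<close>

locale jointly_injective = star_algebra A for A :: "'a cstar_alg" +
  fixes K :: "'k set" and B :: "'k \<Rightarrow> 'b cstar_alg" and p :: "'k \<Rightarrow> 'a \<Rightarrow> 'b"
  assumes algebras: "k \<in> K \<Longrightarrow> star_algebra (B k)"
    and homs: "k \<in> K \<Longrightarrow> p k \<in> star_hom A (B k)"
    and jointly_inj: "\<lbrakk>x \<in> carrier A; y \<in> carrier A; \<And>k. k \<in> K \<Longrightarrow> p k x = p k y\<rbrakk> \<Longrightarrow> x = y"
begin

lemma component: "k \<in> K \<Longrightarrow> star_algebra_hom A (B k) (p k)"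
  unfolding star_algebra_hom_def star_algebra_hom_axioms_def
  using algebras homs star_algebra_axioms by blast

lemma Hom_reflect:
  assumes u: "\<And>i j. i < n \<Longrightarrow> j < n \<Longrightarrow> u i j \<in> carrier A" and T: "T \<in> mats n l k"
    and T_Hom: "\<And>m. m \<in> K \<Longrightarrow> T \<in> Hom (B m) n (\<lambda>i j. p m (u i j)) k l"
  shows "T \<in> Hom A n u k l"
proof -
  have "(\<Oplus>\<^bsub>A\<^esub>c\<in>idx n k. T a c \<odot>\<^bsub>A\<^esub> tensor_power A u c b) = (\<Oplus>\<^bsub>A\<^esub>c\<in>idx n l. T c b \<odot>\<^bsub>A\<^esub> tensor_power A u a c)"
    if ab: "a \<in> idx n l" "b \<in> idx n k" for a b
  proof (rule jointly_inj)
    fix m assume m: "m \<in> K"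
    interpret star_algebra_hom A "B m" "p m" by (rule component[OF m])
    show "p m (\<Oplus>\<^bsub>A\<^esub>c\<in>idx n k. T a c \<odot>\<^bsub>A\<^esub> tensor_power A u c b) =
        p m (\<Oplus>\<^bsub>A\<^esub>c\<in>idx n l. T c b \<odot>\<^bsub>A\<^esub> tensor_power A u a c)"
      using HomD[OF T_Hom[OF m] ab] ab by (simp add: hom_intertwiner[of n u, OF u])
  qed (use ab in \<open>auto intro!: finsum_closed tensor_power_closed[of n u, OF u]\<close>)
  then show ?thesis using T by (simp add: Hom_def)
qed

lemma magic_unitary_reflect:
  assumes u: "\<And>i j. i < n \<Longrightarrow> j < n \<Longrightarrow> u i j \<in> carrier A"
    and magic: "\<And>m. m \<in> K \<Longrightarrow> magic_unitary (B m) n (\<lambda>i j. p m (u i j))"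
  shows "magic_unitary A n u"
proof -
  note hom = star_algebra_hom.hom_mult[OF component] star_algebra_hom.hom_star[OF component]
    star_algebra_hom.hom_zero[OF component] star_algebra_hom.hom_one[OF component]
  show ?thesis
  proof (rule magic_unitaryI; (rule jointly_inj)?)
    show "(\<Oplus>\<^bsub>A\<^esub>j\<in>{..<n}. u i j) \<in> carrier A" if "i < n" for i
      using that by (auto intro!: finsum_closed simp: u)
    show "(\<Oplus>\<^bsub>A\<^esub>i\<in>{..<n}. u i j) \<in> carrier A" if "j < n" for j
      using that by (auto intro!: finsum_closed simp: u)
    fix m assume m: "m \<in> K"
    show "p m (\<Oplus>\<^bsub>A\<^esub>j\<in>{..<n}. u i j) = p m \<one>\<^bsub>A\<^esub>" if "i < n" for i
      using star_algebra_hom.hom_finsum[OF component[OF m], of "{..<n}" "u i"] u that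
        magic_unitary_sums(1)[OF magic[OF m] that] by (simp add: hom m)
    show "p m (\<Oplus>\<^bsub>A\<^esub>i\<in>{..<n}. u i j) = p m \<one>\<^bsub>A\<^esub>" if "j < n" for j
      using star_algebra_hom.hom_finsum[OF component[OF m], of "{..<n}" "\<lambda>i. u i j"] u that
        magic_unitary_sums(2)[OF magic[OF m] that] by (simp add: hom m)
  qed (simp_all add: u hom magic_unitaryD[OF magic])
qed

end

lemma jointly_injective_single:
  assumes "star_algebra A" "star_algebra B" "\<phi> \<in> star_hom A B" "inj_on \<phi> (carrier A)"
  shows "jointly_injective A {()} (\<lambda>_. B) (\<lambda>_. \<phi>)"
  using assms unfolding jointly_injective_def jointly_injective_axioms_def by (auto dest: inj_onD)

subsection \<open>The inverse magic unitary\<close>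

lemma (in star_algebra) magic_unitary_opposite:
  "magic_unitary A n u \<Longrightarrow> magic_unitary (opposite A) n (\<lambda>i j. u j i)"
  by (rule magic_unitaryI) (auto simp: magic_unitaryD[of A n u] magic_unitary_sums[of A n u])

context star_algebra
begin

context
  fixes n u assumes magic: "magic_unitary A n u"
begin

lemma magic_closed: "i < n \<Longrightarrow> j < n \<Longrightarrow> u i j \<in> carrier A"
  using magic by (rule magic_unitaryD)

lemmas tp_closed = tensor_power_closed[of n u, OF magic_closed]

text \<open>The entries are self-adjoint, so reversing a word amounts to taking its adjoint; this
  identifies the relation needed for the antipode with one between adjoints.\<close>

lemma tensor_power_opposite:
  "a \<in> idx n k \<Longrightarrow> b \<in> idx n k \<Longrightarrow>
    tensor_power (opposite A) (\<lambda>i j. u j i) a b = star A (tensor_power A u b a)"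
proof (induction k arbitrary: a b)
  case (Suc k)
  then show ?case using magic_unitaryD[OF magic]
    by (auto elim!: idx_SucE simp: star_mult tp_closed[where k = k])
qed simp

text \<open>The first letters of the two words meet in the middle of the product. Hence the sum over
  their row index is carried out first: row orthogonality forces \<open>i = j\<close>, and a column
  sum gives the unit, leaving the shorter words.\<close>

lemma tensor_power_isometry:
  "a \<in> idx n k \<Longrightarrow> b \<in> idx n k \<Longrightarrow>
    (\<Oplus>c\<in>idx n k. star A (tensor_power A u c a) \<otimes> tensor_power A u c b) = (if a = b then \<one> else \<zero>)"
proof (induction k arbitrary: a b)
  case (Suc k)
  then obtain i a' j b' where [simp]: "a = i # a'" "b = j # b'"
    and ij [simp]: "i < n" "j < n" "a' \<in> idx n k" "b' \<in> idx n k"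
    by (auto elim!: idx_SucE)
  let ?t = "tensor_power A u"
  note [simp] = magic_closed tp_closed[where k = k] tp_closed[where k = "Suc k"]
  have "(\<Oplus>c\<in>idx n (Suc k). star A (?t c a) \<otimes> ?t c b) =
      (\<Oplus>m\<in>{..<n}. \<Oplus>c\<in>idx n k. star A (?t (m # c) a) \<otimes> ?t (m # c) b)"
    by (rule finsum_idx_Suc) simp
  also have "\<dots> = (\<Oplus>c\<in>idx n k. \<Oplus>m\<in>{..<n}. star A (?t (m # c) a) \<otimes> ?t (m # c) b)"
    by (rule finsum_swap) simp_all
  also have "\<dots> = (\<Oplus>c\<in>idx n k. if i = j then star A (?t c a') \<otimes> ?t c b' else \<zero>)"
  proof (intro finsum_cong' refl)
    fix c assume c: "c \<in> idx n k"
    have "(\<Oplus>m\<in>{..<n}. star A (?t (m # c) a) \<otimes> ?t (m # c) b) =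
        (\<Oplus>m\<in>{..<n}. (if i = j then star A (?t c a') \<otimes> u m j else \<zero>) \<otimes> ?t c b')"
    proof (intro finsum_cong' refl)
      fix m assume m: "m \<in> {..<n}"
      have "star A (?t (m # c) a) \<otimes> ?t (m # c) b = (star A (?t c a') \<otimes> u m i) \<otimes> (u m j \<otimes> ?t c b')"
        using c m magic_unitaryD(2)[OF magic] by (simp add: star_mult)
      also have "\<dots> = (star A (?t c a') \<otimes> (u m i \<otimes> u m j)) \<otimes> ?t c b'"
        using c m by (simp add: m_assoc)
      finally show "star A (?t (m # c) a) \<otimes> ?t (m # c) b =
          (if i = j then star A (?t c a') \<otimes> u m j else \<zero>) \<otimes> ?t c b'"
        using c m magic_unitaryD(3)[OF magic] by auto
    qed (use c in auto)
    also have "\<dots> = (\<Oplus>m\<in>{..<n}. if i = j then star A (?t c a') \<otimes> u m j else \<zero>) \<otimes> ?t c b'"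
      using c by (intro finsum_ldistr[symmetric]) auto
    also have "(\<Oplus>m\<in>{..<n}. if i = j then star A (?t c a') \<otimes> u m j else \<zero>) =
        (if i = j then star A (?t c a') \<otimes> (\<Oplus>m\<in>{..<n}. u m j) else \<zero>)"
      using c by (auto intro!: finsum_rdistr[symmetric])
    finally show "(\<Oplus>m\<in>{..<n}. star A (?t (m # c) a) \<otimes> ?t (m # c) b) =
        (if i = j then star A (?t c a') \<otimes> ?t c b' else \<zero>)"
      using c magic_unitary_sums(2)[OF magic] by auto
  qed auto
  also have "\<dots> = (if a = b then \<one> else \<zero>)"
    using Suc.IH[of a' b'] by (cases "i = j") auto
  finally show ?case .
qed auto

text \<open>Here the first letters are outermost, so the shorter words are contracted first; then
  column orthogonality forces \<open>i = j\<close> and a row sum gives the unit.\<close>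

lemma tensor_power_coisometry:
  "a \<in> idx n k \<Longrightarrow> b \<in> idx n k \<Longrightarrow>
    (\<Oplus>c\<in>idx n k. tensor_power A u a c \<otimes> star A (tensor_power A u b c)) = (if a = b then \<one> else \<zero>)"
proof (induction k arbitrary: a b)
  case (Suc k)
  then obtain i a' j b' where [simp]: "a = i # a'" "b = j # b'"
    and ij [simp]: "i < n" "j < n" "a' \<in> idx n k" "b' \<in> idx n k"
    by (auto elim!: idx_SucE)
  let ?t = "tensor_power A u"
  note [simp] = magic_closed tp_closed[where k = k] tp_closed[where k = "Suc k"]
  have "(\<Oplus>c\<in>idx n (Suc k). ?t a c \<otimes> star A (?t b c)) =
      (\<Oplus>m\<in>{..<n}. \<Oplus>c\<in>idx n k. ?t a (m # c) \<otimes> star A (?t b (m # c)))"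
    by (rule finsum_idx_Suc) simp
  also have "\<dots> = (\<Oplus>m\<in>{..<n}. if a = b then u i m else \<zero>)"
  proof (intro finsum_cong' refl)
    fix m assume m: "m \<in> {..<n}"
    have "(\<Oplus>c\<in>idx n k. ?t a (m # c) \<otimes> star A (?t b (m # c))) =
        (\<Oplus>c\<in>idx n k. u i m \<otimes> (?t a' c \<otimes> star A (?t b' c)) \<otimes> u j m)"
      using m magic_unitaryD(2)[OF magic] by (intro finsum_cong') (auto simp: star_mult m_assoc)
    also have "\<dots> = u i m \<otimes> (\<Oplus>c\<in>idx n k. ?t a' c \<otimes> star A (?t b' c)) \<otimes> u j m"
      using m by (simp add: finsum_ldistr finsum_rdistr Pi_def)
    also have "\<dots> = (if a = b then u i m else \<zero>)"
      using Suc.IH[of a' b'] m magic_unitaryD(4)[OF magic] by auto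
    finally show "(\<Oplus>c\<in>idx n k. ?t a (m # c) \<otimes> star A (?t b (m # c))) = (if a = b then u i m else \<zero>)" .
  qed auto
  also have "\<dots> = (if a = b then \<one> else \<zero>)"
    using magic_unitary_sums(1)[OF magic] by auto
  finally show ?case .
qed auto

text \<open>With \<open>V = u\<^sup>\<otimes>\<^sup>k\<close> and \<open>W = u\<^sup>\<otimes>\<^sup>l\<close> unitary, multiplying \<open>T V = W T\<close> by \<open>W\<^sup>*\<close> on the left and
  by \<open>V\<^sup>*\<close> on the right gives \<open>W\<^sup>* T = T V\<^sup>*\<close>.\<close>

lemma Hom_opposite:
  assumes T: "T \<in> Hom A n u k l"
  shows "T \<in> Hom (opposite A) n (\<lambda>i j. u j i) k l"
proof -
  let ?t = "tensor_power A u"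
  note [simp] = tp_closed[where k = k] tp_closed[where k = l]
  have "(\<Oplus>c\<in>idx n k. T a c \<odot> star A (?t b c)) = (\<Oplus>d\<in>idx n l. T d b \<odot> star A (?t d a))"
    if ab: "a \<in> idx n l" "b \<in> idx n k" for a b
  proof -
    \<comment> \<open>With V and W the tensor powers of order \<open>k\<close> and \<open>l\<close>,
      \<open>X\<close> is the entry at \<open>a\<close>, \<open>b\<close> of the product of the
      adjoint of W, of T V and of the adjoint of V. Contracting V with its adjoint gives one side of
      the claim; replacing T V by W T and contracting W with its adjoint gives the other.\<close>
    define X where "X = (\<Oplus>d\<in>idx n l. \<Oplus>e\<in>idx n k.
      star A (?t d a) \<otimes> (\<Oplus>c\<in>idx n k. T d c \<odot> ?t c e) \<otimes> star A (?t b e))"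
    have "X = (\<Oplus>d\<in>idx n l. T d b \<odot> star A (?t d a))"
      unfolding X_def
    proof (intro finsum_cong' refl)
      fix d assume d: "d \<in> idx n l"
      have "(\<Oplus>e\<in>idx n k. star A (?t d a) \<otimes> (\<Oplus>c\<in>idx n k. T d c \<odot> ?t c e) \<otimes> star A (?t b e)) =
          (\<Oplus>e\<in>idx n k. star A (?t d a) \<otimes> ((\<Oplus>c\<in>idx n k. T d c \<odot> ?t c e) \<otimes> star A (?t b e)))"
        using ab d by (intro finsum_cong') (auto simp: m_assoc Pi_def)
      also have "\<dots> = star A (?t d a) \<otimes> (\<Oplus>e\<in>idx n k. (\<Oplus>c\<in>idx n k. T d c \<odot> ?t c e) \<otimes> star A (?t b e))"
        using ab d by (intro finsum_rdistr[symmetric]) (auto simp: Pi_def)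
      also have "(\<Oplus>e\<in>idx n k. (\<Oplus>c\<in>idx n k. T d c \<odot> ?t c e) \<otimes> star A (?t b e)) =
          (\<Oplus>e\<in>idx n k. \<Oplus>c\<in>idx n k. T d c \<odot> (?t c e \<otimes> star A (?t b e)))"
        using ab d by (intro finsum_cong') (auto simp: finsum_ldistr smult_mult_left Pi_def intro!: finsum_cong')
      also have "\<dots> = (\<Oplus>c\<in>idx n k. \<Oplus>e\<in>idx n k. T d c \<odot> (?t c e \<otimes> star A (?t b e)))"
        using ab d by (intro finsum_swap) auto
      also have "\<dots> = (\<Oplus>c\<in>idx n k. if c = b then T d c \<odot> \<one> else \<zero>)"
        using ab d by (intro finsum_cong') (auto simp: tensor_power_coisometry simp flip: finsum_smult)
      also have "\<dots> = T d b \<odot> \<one>"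
        using ab by (intro finsum_delta) auto
      finally show "(\<Oplus>e\<in>idx n k. star A (?t d a) \<otimes> (\<Oplus>c\<in>idx n k. T d c \<odot> ?t c e) \<otimes> star A (?t b e)) =
          T d b \<odot> star A (?t d a)"
        using ab d by (simp add: smult_mult_right)
    qed (use ab in auto)
    moreover have "X = (\<Oplus>e\<in>idx n k. T a e \<odot> star A (?t b e))"
    proof -
      have "X = (\<Oplus>d\<in>idx n l. \<Oplus>e\<in>idx n k.
          star A (?t d a) \<otimes> (\<Oplus>c\<in>idx n l. T c e \<odot> ?t d c) \<otimes> star A (?t b e))"
        unfolding X_def using ab by (intro finsum_cong') (auto simp: HomD[OF T] Pi_def intro!: finsum_closed)
      also have "\<dots> = (\<Oplus>e\<in>idx n k. \<Oplus>d\<in>idx n l.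
          star A (?t d a) \<otimes> (\<Oplus>c\<in>idx n l. T c e \<odot> ?t d c) \<otimes> star A (?t b e))"
        using ab by (intro finsum_swap) (auto simp: Pi_def)
      also have "\<dots> = (\<Oplus>e\<in>idx n k. T a e \<odot> star A (?t b e))"
      proof (intro finsum_cong' refl)
        fix e assume e: "e \<in> idx n k"
        have "(\<Oplus>d\<in>idx n l. star A (?t d a) \<otimes> (\<Oplus>c\<in>idx n l. T c e \<odot> ?t d c) \<otimes> star A (?t b e)) =
            (\<Oplus>d\<in>idx n l. star A (?t d a) \<otimes> (\<Oplus>c\<in>idx n l. T c e \<odot> ?t d c)) \<otimes> star A (?t b e)"
          using ab e by (intro finsum_ldistr[symmetric]) (auto simp: Pi_def)
        also have "(\<Oplus>d\<in>idx n l. star A (?t d a) \<otimes> (\<Oplus>c\<in>idx n l. T c e \<odot> ?t d c)) =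
            (\<Oplus>d\<in>idx n l. \<Oplus>c\<in>idx n l. T c e \<odot> (star A (?t d a) \<otimes> ?t d c))"
          using ab e by (intro finsum_cong') (auto simp: finsum_rdistr smult_mult_right Pi_def intro!: finsum_cong')
        also have "\<dots> = (\<Oplus>c\<in>idx n l. \<Oplus>d\<in>idx n l. T c e \<odot> (star A (?t d a) \<otimes> ?t d c))"
          using ab e by (intro finsum_swap) auto
        also have "\<dots> = (\<Oplus>c\<in>idx n l. if c = a then T c e \<odot> \<one> else \<zero>)"
          using ab e by (intro finsum_cong') (auto simp: tensor_power_isometry simp flip: finsum_smult)
        also have "\<dots> = T a e \<odot> \<one>"
          using ab by (intro finsum_delta) auto
        finally show "(\<Oplus>d\<in>idx n l. star A (?t d a) \<otimes> (\<Oplus>c\<in>idx n l. T c e \<odot> ?t d c) \<otimes> star A (?t b e)) =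
            T a e \<odot> star A (?t b e)"
          using ab e by (simp add: smult_mult_left)
      qed (use ab in auto)
      finally show ?thesis .
    qed
    ultimately show ?thesis by simp
  qed
  moreover have "(\<Oplus>c\<in>idx n k. T a c \<odot> tensor_power (opposite A) (\<lambda>i j. u j i) c b) =
      (\<Oplus>c\<in>idx n k. T a c \<odot> star A (?t b c))"
    "(\<Oplus>c\<in>idx n l. T c b \<odot> tensor_power (opposite A) (\<lambda>i j. u j i) a c) =
      (\<Oplus>d\<in>idx n l. T d b \<odot> star A (?t d a))" if "a \<in> idx n l" "b \<in> idx n k" for a b
    using that by (intro finsum_cong'; simp add: tensor_power_opposite Pi_def)+
  ultimately show ?thesis
    using Hom_in_mats[OF T] by (simp add: Hom_def)
qed

end

end

subsection \<open>Products of commuting magic unitaries\<close>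

context star_algebra
begin

lemma tensor_power_commute:
  assumes u: "\<And>i j. i < n \<Longrightarrow> j < n \<Longrightarrow> u i j \<in> carrier A" and x: "x \<in> carrier A"
    and comm: "\<And>i j. i < n \<Longrightarrow> j < n \<Longrightarrow> u i j \<otimes> x = x \<otimes> u i j"
  shows "a \<in> idx n k \<Longrightarrow> b \<in> idx n k \<Longrightarrow> tensor_power A u a b \<otimes> x = x \<otimes> tensor_power A u a b"
proof (induction k arbitrary: a b)
  case (Suc k)
  then obtain i a' j b' where [simp]: "a = i # a'" "b = j # b'"
    and ij [simp]: "i < n" "j < n" "a' \<in> idx n k" "b' \<in> idx n k"
    by (auto elim!: idx_SucE)
  let ?t = "tensor_power A u a' b'"
  have [simp]: "?t \<in> carrier A" "u i j \<in> carrier A" using tensor_power_closed[of n u a' k b', OF u] u by auto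
  have "(u i j \<otimes> ?t) \<otimes> x = u i j \<otimes> (x \<otimes> ?t)"
    using x Suc.IH[of a' b'] by (simp add: m_assoc)
  also have "\<dots> = x \<otimes> (u i j \<otimes> ?t)"
    using x comm by (simp flip: m_assoc)
  finally show ?case by simp
qed (use x in auto)

context
  fixes n v w
  assumes v: "magic_unitary A n v" and w: "magic_unitary A n w"
    and comm: "\<And>i j a b. i < n \<Longrightarrow> j < n \<Longrightarrow> a < n \<Longrightarrow> b < n \<Longrightarrow> v i j \<otimes> w a b = w a b \<otimes> v i j"
begin

text \<open>The matrix product of \<open>v\<close> and \<open>w\<close>. When these are the images
  of one magic unitary in the two legs of a tensor square, the entries are those of the
  comultiplication.\<close>

abbreviation (input) "vw \<equiv> (\<lambda>i j. \<Oplus>m\<in>{..<n}. v i m \<otimes> w m j)"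

lemma vw_closed: "i < n \<Longrightarrow> j < n \<Longrightarrow> v i j \<in> carrier A" "i < n \<Longrightarrow> j < n \<Longrightarrow> w i j \<in> carrier A"
  using v w by (auto dest: magic_unitaryD)

lemma vw_mult:
  assumes [simp]: "i < n" "j < n" "i' < n" "j' < n"
  shows "vw i j \<otimes> vw i' j' = (\<Oplus>m\<in>{..<n}. \<Oplus>m'\<in>{..<n}. (v i m \<otimes> v i' m') \<otimes> (w m j \<otimes> w m' j'))"
proof -
  note [simp] = vw_closed
  have "vw i j \<otimes> vw i' j' = (\<Oplus>m\<in>{..<n}. (v i m \<otimes> w m j) \<otimes> vw i' j')"
    by (rule finsum_ldistr) (auto simp: Pi_def)
  also have "\<dots> = (\<Oplus>m\<in>{..<n}. \<Oplus>m'\<in>{..<n}. (v i m \<otimes> w m j) \<otimes> (v i' m' \<otimes> w m' j'))"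
    by (intro finsum_cong' finsum_rdistr refl) (auto simp: Pi_def)
  also have "\<dots> = (\<Oplus>m\<in>{..<n}. \<Oplus>m'\<in>{..<n}. (v i m \<otimes> v i' m') \<otimes> (w m j \<otimes> w m' j'))"
  proof (intro finsum_cong' refl)
    fix m m' assume m: "m \<in> {..<n}" "m' \<in> {..<n}"
    have "(v i m \<otimes> w m j) \<otimes> (v i' m' \<otimes> w m' j') = v i m \<otimes> (w m j \<otimes> v i' m') \<otimes> w m' j'"
      using m by (simp add: m_assoc)
    also have "\<dots> = v i m \<otimes> (v i' m' \<otimes> w m j) \<otimes> w m' j'"
      using m comm[of i' m' m j] by simp
    finally show "(v i m \<otimes> w m j) \<otimes> (v i' m' \<otimes> w m' j') = (v i m \<otimes> v i' m') \<otimes> (w m j \<otimes> w m' j')"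
      using m by (simp add: m_assoc)
  qed (auto simp: Pi_def)
  finally show ?thesis .
qed

text \<open>For two entries in one row, row orthogonality of \<open>v\<close> identifies the
  summation indices and that of \<open>w\<close> finishes. For two entries in one column,
  \<open>w\<close> identifies the indices by its columns and \<open>v\<close> finishes.\<close>

lemma magic_unitary_vw: "magic_unitary A n vw"
proof (rule magic_unitaryI)
  note [simp] = vw_closed and V = magic_unitaryD[OF v] and W = magic_unitaryD[OF w]
  fix i j assume ij [simp]: "i < n" "j < n"
  show "vw i j \<in> carrier A" by (auto simp: Pi_def)
  have "star A (vw i j) = (\<Oplus>m\<in>{..<n}. star A (v i m \<otimes> w m j))"
    by (rule finsum_star) (auto simp: Pi_def)
  also have "\<dots> = vw i j"
    using V(2) W(2) by (intro finsum_cong') (auto simp: star_mult comm)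
  finally show "star A (vw i j) = vw i j" .
  fix m assume [simp]: "m < n"
  have "vw i j \<otimes> vw i m = (\<Oplus>p\<in>{..<n}. \<Oplus>q\<in>{..<n}. if q = p then v i q \<otimes> (w p j \<otimes> w p m) else \<zero>)"
    unfolding vw_mult[OF ij \<open>i < n\<close> \<open>m < n\<close>] using V(3) by (intro finsum_cong') (auto simp: Pi_def)
  also have "\<dots> = (\<Oplus>p\<in>{..<n}. v i p \<otimes> (w p j \<otimes> w p m))"
    by (intro finsum_cong' finsum_delta refl) (auto simp: Pi_def)
  also have "\<dots> = (\<Oplus>p\<in>{..<n}. if j = m then v i p \<otimes> w p j else \<zero>)"
    using W(3) by (intro finsum_cong') auto
  also have "\<dots> = (if j = m then vw i j else \<zero>)" by simp
  finally show "vw i j \<otimes> vw i m = (if j = m then vw i j else \<zero>)" .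
  have "vw i j \<otimes> vw m j = (\<Oplus>p\<in>{..<n}. \<Oplus>q\<in>{..<n}. if q = p then (v i p \<otimes> v m q) \<otimes> w p j else \<zero>)"
    unfolding vw_mult[OF ij \<open>m < n\<close> \<open>j < n\<close>] using W(4) by (intro finsum_cong') (auto simp: Pi_def)
  also have "\<dots> = (\<Oplus>p\<in>{..<n}. (v i p \<otimes> v m p) \<otimes> w p j)"
    by (intro finsum_cong' finsum_delta refl) (auto simp: Pi_def)
  also have "\<dots> = (\<Oplus>p\<in>{..<n}. if i = m then v i p \<otimes> w p j else \<zero>)"
    using V(4) by (intro finsum_cong') auto
  also have "\<dots> = (if i = m then vw i j else \<zero>)" by simp
  finally show "vw i j \<otimes> vw m j = (if i = m then vw i j else \<zero>)" .
next
  note [simp] = vw_closed and V = magic_unitary_sums[OF v] and W = magic_unitary_sums[OF w]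
  fix i assume [simp]: "i < n"
  have "(\<Oplus>j\<in>{..<n}. vw i j) = (\<Oplus>m\<in>{..<n}. \<Oplus>j\<in>{..<n}. v i m \<otimes> w m j)"
    by (intro finsum_swap) auto
  also have "\<dots> = (\<Oplus>m\<in>{..<n}. v i m)"
    using W(1) by (intro finsum_cong') (auto simp flip: finsum_rdistr)
  finally show "(\<Oplus>j\<in>{..<n}. vw i j) = \<one>" using V(1) by simp
next
  note [simp] = vw_closed and V = magic_unitary_sums[OF v] and W = magic_unitary_sums[OF w]
  fix j assume [simp]: "j < n"
  have "(\<Oplus>i\<in>{..<n}. vw i j) = (\<Oplus>m\<in>{..<n}. \<Oplus>i\<in>{..<n}. v i m \<otimes> w m j)"
    by (intro finsum_swap) auto
  also have "\<dots> = (\<Oplus>m\<in>{..<n}. w m j)"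
    using V(2) by (intro finsum_cong') (auto simp flip: finsum_ldistr)
  finally show "(\<Oplus>i\<in>{..<n}. vw i j) = \<one>" using W(2) by simp
qed

text \<open>Multiplicativity of the tensor power: commutation moves each letter from
  \<open>w\<close> past the remaining word in \<open>v\<close>.\<close>

lemma tensor_power_vw:
  "a \<in> idx n k \<Longrightarrow> b \<in> idx n k \<Longrightarrow>
    tensor_power A vw a b = (\<Oplus>c\<in>idx n k. tensor_power A v a c \<otimes> tensor_power A w c b)"
proof (induction k arbitrary: a b)
  case (Suc k)
  then obtain i a' j b' where [simp]: "a = i # a'" "b = j # b'"
    and ij [simp]: "i < n" "j < n" "a' \<in> idx n k" "b' \<in> idx n k"
    by (auto elim!: idx_SucE)
  note [simp] = vw_closed tensor_power_closed[of n v _ k, OF vw_closed(1)] tensor_power_closed[of n w _ k, OF vw_closed(2)]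
    tensor_power_closed[of n v _ "Suc k", OF vw_closed(1)] tensor_power_closed[of n w _ "Suc k", OF vw_closed(2)]
  let ?v = "tensor_power A v" and ?w = "tensor_power A w"
  have "tensor_power A vw a b = vw i j \<otimes> (\<Oplus>c\<in>idx n k. ?v a' c \<otimes> ?w c b')"
    using Suc.IH[of a' b'] by simp
  also have "\<dots> = (\<Oplus>m\<in>{..<n}. (v i m \<otimes> w m j) \<otimes> (\<Oplus>c\<in>idx n k. ?v a' c \<otimes> ?w c b'))"
    by (rule finsum_ldistr) (auto simp: Pi_def)
  also have "\<dots> = (\<Oplus>m\<in>{..<n}. \<Oplus>c\<in>idx n k. (v i m \<otimes> w m j) \<otimes> (?v a' c \<otimes> ?w c b'))"
    by (intro finsum_cong' finsum_rdistr refl) (auto simp: Pi_def)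
  also have "\<dots> = (\<Oplus>m\<in>{..<n}. \<Oplus>c\<in>idx n k. ?v a (m # c) \<otimes> ?w (m # c) b)"
  proof (intro finsum_cong' refl)
    fix m c assume m: "m \<in> {..<n}" "c \<in> idx n k"
    have "?v a' c \<otimes> w m j = w m j \<otimes> ?v a' c"
      using m by (intro tensor_power_commute[of n v _ _ k]) (auto simp: comm)
    then have "(v i m \<otimes> w m j) \<otimes> (?v a' c \<otimes> ?w c b') = v i m \<otimes> (?v a' c \<otimes> w m j) \<otimes> ?w c b'"
      using m by (simp add: m_assoc)
    then show "(v i m \<otimes> w m j) \<otimes> (?v a' c \<otimes> ?w c b') = ?v a (m # c) \<otimes> ?w (m # c) b"
      using m by (simp add: m_assoc)
  qed (auto simp: Pi_def)
  also have "\<dots> = (\<Oplus>c\<in>idx n (Suc k). ?v a c \<otimes> ?w c b)"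
    by (rule finsum_idx_Suc[symmetric]) simp
  finally show ?case .
qed simp

text \<open>With V and W the tensor powers of \<open>v\<close> and \<open>w\<close> of the
  appropriate order, T V W = V T W = V W T.\<close>

lemma Hom_vw:
  assumes Tv: "T \<in> Hom A n v k l" and Tw: "T \<in> Hom A n w k l"
  shows "T \<in> Hom A n vw k l"
proof -
  note [simp] = vw_closed tensor_power_closed[of n v _ k, OF vw_closed(1)] tensor_power_closed[of n w _ k, OF vw_closed(2)]
    tensor_power_closed[of n v _ l, OF vw_closed(1)] tensor_power_closed[of n w _ l, OF vw_closed(2)]
  let ?v = "tensor_power A v" and ?w = "tensor_power A w"
  have "(\<Oplus>c\<in>idx n k. T a c \<odot> tensor_power A vw c b) = (\<Oplus>c\<in>idx n l. T c b \<odot> tensor_power A vw a c)"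
    if [simp]: "a \<in> idx n l" "b \<in> idx n k" for a b
  proof -
    have "(\<Oplus>c\<in>idx n k. T a c \<odot> tensor_power A vw c b) = (\<Oplus>c\<in>idx n k. \<Oplus>e\<in>idx n k. (T a c \<odot> ?v c e) \<otimes> ?w e b)"
      by (intro finsum_cong') (auto simp: tensor_power_vw finsum_smult smult_mult_left Pi_def intro!: finsum_cong')
    also have "\<dots> = (\<Oplus>e\<in>idx n k. \<Oplus>c\<in>idx n k. (T a c \<odot> ?v c e) \<otimes> ?w e b)"
      by (intro finsum_swap) auto
    also have "\<dots> = (\<Oplus>e\<in>idx n k. (\<Oplus>c\<in>idx n k. T a c \<odot> ?v c e) \<otimes> ?w e b)"
      by (intro finsum_cong' finsum_ldistr[symmetric] refl) (auto simp: Pi_def)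
    also have "\<dots> = (\<Oplus>e\<in>idx n k. (\<Oplus>c\<in>idx n l. T c e \<odot> ?v a c) \<otimes> ?w e b)"
      by (intro finsum_cong') (auto simp: HomD[OF Tv] Pi_def)
    also have "\<dots> = (\<Oplus>e\<in>idx n k. \<Oplus>c\<in>idx n l. ?v a c \<otimes> (T c e \<odot> ?w e b))"
      by (intro finsum_cong') (auto simp: finsum_ldistr smult_mult_left smult_mult_right Pi_def intro!: finsum_cong')
    also have "\<dots> = (\<Oplus>c\<in>idx n l. \<Oplus>e\<in>idx n k. ?v a c \<otimes> (T c e \<odot> ?w e b))"
      by (intro finsum_swap) auto
    also have "\<dots> = (\<Oplus>c\<in>idx n l. ?v a c \<otimes> (\<Oplus>e\<in>idx n k. T c e \<odot> ?w e b))"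
      by (intro finsum_cong' finsum_rdistr[symmetric] refl) (auto simp: Pi_def)
    also have "\<dots> = (\<Oplus>c\<in>idx n l. ?v a c \<otimes> (\<Oplus>e\<in>idx n l. T e b \<odot> ?w c e))"
      by (intro finsum_cong') (auto simp: HomD[OF Tw] Pi_def)
    also have "\<dots> = (\<Oplus>c\<in>idx n l. \<Oplus>e\<in>idx n l. T e b \<odot> (?v a c \<otimes> ?w c e))"
      by (intro finsum_cong') (auto simp: finsum_rdistr smult_mult_right Pi_def intro!: finsum_cong')
    also have "\<dots> = (\<Oplus>e\<in>idx n l. \<Oplus>c\<in>idx n l. T e b \<odot> (?v a c \<otimes> ?w c e))"
      by (intro finsum_swap) auto
    also have "\<dots> = (\<Oplus>e\<in>idx n l. T e b \<odot> tensor_power A vw a e)"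
      by (intro finsum_cong') (auto simp: tensor_power_vw[of _ l] finsum_smult Pi_def)
    finally show ?thesis .
  qed
  then show ?thesis using Hom_in_mats[OF Tv] by (simp add: Hom_def)
qed

end

end

subsection \<open>The identity matrix\<close>

lemma magic_unitary_identity: "magic_unitary complex_alg n (\<lambda>i j. if i = j then 1 else 0)"
  by (rule magic_unitaryI) auto

lemma tensor_power_identity:
  "a \<in> idx n k \<Longrightarrow> b \<in> idx n k \<Longrightarrow>
    tensor_power complex_alg (\<lambda>i j. if i = j then 1 else 0) a b = (if a = b then 1 else 0)"
proof (induction k arbitrary: a b)
  case (Suc k)
  then obtain i a' j b' where "a = i # a'" "b = j # b'" "a' \<in> idx n k" "b' \<in> idx n k"
    by (auto elim!: idx_SucE)
  then show ?case using Suc.IH[of a' b'] by simp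
qed simp

text \<open>The tensor powers of the identity matrix are identity matrices; this is the relation
  that the counit has to respect.\<close>

lemma Hom_identity:
  assumes "T \<in> mats n l k"
  shows "T \<in> Hom complex_alg n (\<lambda>i j. if i = j then 1 else 0) k l"
  using assms by (simp add: Hom_def tensor_power_identity sum.delta if_distrib cong: sum.cong if_cong)

section \<open>Quantum permutation algebras defined by an intertwiner\<close>

text \<open>Makes a universal property stated on \<open>univ\<close> usable for targets of any type:
  \<open>D\<close> is a copy of the subalgebra generated by \<open>X\<close>, \<open>h\<close> its
  inclusion, and \<open>e\<close> locates the elements of \<open>X\<close> in it.\<close>

lemma embed_in_univ:
  fixes B :: "'b cstar_alg"
  assumes B: "cstar_algebra B" and X: "countable X" "X \<subseteq> carrier B"
  obtains D :: "univ cstar_alg" and h e where "cstar_algebra D" "h \<in> star_hom D B"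
    "inj_on h (carrier D)" "\<And>x. x \<in> X \<Longrightarrow> e x \<in> carrier D" "\<And>x. x \<in> X \<Longrightarrow> h (e x) = x"
proof -
  interpret cstar_algebra B by (rule B)
  define C where "C = B\<lparr>carrier := cstar_gen B X\<rparr>"
  have sub: "cstar_subalgebra B (cstar_gen B X)" using X(2) by (rule cstar_subalgebra_cstar_gen)
  have C: "cstar_algebra C" unfolding C_def using B sub by (rule cstar_algebra_subalgebra)
  have incl: "(\<lambda>x. x) \<in> star_hom C B"
    unfolding C_def using sub by (intro star_hom_inclusion) (simp add: cstar_subalgebra_def)
  obtain f :: "'b \<Rightarrow> univ" where "inj_on f (cstar_gen B X)"
    by (rule countably_generated_embedding[OF B X])
  then have f: "inj_on f (carrier C)" by (simp add: C_def)
  have XC: "x \<in> carrier C" if "x \<in> X" for x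
    using that cstar_gen_superset[of X B] by (auto simp: C_def)
  note T = transport[OF C f]
  show thesis
  proof (rule that)
    show "cstar_algebra (transport f C)" by (rule T)
    show "the_inv_into (carrier C) f \<in> star_hom (transport f C) B"
      using star_hom_comp[OF T(3) incl] by simp
    show "inj_on (the_inv_into (carrier C) f) (carrier (transport f C))"
      using inj_on_the_inv_into[OF f] by (simp add: transport_def Let_def)
    show "f x \<in> carrier (transport f C)" if "x \<in> X" for x
      using XC[OF that] star_homD(1)[OF T(2)] by blast
    show "the_inv_into (carrier C) f (f x) = x" if "x \<in> X" for x
      using the_inv_into_f_f[OF f XC[OF that]] .
  qed
qed

text \<open>The assumption \<open>universal\<close> is restricted to targets on \<open>univ\<close>
  because types cannot be quantified inside it; \<open>universal_any\<close> removes the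
  restriction.\<close>

locale universal_intertwiner =
  fixes n k l :: nat and T :: multimat and U :: "univ cstar_alg" and w :: "nat \<Rightarrow> nat \<Rightarrow> univ"
  assumes U: "cstar_algebra U" and magic: "magic_unitary U n w" and T: "T \<in> Hom U n w k l"
    and gen: "cstar_gen U (entries n w) = carrier U"
    and universal: "\<And>(B :: univ cstar_alg) v. \<lbrakk>cstar_algebra B; magic_unitary B n v; T \<in> Hom B n v k l\<rbrakk> \<Longrightarrow>
      \<exists>\<phi>\<in>star_hom U B. \<forall>i<n. \<forall>j<n. \<phi> (w i j) = v i j"

text \<open>\<open>K\<close> is the set of all models on \<open>univ\<close>. The relations hold in
  the generated subalgebra of their product because they hold in each model, and the projection to a
  model is the required homomorphism.\<close>

lemma exists_universal_intertwiner:
  assumes T: "T \<in> mats n l k"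
  obtains U w where "universal_intertwiner n k l T U w"
proof -
  define K where "K = {(B :: univ cstar_alg, v). cstar_algebra B \<and> magic_unitary B n v \<and> T \<in> Hom B n v k l}"
  have K: "cstar_algebra (fst m)" "magic_unitary (fst m) n (snd m)" "T \<in> Hom (fst m) n (snd m) k l"
    if "m \<in> K" for m
    using that by (auto simp: K_def)
  let ?v = "\<lambda>(m :: univ cstar_alg \<times> (nat \<Rightarrow> nat \<Rightarrow> univ)) (i, j). snd m i j" and ?J = "{..<n} \<times> {..<n}"
  obtain U :: "univ cstar_alg" and w p where U: "cstar_algebra U" "w ` ?J \<subseteq> carrier U"
    "cstar_gen U (w ` ?J) = carrier U"
    "\<And>m. m \<in> K \<Longrightarrow> p m \<in> star_hom U (fst m)"
    "\<And>m g. m \<in> K \<Longrightarrow> g \<in> ?J \<Longrightarrow> p m (w g) = ?v m g"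
    "\<And>x y. x \<in> carrier U \<Longrightarrow> y \<in> carrier U \<Longrightarrow> (\<And>m. m \<in> K \<Longrightarrow> p m x = p m y) \<Longrightarrow> x = y"
  proof (rule universal_family[of K fst ?J ?v])
    fix m g assume m: "m \<in> K" and g: "g \<in> ?J"
    obtain i j where [simp]: "g = (i, j)" and ij: "i < n" "j < n" using g by auto
    show "?v m g \<in> carrier (fst m)" using magic_unitaryD(1)[OF K(2)[OF m] ij] by simp
    show "nrm (fst m) (?v m g) \<le> 1" using magic_unitary_nrm_le_1[OF K(1,2)[OF m] ij] by simp
  qed (use K(1) in auto)
  define w' where "w' i j = w (i, j)" for i j
  have entries: "w ` ?J = entries n w'" by (auto simp: entries_def w'_def)
  interpret U: cstar_algebra U by (rule U)
  interpret jointly_injective U K fst p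
    by (intro jointly_injective.intro jointly_injective_axioms.intro U.star_algebra_axioms
        cstar_algebra.axioms(1)[OF K(1)] U(4)) (assumption | fact U(6))+
  have w': "w' i j \<in> carrier U" if "i < n" "j < n" for i j using U(2) that by (auto simp: w'_def)
  have pw: "p m (w' i j) = snd m i j" if "m \<in> K" "i < n" "j < n" for m i j
    using U(5)[of m "(i, j)"] that by (simp add: w'_def)
  have "universal_intertwiner n k l T U w'"
  proof (rule universal_intertwiner.intro)
    show "cstar_algebra U" by (rule U)
    show "cstar_gen U (entries n w') = carrier U" using U(3) by (simp add: entries)
    show "magic_unitary U n w'"
    proof (rule magic_unitary_reflect[OF w'])
      fix m assume m: "m \<in> K"
      interpret star_algebra "fst m" using algebras[OF m] .
      show "magic_unitary (fst m) n (\<lambda>i j. p m (w' i j))"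
        by (rule magic_unitary_cong[OF pw[OF m] K(2)[OF m]])
    qed
    show "T \<in> Hom U n w' k l"
    proof (rule Hom_reflect[OF w' T])
      fix m assume m: "m \<in> K"
      interpret star_algebra "fst m" using algebras[OF m] .
      show "T \<in> Hom (fst m) n (\<lambda>i j. p m (w' i j)) k l"
        using K(3)[OF m] Hom_cong[of n "\<lambda>i j. p m (w' i j)" "snd m"] pw[OF m] magic_unitaryD(1)[OF K(2)[OF m]]
        by blast
    qed
    fix B :: "univ cstar_alg" and v
    assume "cstar_algebra B" "magic_unitary B n v" "T \<in> Hom B n v k l"
    then have "(B, v) \<in> K" by (simp add: K_def)
    then show "\<exists>\<phi>\<in>star_hom U B. \<forall>i<n. \<forall>j<n. \<phi> (w' i j) = v i j"
      using U(4)[of "(B, v)"] pw[of "(B, v)"] by (intro bexI[of _ "p (B, v)"]) auto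
  qed
  then show thesis by (rule that)
qed

context universal_intertwiner
begin

sublocale U: cstar_algebra U by (rule U)

lemma w_closed: "i < n \<Longrightarrow> j < n \<Longrightarrow> w i j \<in> carrier U"
  using magic by (rule magic_unitaryD)

lemma entries_closed: "entries n w \<subseteq> carrier U"
  using w_closed by (simp add: entries_subset_iff)

lemma hom_eqI:
  assumes "cstar_algebra B" "\<phi> \<in> star_hom U B" "\<psi> \<in> star_hom U B"
    and "\<And>i j. i < n \<Longrightarrow> j < n \<Longrightarrow> \<phi> (w i j) = \<psi> (w i j)" "x \<in> carrier U"
  shows "\<phi> x = \<psi> x"
proof (rule star_hom_eq_on_cstar_gen[OF U assms(1-3) entries_closed])
  show "\<phi> y = \<psi> y" if "y \<in> entries n w" for y
    using that assms(4) by (auto simp: entries_def)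
  show "x \<in> cstar_gen U (entries n w)" using assms(5) gen by simp
qed

text \<open>The relations hold in the copy \<open>D\<close> on \<open>univ\<close> because the
  injective homomorphism \<open>h\<close> reflects them; the map to \<open>D\<close> is then
  composed with \<open>h\<close>.\<close>

lemma universal_any:
  fixes B :: "'b cstar_alg"
  assumes B: "cstar_algebra B" and v: "magic_unitary B n v" and TB: "T \<in> Hom B n v k l"
  obtains \<phi> where "\<phi> \<in> star_hom U B" "\<And>i j. i < n \<Longrightarrow> j < n \<Longrightarrow> \<phi> (w i j) = v i j"
proof -
  interpret cstar_algebra B by (rule B)
  have fin: "countable (entries n v)" by (simp add: entries_eq_image)
  have sub: "entries n v \<subseteq> carrier B" using magic_unitaryD(1)[OF v] by (simp add: entries_subset_iff)
  obtain D :: "univ cstar_alg" and h e where D: "cstar_algebra D" "h \<in> star_hom D B"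
    "inj_on h (carrier D)" "\<And>x. x \<in> entries n v \<Longrightarrow> e x \<in> carrier D" "\<And>x. x \<in> entries n v \<Longrightarrow> h (e x) = x"
    using embed_in_univ[OF B fin sub] by blast
  have vin: "v i j \<in> entries n v" if "i < n" "j < n" for i j using that by (auto simp: entries_def)
  interpret D: cstar_algebra D by (rule D)
  interpret h: jointly_injective D "{()}" "\<lambda>_. B" "\<lambda>_. h"
    by (rule jointly_injective_single[OF D.star_algebra_axioms star_algebra_axioms D(2,3)])
  have "magic_unitary B n (\<lambda>i j. h (e (v i j)))"
    using D(5)[OF vin] v by (rule magic_unitary_cong)
  then have "magic_unitary D n (\<lambda>i j. e (v i j))"
    using D(4)[OF vin] by (intro h.magic_unitary_reflect)
  moreover have "T \<in> Hom B n (\<lambda>i j. h (e (v i j))) k l"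
    using TB Hom_cong[of n "\<lambda>i j. h (e (v i j))" v] D(5)[OF vin] magic_unitaryD(1)[OF v] by blast
  then have "T \<in> Hom D n (\<lambda>i j. e (v i j)) k l"
    using D(4)[OF vin] by (intro h.Hom_reflect Hom_in_mats[OF TB])
  ultimately obtain \<phi> where "\<phi> \<in> star_hom U D" "\<forall>i<n. \<forall>j<n. \<phi> (w i j) = e (v i j)"
    using universal[OF D(1)] by blast
  then show thesis
    using D(5)[OF vin] by (intro that[of "\<lambda>x. h (\<phi> x)"] star_hom_comp[OF _ D(2)]) auto
qed

lemma hom_relations:
  assumes "star_algebra B" "\<phi> \<in> star_hom U B"
  shows "magic_unitary B n (\<lambda>i j. \<phi> (w i j))" "T \<in> Hom B n (\<lambda>i j. \<phi> (w i j)) k l"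
proof -
  interpret star_algebra_hom U B \<phi>
    using assms U.star_algebra_axioms by (simp add: star_algebra_hom_def star_algebra_hom_axioms_def)
  show "magic_unitary B n (\<lambda>i j. \<phi> (w i j))" using magic by (rule magic_unitary_image)
  show "T \<in> Hom B n (\<lambda>i j. \<phi> (w i j)) k l" using w_closed T by (rule Hom_image)
qed

text \<open>The maximal tensor product as universal receiver of commuting pairs: \<open>K\<close>
  collects all such pairs into algebras on \<open>univ\<close>, and the Boolean tag separates the
  two copies of the generators.\<close>

lemma exists_tensor_square:
  obtains C :: "univ cstar_alg" and \<iota> \<kappa> where "is_tensor_product U U C \<iota> \<kappa>"
proof -
  define K where "K = {(D :: univ cstar_alg, \<phi>, \<psi>). cstar_algebra D \<and> \<phi> \<in> star_hom U D \<and> \<psi> \<in> star_hom U D \<and>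
    (\<forall>a\<in>carrier U. \<forall>b\<in>carrier U. \<phi> a \<otimes>\<^bsub>D\<^esub> \<psi> b = \<psi> b \<otimes>\<^bsub>D\<^esub> \<phi> a)}"
  have K: "cstar_algebra (fst m)" "fst (snd m) \<in> star_hom U (fst m)" "snd (snd m) \<in> star_hom U (fst m)"
    if "m \<in> K" for m
    using that by (auto simp: K_def)
  have comm: "fst (snd m) a \<otimes>\<^bsub>fst m\<^esub> snd (snd m) b = snd (snd m) b \<otimes>\<^bsub>fst m\<^esub> fst (snd m) a"
    if "m \<in> K" "a \<in> carrier U" "b \<in> carrier U" for m a b
    using that by (auto simp: K_def)
  note alg = cstar_algebra.axioms(1)[OF K(1)]
  let ?J = "(UNIV :: bool set) \<times> {..<n} \<times> {..<n}"
    and ?v = "\<lambda>(m :: univ cstar_alg \<times> (univ \<Rightarrow> univ) \<times> (univ \<Rightarrow> univ)) (b, i, j).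
      if b then fst (snd m) (w i j) else snd (snd m) (w i j)"
  obtain C :: "univ cstar_alg" and g p where C: "cstar_algebra C" "g ` ?J \<subseteq> carrier C"
    "cstar_gen C (g ` ?J) = carrier C"
    "\<And>m. m \<in> K \<Longrightarrow> p m \<in> star_hom C (fst m)"
    "\<And>m x. m \<in> K \<Longrightarrow> x \<in> ?J \<Longrightarrow> p m (g x) = ?v m x"
    "\<And>x y. x \<in> carrier C \<Longrightarrow> y \<in> carrier C \<Longrightarrow> (\<And>m. m \<in> K \<Longrightarrow> p m x = p m y) \<Longrightarrow> x = y"
  proof (rule universal_family[of K fst ?J ?v])
    fix m x assume m: "m \<in> K" and x: "x \<in> ?J"
    obtain b i j where [simp]: "x = (b, i, j)" and ij: "i < n" "j < n" using x by auto
    note magics = hom_relations(1)[OF alg[OF m] K(2)[OF m]] hom_relations(1)[OF alg[OF m] K(3)[OF m]]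
    show "?v m x \<in> carrier (fst m)" using magics[THEN magic_unitaryD(1)] ij by simp
    show "nrm (fst m) (?v m x) \<le> 1"
      using magics[THEN magic_unitary_nrm_le_1[OF K(1)[OF m]]] ij by simp
  qed (use K(1) in auto)
  interpret C: cstar_algebra C by (rule C)
  interpret jointly_injective C K fst p
    by (intro jointly_injective.intro jointly_injective_axioms.intro C.star_algebra_axioms alg C(4))
      (assumption | fact C(6))+
  have gc: "g (b, i, j) \<in> carrier C" if "i < n" "j < n" for b i j using C(2) that by auto
  have pg: "p m (g (True, i, j)) = fst (snd m) (w i j)" "p m (g (False, i, j)) = snd (snd m) (w i j)"
    if "m \<in> K" "i < n" "j < n" for m i j
    using C(5)[OF that(1), of "(True, i, j)"] C(5)[OF that(1), of "(False, i, j)"] that by simp_all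
  \<comment> \<open>The generators with a given tag satisfy the relations in every model, hence in
    \<open>C\<close>; universality of \<open>U\<close> turns them into a homomorphism from
    \<open>U\<close>.\<close>
  have leg: "\<exists>\<iota>\<in>star_hom U C. (\<forall>i<n. \<forall>j<n. \<iota> (w i j) = g (b, i, j)) \<and> (\<forall>m\<in>K. \<forall>a\<in>carrier U. p m (\<iota> a) = c m a)"
    if c: "\<And>m. m \<in> K \<Longrightarrow> c m \<in> star_hom U (fst m)"
      "\<And>m i j. m \<in> K \<Longrightarrow> i < n \<Longrightarrow> j < n \<Longrightarrow> p m (g (b, i, j)) = c m (w i j)" for b c
  proof -
    have "magic_unitary C n (\<lambda>i j. g (b, i, j))"
    proof (rule magic_unitary_reflect[OF gc])
      fix m assume m: "m \<in> K"
      interpret star_algebra "fst m" by (rule alg[OF m])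
      show "magic_unitary (fst m) n (\<lambda>i j. p m (g (b, i, j)))"
        using c(2)[OF m] hom_relations(1)[OF alg[OF m] c(1)[OF m]] by (rule magic_unitary_cong)
    qed
    moreover have "T \<in> Hom C n (\<lambda>i j. g (b, i, j)) k l"
    proof (rule Hom_reflect[OF gc Hom_in_mats[OF T]])
      fix m assume m: "m \<in> K"
      interpret star_algebra "fst m" by (rule alg[OF m])
      note rel = hom_relations[OF alg[OF m] c(1)[OF m]]
      show "T \<in> Hom (fst m) n (\<lambda>i j. p m (g (b, i, j))) k l"
        using rel(2) Hom_cong[of n "\<lambda>i j. p m (g (b, i, j))" "\<lambda>i j. c m (w i j)"] c(2)[OF m]
          magic_unitaryD(1)[OF rel(1)] by blast
    qed
    ultimately obtain \<iota> where \<iota>: "\<iota> \<in> star_hom U C" "\<forall>i<n. \<forall>j<n. \<iota> (w i j) = g (b, i, j)"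
      using universal[OF C(1)] by blast
    have "p m (\<iota> a) = c m a" if m: "m \<in> K" and a: "a \<in> carrier U" for m a
      using \<iota>(2) c(2)[OF m]
      by (intro hom_eqI[OF K(1)[OF m] star_hom_comp[OF \<iota>(1) C(4)[OF m]] c(1)[OF m] _ a]) simp
    with \<iota> show ?thesis by blast
  qed
  obtain \<iota> where \<iota>: "\<iota> \<in> star_hom U C" "\<And>i j. i < n \<Longrightarrow> j < n \<Longrightarrow> \<iota> (w i j) = g (True, i, j)"
    "\<And>m a. m \<in> K \<Longrightarrow> a \<in> carrier U \<Longrightarrow> p m (\<iota> a) = fst (snd m) a"
    using leg[of "\<lambda>m. fst (snd m)" True, OF K(2) pg(1)] by blast
  obtain \<kappa> where \<kappa>: "\<kappa> \<in> star_hom U C" "\<And>i j. i < n \<Longrightarrow> j < n \<Longrightarrow> \<kappa> (w i j) = g (False, i, j)"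
    "\<And>m a. m \<in> K \<Longrightarrow> a \<in> carrier U \<Longrightarrow> p m (\<kappa> a) = snd (snd m) a"
    using leg[of "\<lambda>m. snd (snd m)" False, OF K(3) pg(2)] by blast
  note cl [simp] = star_homD(1)[OF \<iota>(1)] star_homD(1)[OF \<kappa>(1)]
  have "is_tensor_product U U C \<iota> \<kappa>"
    unfolding is_tensor_product_def
  proof (intro conjI allI impI)
    show "cstar_algebra C" "\<iota> \<in> star_hom U C" "\<kappa> \<in> star_hom U C" by fact+
    show "\<forall>a\<in>carrier U. \<forall>b\<in>carrier U. \<iota> a \<otimes>\<^bsub>C\<^esub> \<kappa> b = \<kappa> b \<otimes>\<^bsub>C\<^esub> \<iota> a"
    proof (intro ballI)
      fix a b assume ab: "a \<in> carrier U" "b \<in> carrier U"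
      show "\<iota> a \<otimes>\<^bsub>C\<^esub> \<kappa> b = \<kappa> b \<otimes>\<^bsub>C\<^esub> \<iota> a"
        by (rule jointly_inj) (simp_all add: ab star_homD(2)[OF C(4)] \<iota>(3) \<kappa>(3) comm)
    qed
    \<comment> \<open>The tagged generators of \<open>C\<close> are values of the two legs, so the
      images of the legs generate \<open>C\<close>.\<close>
    have "g ` ?J \<subseteq> \<iota> ` carrier U \<union> \<kappa> ` carrier U"
    proof clarify
      fix b i j assume "i < n" "j < n" "g (b, i, j) \<notin> \<kappa> ` carrier U"
      then show "g (b, i, j) \<in> \<iota> ` carrier U"
        using \<iota>(2)[of i j] \<kappa>(2)[of i j] w_closed[of i j] by (cases b) (metis imageI)+
    qed
    then have "carrier C \<subseteq> cstar_gen C (\<iota> ` carrier U \<union> \<kappa> ` carrier U)"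
      unfolding C(3)[symmetric] by (rule cstar_gen_mono)
    moreover have "\<iota> ` carrier U \<union> \<kappa> ` carrier U \<subseteq> carrier C" by auto
    ultimately show "cstar_gen C (\<iota> ` carrier U \<union> \<kappa> ` carrier U) = carrier C"
      by (intro antisym C.cstar_gen_closed)
    fix D :: "univ cstar_alg" and \<phi> \<psi>
    assume "cstar_algebra D \<and> \<phi> \<in> star_hom U D \<and> \<psi> \<in> star_hom U D \<and>
      (\<forall>a\<in>carrier U. \<forall>b\<in>carrier U. \<phi> a \<otimes>\<^bsub>D\<^esub> \<psi> b = \<psi> b \<otimes>\<^bsub>D\<^esub> \<phi> a)"
    then have m: "(D, \<phi>, \<psi>) \<in> K" by (simp add: K_def)
    show "\<exists>\<theta>\<in>star_hom C D. (\<forall>a\<in>carrier U. \<theta> (\<iota> a) = \<phi> a) \<and> (\<forall>b\<in>carrier U. \<theta> (\<kappa> b) = \<psi> b)"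
      using C(4)[OF m] \<iota>(3)[OF m] \<kappa>(3)[OF m] by (intro bexI[of _ "p (D, \<phi>, \<psi>)"]) auto
  qed
  then show thesis by (rule that)
qed

text \<open>Fullness is automatic for an algebra given by relations: a homomorphism on the dense
  *-algebra already sends the generators to a solution of the relations, and universality of
  \<open>U\<close> extends it.\<close>

lemma is_enveloping_star_gen:
  "is_enveloping (U\<lparr>carrier := star_gen U (entries n w)\<rparr>) U (\<lambda>x. x)"
proof -
  let ?S = "star_gen U (entries n w)"
  let ?R = "U\<lparr>carrier := ?S\<rparr>"
  have S: "star_subalgebra U ?S" using entries_closed by (rule U.star_subalgebra_star_gen)
  have R: "star_algebra ?R" using U.star_algebra_axioms S by (rule star_algebra_subalgebra)
  have incl: "(\<lambda>x. x) \<in> star_hom ?R U" using S by (rule star_hom_inclusion)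
  have wS: "w i j \<in> ?S" if "i < n" "j < n" for i j
    using that star_gen_superset[of "entries n w" U] by (auto simp: entries_def)
  interpret R: star_algebra ?R by (rule R)
  interpret incl: jointly_injective ?R "{()}" "\<lambda>_. U" "\<lambda>_ x. x"
    by (rule jointly_injective_single[OF R U.star_algebra_axioms incl]) simp
  have Rw: "magic_unitary ?R n w" "T \<in> Hom ?R n w k l"
    using wS magic T by (auto intro!: incl.magic_unitary_reflect incl.Hom_reflect Hom_in_mats[OF T])
  have "\<exists>\<psi>\<in>star_hom U B. \<forall>x\<in>carrier ?R. \<psi> x = \<phi> x"
    if B: "cstar_algebra B" and \<phi>: "\<phi> \<in> star_hom ?R B" for B :: "univ cstar_alg" and \<phi>
  proof -
    interpret B: cstar_algebra B by (rule B)
    interpret \<phi>: star_algebra_hom ?R B \<phi> by unfold_locales (rule \<phi>)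
    have "magic_unitary B n (\<lambda>i j. \<phi> (w i j))" using Rw(1) by (rule \<phi>.magic_unitary_image)
    moreover have "T \<in> Hom B n (\<lambda>i j. \<phi> (w i j)) k l"
      using wS Rw(2) by (intro \<phi>.Hom_image) auto
    ultimately obtain \<psi> where \<psi>: "\<psi> \<in> star_hom U B" "\<forall>i<n. \<forall>j<n. \<psi> (w i j) = \<phi> (w i j)"
      using universal[OF B] by blast
    \<comment> \<open>The extension was chosen only to agree on generators; the equalizer is a
      *-subalgebra, which spreads this to the whole *-algebra.\<close>
    let ?E = "{x \<in> carrier ?R. \<psi> x = \<phi> x}"
    have "star_subalgebra ?R ?E"
      using R star_hom_comp[OF incl \<psi>(1)] \<phi> by (rule star_subalgebra_equalizer)
    then have "star_subalgebra U ?E"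
      using star_subalgebraD(1)[OF S] unfolding star_subalgebra_def by auto
    moreover have "entries n w \<subseteq> ?E" using \<psi>(2) wS by (auto simp: entries_def)
    ultimately have "?S \<subseteq> ?E" by (rule star_gen_subset)
    with \<psi>(1) show ?thesis by auto
  qed
  moreover have "cstar_gen U ?S = carrier U"
    using cstar_gen_mono[OF star_gen_superset, of U "entries n w"] U.cstar_gen_closed[of ?S]
      star_subalgebraD(1)[OF S] gen by blast
  ultimately show ?thesis
    unfolding is_enveloping_def using R U incl by simp
qed

text \<open>For each structure map, universality asks only that its prescribed matrix of images be
  magic and intertwined by \<open>T\<close>.\<close>

theorem quantum_permutation_algebra: "quantum_permutation_algebra n U w"
proof -
  have "\<exists>(C :: univ cstar_alg) \<iota> \<kappa>. is_tensor_product U U C \<iota> \<kappa> \<and>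
      (\<exists>\<Delta>\<in>star_hom U C. \<forall>i<n. \<forall>j<n. \<Delta> (w i j) = (\<Oplus>\<^bsub>C\<^esub>m\<in>{..<n}. \<iota> (w i m) \<otimes>\<^bsub>C\<^esub> \<kappa> (w m j)))"
  proof -
    obtain C :: "univ cstar_alg" and \<iota> \<kappa> where tp: "is_tensor_product U U C \<iota> \<kappa>"
      by (rule exists_tensor_square)
    then have C: "cstar_algebra C" "\<iota> \<in> star_hom U C" "\<kappa> \<in> star_hom U C"
      and comm: "\<And>a b. a \<in> carrier U \<Longrightarrow> b \<in> carrier U \<Longrightarrow> \<iota> a \<otimes>\<^bsub>C\<^esub> \<kappa> b = \<kappa> b \<otimes>\<^bsub>C\<^esub> \<iota> a"
      unfolding is_tensor_product_def by auto
    interpret C: cstar_algebra C by (rule C)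
    note rel = hom_relations[OF C.star_algebra_axioms C(2)] hom_relations[OF C.star_algebra_axioms C(3)]
    have "magic_unitary C n (\<lambda>i j. \<Oplus>\<^bsub>C\<^esub>m\<in>{..<n}. \<iota> (w i m) \<otimes>\<^bsub>C\<^esub> \<kappa> (w m j))"
      using rel(1,3) by (rule C.magic_unitary_vw) (intro comm w_closed)
    moreover have "T \<in> Hom C n (\<lambda>i j. \<Oplus>\<^bsub>C\<^esub>m\<in>{..<n}. \<iota> (w i m) \<otimes>\<^bsub>C\<^esub> \<kappa> (w m j)) k l"
      using rel(1,3) _ rel(2,4) by (rule C.Hom_vw) (intro comm w_closed)
    ultimately show ?thesis using universal[OF C(1)] tp by blast
  qed
  moreover have "\<exists>\<epsilon>\<in>star_hom U complex_alg. \<forall>i<n. \<forall>j<n. \<epsilon> (w i j) = (if i = j then 1 else 0)"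
    by (rule universal_any[OF cstar_algebra_complex_alg magic_unitary_identity Hom_identity[OF Hom_in_mats[OF T]]])
      blast
  moreover have "\<exists>\<sigma>\<in>star_hom U (opposite U). \<forall>i<n. \<forall>j<n. \<sigma> (w i j) = w j i"
    using universal[OF cstar_algebra_opposite[OF U] U.magic_unitary_opposite[OF magic] U.Hom_opposite[OF magic T]] .
  ultimately show ?thesis
    unfolding quantum_permutation_algebra_def using U magic gen is_enveloping_star_gen by blast
qed

end

section \<open>Intertwiners of a Hopf image\<close>

theorem Hom_hopf_image:
  fixes S :: "'s cstar_alg" and B :: "'b cstar_alg" and A :: "'a cstar_alg"
  assumes S: "is_universal_magic n S s" and B: "cstar_algebra B" and \<pi>: "\<pi> \<in> star_hom S B"
    and A: "is_hopf_image n S s B \<pi> A u"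
  shows "Hom A n u k l = Hom B n (\<lambda>i j. \<pi> (s i j)) k l"
proof -
  have S': "cstar_algebra S" "magic_unitary S n s" "cstar_gen S (entries n s) = carrier S"
    using S unfolding is_universal_magic_def by blast+
  have qpa: "quantum_permutation_algebra n A u" and factors: "factors_through n S s B \<pi> A u"
    and least: "\<And>(A' :: univ cstar_alg) u'. quantum_permutation_algebra n A' u' \<Longrightarrow>
      factors_through n S s B \<pi> A' u' \<Longrightarrow>
      \<exists>\<theta>\<in>star_hom A' A. \<theta> ` carrier A' = carrier A \<and> (\<forall>i<n. \<forall>j<n. \<theta> (u' i j) = u i j)"
    using A unfolding is_hopf_image_def by simp_all
  have A': "cstar_algebra A" "magic_unitary A n u"
    using qpa unfolding quantum_permutation_algebra_def by simp_all
  interpret S: cstar_algebra S by (rule S')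
  interpret A: cstar_algebra A by (rule A')
  interpret B: cstar_algebra B by (rule B)
  interpret \<pi>: star_algebra_hom S B \<pi> by unfold_locales (rule \<pi>)
  note s_closed = magic_unitaryD(1)[OF S'(2)] and u_closed = magic_unitaryD(1)[OF A'(2)]
  show ?thesis
  proof (intro equalityI subsetI)
    fix T assume T: "T \<in> Hom A n u k l"
    obtain \<phi> \<rho> where \<phi>: "\<phi> \<in> star_hom S A" and \<rho>: "\<rho> \<in> star_hom A B"
      and \<phi>s: "\<forall>i<n. \<forall>j<n. \<phi> (s i j) = u i j" and \<rho>\<phi>: "\<forall>x\<in>carrier S. \<rho> (\<phi> x) = \<pi> x"
      using factors unfolding factors_through_def by blast
    interpret \<rho>: star_algebra_hom A B \<rho> by unfold_locales (rule \<rho>)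
    have "\<pi> (s i j) = \<rho> (u i j)" if "i < n" "j < n" for i j
      using \<phi>s[rule_format, OF that] \<rho>\<phi>[rule_format, OF s_closed[OF that]] by simp
    then have "Hom B n (\<lambda>i j. \<pi> (s i j)) k l = Hom B n (\<lambda>i j. \<rho> (u i j)) k l"
      using u_closed by (intro B.Hom_cong) auto
    then show "T \<in> Hom B n (\<lambda>i j. \<pi> (s i j)) k l"
      using \<rho>.Hom_image[OF u_closed T] by simp
  next
    fix T assume TB: "T \<in> Hom B n (\<lambda>i j. \<pi> (s i j)) k l"
    \<comment> \<open>\<open>U\<close> is built for this one \<open>T\<close>; its relation reaches
      \<open>A\<close> through the homomorphism that minimality provides.\<close>
    obtain U w where "universal_intertwiner n k l T U w"
      by (rule exists_universal_intertwiner[OF Hom_in_mats[OF TB]])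
    then interpret universal_intertwiner n k l T U w .
    obtain \<rho> where \<rho>: "\<rho> \<in> star_hom U B" "\<And>i j. i < n \<Longrightarrow> j < n \<Longrightarrow> \<rho> (w i j) = \<pi> (s i j)"
      using universal_any[OF B \<pi>.magic_unitary_image[OF S'(2)] TB] by blast
    obtain \<phi> where \<phi>: "\<phi> \<in> star_hom S U" "\<forall>i<n. \<forall>j<n. \<phi> (s i j) = w i j"
      using S U magic unfolding is_universal_magic_def by blast
    have "\<rho> (\<phi> x) = \<pi> x" if "x \<in> carrier S" for x
    proof (rule star_hom_eq_on_cstar_gen[OF S'(1) B star_hom_comp[OF \<phi>(1) \<rho>(1)] \<pi>])
      show "entries n s \<subseteq> carrier S" using s_closed by (simp add: entries_subset_iff)
      show "x \<in> cstar_gen S (entries n s)" using S'(3) that by simp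
    qed (use \<phi>(2) \<rho>(2) in \<open>auto simp: entries_def\<close>)
    then have "factors_through n S s B \<pi> U w"
      unfolding factors_through_def using \<phi> \<rho>(1) by blast
    then obtain \<theta> where \<theta>: "\<theta> \<in> star_hom U A" "\<forall>i<n. \<forall>j<n. \<theta> (w i j) = u i j"
      using least[OF quantum_permutation_algebra] by blast
    have "Hom A n (\<lambda>i j. \<theta> (w i j)) k l = Hom A n u k l"
      using \<theta>(2) u_closed by (intro A.Hom_cong) auto
    then show "T \<in> Hom A n u k l"
      using hom_relations(2)[OF A.star_algebra_axioms \<theta>(1)] by simp
  qed
qed

section \<open>Operators on a finite-dimensional Hilbert space\<close>

text \<open>A fixed orthonormal basis reduces statements on operators to matrix entries. It will be
  row 0 of \<xi>; \<open>n = 0\<close> is allowed.\<close>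

locale finite_hilbert_space = hilbert_space scale ip
  for scale :: "complex \<Rightarrow> 'h::ab_group_add \<Rightarrow> 'h" and ip +
  fixes e :: "nat \<Rightarrow> 'h" and n :: nat
  assumes orthonormal: "q < n \<Longrightarrow> r < n \<Longrightarrow> ip (e q) (e r) = (if q = r then 1 else 0)"
    and spanning: "span (e ` {..<n}) = UNIV"
begin

section \<open>Scalar product, norm and expansion in the basis\<close>

lemma ip_zero_left [simp]: "ip 0 y = 0"
  using ip_add_left[of 0 0 y] by simp

lemma ip_zero_right [simp]: "ip x 0 = 0"
  using ip_cnj[of 0 x] by simp

lemma ip_add_right: "ip x (y + z) = ip x y + ip x z"
  using ip_cnj[of x "y + z"] ip_cnj[of x y] ip_cnj[of x z] ip_add_left[of y z x] by simp

lemma ip_scale_right: "ip x (scale c y) = cnj c * ip x y"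
  using ip_cnj[of x "scale c y"] ip_cnj[of x y] ip_scale_left[of c y x] by simp

lemma ip_minus_left: "ip (x - y) z = ip x z - ip y z"
  using ip_add_left[of "x - y" y z] by simp

lemma ip_minus_right: "ip x (y - z) = ip x y - ip x z"
  using ip_add_right[of x "y - z" z] by simp

lemma ip_sum_left: "ip (\<Sum>i\<in>I. f i) y = (\<Sum>i\<in>I. ip (f i) y)"
  by (induction I rule: infinite_finite_induct) (simp_all add: ip_add_left)

lemma ip_sum_right: "ip y (\<Sum>i\<in>I. f i) = (\<Sum>i\<in>I. ip y (f i))"
  by (induction I rule: infinite_finite_induct) (simp_all add: ip_add_right)

lemma ip_self_Reals: "ip x x = complex_of_real (Re (ip x x))"
  using ip_cnj[of x x] by (simp add: complex_eq_iff)

lemma ip_self_nonneg: "0 \<le> Re (ip x x)"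
  using ip_pos[of x] by (cases "x = 0") auto

lemma hnorm_nonneg [simp]: "0 \<le> hnorm ip x"
  using ip_self_nonneg by (simp add: hnorm_def)

lemma hnorm_square: "(hnorm ip x)\<^sup>2 = Re (ip x x)"
  using ip_self_nonneg by (simp add: hnorm_def)

lemma ip_self: "ip x x = complex_of_real ((hnorm ip x)\<^sup>2)"
  using ip_self_Reals by (simp only: hnorm_square)

lemma hnorm_eq_0_iff [simp]: "hnorm ip x = 0 \<longleftrightarrow> x = 0"
  using ip_pos[of x] by (cases "x = 0") (simp_all add: hnorm_def)

lemma hnorm_zero [simp]: "hnorm ip 0 = 0"
  by simp

lemma hnorm_scale: "hnorm ip (scale c x) = cmod c * hnorm ip x"
proof -
  have "ip (scale c x) (scale c x) = complex_of_real ((cmod c)\<^sup>2) * ip x x"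
    by (simp add: ip_scale_left ip_scale_right complex_norm_square mult_ac del: of_real_power)
  then have "Re (ip (scale c x) (scale c x)) = (cmod c)\<^sup>2 * Re (ip x x)"
    by (simp only: Re_complex_of_real times_complex.sel Im_complex_of_real)
  then show ?thesis by (simp add: hnorm_def real_sqrt_mult)
qed

lemma cauchy_schwarz: "cmod (ip x y) \<le> hnorm ip x * hnorm ip y"
proof (cases "y = 0")
  case False
  define N where "N = (hnorm ip y)\<^sup>2"
  have N: "N > 0" using False by (simp add: N_def zero_less_power2)
  \<comment> \<open>\<open>scale c y\<close> is the orthogonal projection of \<open>x\<close> onto
    the line of \<open>y\<close>; the inequality says that the remainder has nonnegative square
    norm.\<close>
  define c where "c = ip x y / complex_of_real N"
  have yy: "ip y y = complex_of_real N" by (simp add: N_def ip_self)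
  have yx: "ip y x = cnj (ip x y)" by (rule ip_cnj)
  have "ip (x - scale c y) (x - scale c y) = ip x x - ip x y * cnj (ip x y) / complex_of_real N"
    using N by (simp add: ip_minus_left ip_minus_right ip_scale_left ip_scale_right yy yx c_def field_simps)
  also have "\<dots> = complex_of_real ((hnorm ip x)\<^sup>2 - (cmod (ip x y))\<^sup>2 / N)"
    by (simp add: ip_self[of x] flip: complex_norm_square)
  finally have "0 \<le> (hnorm ip x)\<^sup>2 - (cmod (ip x y))\<^sup>2 / N"
    using ip_self_nonneg[of "x - scale c y"] by (simp only: Re_complex_of_real)
  then have "(cmod (ip x y))\<^sup>2 \<le> (hnorm ip x * hnorm ip y)\<^sup>2"
    using N by (simp add: field_simps power_mult_distrib N_def[symmetric])
  then show ?thesis by (rule power2_le_imp_le) simp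
qed simp

lemma hnorm_triangle: "hnorm ip (x + y) \<le> hnorm ip x + hnorm ip y"
proof (rule power2_le_imp_le)
  have "Re (ip x y) \<le> hnorm ip x * hnorm ip y"
    using cauchy_schwarz[of x y] complex_Re_le_cmod[of "ip x y"] by linarith
  moreover have "Re (ip y x) = Re (ip x y)" using ip_cnj[of y x] by simp
  ultimately show "(hnorm ip (x + y))\<^sup>2 \<le> (hnorm ip x + hnorm ip y)\<^sup>2"
    by (simp add: hnorm_square ip_add_left ip_add_right power2_sum)
qed simp

lemma hnorm_sum: "hnorm ip (\<Sum>i\<in>I. f i) \<le> (\<Sum>i\<in>I. hnorm ip (f i))"
proof (induction I rule: infinite_finite_induct)
  case (insert i I)
  then show ?case using hnorm_triangle[of "f i" "\<Sum>i\<in>I. f i"] by simp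
qed simp_all

lemma hnorm_basis: "q < n \<Longrightarrow> hnorm ip (e q) = 1"
  by (simp add: hnorm_def orthonormal)

lemma expansion: "x = (\<Sum>q<n. scale (ip x (e q)) (e q))"
proof -
  have "x \<in> span (e ` {..<n})" using spanning by simp
  then show ?thesis
  proof (induction x rule: span_induct_alt)
    case base
    show ?case by simp
  next
    case (step c x y)
    then obtain r where r: "r < n" "x = e r" by auto
    have "(\<Sum>q<n. scale (ip (scale c x + y) (e q)) (e q)) =
        (\<Sum>q<n. scale (if q = r then c else 0) (e q) + scale (ip y (e q)) (e q))"
      using r by (intro sum.cong) (auto simp: ip_add_left ip_scale_left orthonormal scale_left_distrib)
    also have "\<dots> = (\<Sum>q<n. scale (if q = r then c else 0) (e q)) + (\<Sum>q<n. scale (ip y (e q)) (e q))"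
      by (rule sum.distrib)
    also have "(\<Sum>q<n. scale (if q = r then c else 0) (e q)) = scale c x"
      using r by (simp add: if_distrib if_distribR sum.delta cong: if_cong)
    finally show ?case using step by simp
  qed
qed

lemma ip_eqI: assumes "\<And>q. q < n \<Longrightarrow> ip x (e q) = ip y (e q)" shows "x = y"
  by (subst expansion[of x], subst expansion[of y]) (simp add: assms)

section \<open>Linear operators and their adjoints\<close>

abbreviation "L \<equiv> bounded_ops scale ip"

definition op_linear :: "('h \<Rightarrow> 'h) \<Rightarrow> bool" where
  "op_linear T \<longleftrightarrow> (\<forall>x y. T (x + y) = T x + T y) \<and> (\<forall>c x. T (scale c x) = scale c (T x))"

lemma op_linearD: "op_linear T \<Longrightarrow> T (x + y) = T x + T y" "op_linear T \<Longrightarrow> T (scale c x) = scale c (T x)"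
  by (simp_all add: op_linear_def)

lemma op_linear_sum: "op_linear T \<Longrightarrow> T (\<Sum>i\<in>I. f i) = (\<Sum>i\<in>I. T (f i))"
proof (induction I rule: infinite_finite_induct)
  case (infinite A)
  then show ?case using op_linearD(2)[of T 0 0] by simp
next
  case empty
  then show ?case using op_linearD(2)[of T 0 0] by simp
qed (simp add: op_linearD)

lemma op_linear_expansion: "op_linear T \<Longrightarrow> T x = (\<Sum>q<n. scale (ip x (e q)) (T (e q)))"
  by (subst (1) expansion[of x]) (simp add: op_linear_sum op_linearD)

lemma op_linear_bounded:
  assumes "op_linear T" shows "hnorm ip (T x) \<le> (\<Sum>q<n. hnorm ip (T (e q))) * hnorm ip x"
proof -
  have "hnorm ip (T x) \<le> (\<Sum>q<n. cmod (ip x (e q)) * hnorm ip (T (e q)))"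
    unfolding op_linear_expansion[OF assms, of x] by (rule order.trans[OF hnorm_sum]) (simp add: hnorm_scale)
  also have "\<dots> \<le> (\<Sum>q<n. hnorm ip x * hnorm ip (T (e q)))"
  proof (intro sum_mono mult_right_mono)
    show "cmod (ip x (e q)) \<le> hnorm ip x" if "q \<in> {..<n}" for q
      using cauchy_schwarz[of x "e q"] hnorm_basis[of q] that by simp
  qed simp
  finally show ?thesis by (simp add: sum_distrib_left mult.commute)
qed

text \<open>Finite dimension makes boundedness automatic: the norms of the images of the basis
  vectors add up to a bound.\<close>

lemma carrier_L: "carrier L = Collect op_linear"
proof -
  have "\<exists>c. \<forall>x. hnorm ip (T x) \<le> c * hnorm ip x" if "op_linear T" for T
    using op_linear_bounded[OF that] by blast
  then show ?thesis
    using vector_space_axioms by (auto simp: bounded_ops_def op_linear_def Vector_Spaces.linear_iff)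
qed

lemma L_simps [simp]:
  "\<one>\<^bsub>L\<^esub> x = x" "\<zero>\<^bsub>L\<^esub> x = 0" "(S \<otimes>\<^bsub>L\<^esub> T) x = S (T x)" "(S \<oplus>\<^bsub>L\<^esub> T) x = S x + T x" "(c \<odot>\<^bsub>L\<^esub> T) x = scale c (T x)"
  by (simp_all add: bounded_ops_def)

definition adj :: "('h \<Rightarrow> 'h) \<Rightarrow> 'h \<Rightarrow> 'h" where
  "adj T y = (\<Sum>q<n. scale (ip y (T (e q))) (e q))"

lemma ip_adj: assumes "op_linear T" shows "ip (T x) y = ip x (adj T y)"
proof -
  have "ip (T x) y = (\<Sum>q<n. ip x (e q) * ip (T (e q)) y)"
    by (subst op_linear_expansion[OF assms, of x]) (simp add: ip_sum_left ip_scale_left)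
  also have "\<dots> = ip x (adj T y)"
    using ip_cnj[of "T _" y] by (simp add: adj_def ip_sum_right ip_scale_right mult.commute)
  finally show ?thesis .
qed

text \<open>The adjoint is a definite description over all functions. Scalar products with the basis
  determine a vector, so any candidate with the adjoint property is the described one.\<close>

lemma star_eqI: assumes "\<And>x y. ip (T x) y = ip x (S y)" shows "star L T = S"
proof -
  have "(THE S. \<forall>x y. ip (T x) y = ip x (S y)) = S"
  proof (rule the_equality)
    fix S' assume S': "\<forall>x y. ip (T x) y = ip x (S' y)"
    show "S' = S"
    proof
      fix y show "S' y = S y"
      proof (rule ip_eqI)
        fix q
        have "ip (e q) (S' y) = ip (e q) (S y)" using S' assms by metis
        then show "ip (S' y) (e q) = ip (S y) (e q)" using ip_cnj by metis
      qed
    qed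
  qed (use assms in blast)
  then show ?thesis by (simp add: bounded_ops_def)
qed

lemma star_L: "op_linear T \<Longrightarrow> star L T = adj T"
  by (rule star_eqI) (rule ip_adj)

lemma ip_star: "op_linear T \<Longrightarrow> ip (T x) y = ip x (star L T y)"
  by (simp add: star_L ip_adj)

lemma ip_star': assumes "op_linear T" shows "ip (star L T x) y = ip x (T y)"
  using ip_star[OF assms, of y x] ip_cnj by metis

lemma op_linear_star: "op_linear T \<Longrightarrow> op_linear (star L T)"
  by (simp add: star_L op_linear_def adj_def ip_add_left ip_scale_left scale_left_distrib sum.distrib
      scale_sum_right)

lemma star_algebra_L: "star_algebra L"
proof (rule star_algebraI; (unfold carrier_L mem_Collect_eq)?)
  fix S T :: "'h \<Rightarrow> 'h" and c d assume T: "op_linear T"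
  show "op_linear (star L T)" using T by (rule op_linear_star)
  show "star L (star L T) = T" using ip_star'[OF T] by (rule star_eqI)
  show "star L (c \<odot>\<^bsub>L\<^esub> T) = cnj c \<odot>\<^bsub>L\<^esub> star L T"
    using ip_star[OF T] by (intro star_eqI) (simp add: ip_scale_left ip_scale_right)
  assume S: "op_linear S"
  show "star L (S \<otimes>\<^bsub>L\<^esub> T) = star L T \<otimes>\<^bsub>L\<^esub> star L S"
    using ip_star[OF T] ip_star[OF S] by (intro star_eqI) simp
  show "star L (S \<oplus>\<^bsub>L\<^esub> T) = star L S \<oplus>\<^bsub>L\<^esub> star L T"
    using ip_star[OF T] ip_star[OF S] by (intro star_eqI) (simp add: ip_add_left ip_add_right)
qed (auto simp: fun_eq_iff op_linear_def scale_left_distrib scale_right_distrib mult.commute)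

lemma minus_L: "op_linear T \<Longrightarrow> (S \<ominus>\<^bsub>L\<^esub> T) x = S x - T x"
  by (simp add: star_algebra.minus_eq_smult[OF star_algebra_L] carrier_L)

lemma finsum_L:
  assumes "finite I" "\<And>i. i \<in> I \<Longrightarrow> op_linear (f i)"
  shows "finsum L f I x = (\<Sum>i\<in>I. f i x)"
proof -
  interpret star_algebra L by (rule star_algebra_L)
  show ?thesis using assms
  proof (induction set: finite)
    case (insert a I)
    then have "f \<in> I \<rightarrow> carrier L" "f a \<in> carrier L" by (auto simp: carrier_L)
    then show ?case using insert by simp
  qed simp
qed

section \<open>The operator norm and the C*-algebra of operators\<close>

lemma nrm_bdd:
  assumes "op_linear T" shows "bdd_above ((\<lambda>x. hnorm ip (T x)) ` {x. hnorm ip x \<le> 1})"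
proof (rule bdd_aboveI2)
  fix x assume "x \<in> {x. hnorm ip x \<le> 1}"
  then have "(\<Sum>q<n. hnorm ip (T (e q))) * hnorm ip x \<le> (\<Sum>q<n. hnorm ip (T (e q))) * 1"
    by (intro mult_left_mono sum_nonneg) auto
  then show "hnorm ip (T x) \<le> (\<Sum>q<n. hnorm ip (T (e q)))"
    using op_linear_bounded[OF assms, of x] by simp
qed

lemma nrm_L: "nrm L T = (SUP x\<in>{x. hnorm ip x \<le> 1}. hnorm ip (T x))"
  by (simp add: bounded_ops_def)

lemma nrm_L_nonneg: assumes "op_linear T" shows "0 \<le> nrm L T"
proof -
  have "hnorm ip (T 0) \<le> nrm L T"
    unfolding nrm_L using assms by (intro cSUP_upper nrm_bdd) (simp add: hnorm_def)
  then show ?thesis using hnorm_nonneg order.trans by blast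
qed

lemma nrm_L_le:
  assumes "0 \<le> c" "\<And>x. hnorm ip (T x) \<le> c * hnorm ip x" shows "nrm L T \<le> c"
  unfolding nrm_L
proof (rule cSUP_least)
  fix x assume "x \<in> {x. hnorm ip x \<le> 1}"
  then have "c * hnorm ip x \<le> c * 1" using assms by (intro mult_left_mono) auto
  then show "hnorm ip (T x) \<le> c" using assms(2)[of x] by simp
qed (auto intro!: exI[of _ 0] simp: hnorm_def)

lemma hnorm_le_nrm_L:
  assumes T: "op_linear T" shows "hnorm ip (T x) \<le> nrm L T * hnorm ip x"
proof (cases "x = 0")
  case False
  let ?c = "complex_of_real (1 / hnorm ip x)"
  have pos: "hnorm ip x > 0" using False hnorm_nonneg[of x] hnorm_eq_0_iff[of x] by linarith
  have "hnorm ip (T (scale ?c x)) \<le> nrm L T"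
    unfolding nrm_L using T pos by (intro cSUP_upper nrm_bdd) (auto simp: hnorm_scale norm_divide)
  then show ?thesis using pos by (simp add: op_linearD[OF T] hnorm_scale norm_divide field_simps)
next
  case True
  then show ?thesis using op_linearD(2)[OF T, of 0 0] by (simp add: hnorm_def)
qed

text \<open>The square norm of the adjoint at \<open>y\<close> is a scalar product with
  \<open>y\<close>; Cauchy-Schwarz bounds it, and one factor cancels.\<close>

lemma nrm_L_star_le: assumes T: "op_linear T" shows "nrm L (star L T) \<le> nrm L T"
proof (rule nrm_L_le)
  fix y
  let ?z = "star L T y"
  have "(hnorm ip ?z)\<^sup>2 = Re (ip (T ?z) y)"
    by (simp add: hnorm_square ip_star[OF T])
  also have "\<dots> \<le> hnorm ip (T ?z) * hnorm ip y"
    using cauchy_schwarz complex_Re_le_cmod order.trans by blast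
  also have "\<dots> \<le> nrm L T * hnorm ip ?z * hnorm ip y"
    by (intro mult_right_mono hnorm_le_nrm_L T) simp
  finally have "hnorm ip ?z * hnorm ip ?z \<le> hnorm ip ?z * (nrm L T * hnorm ip y)"
    by (simp add: power2_eq_square mult_ac)
  then show "hnorm ip ?z \<le> nrm L T * hnorm ip y"
    using hnorm_nonneg[of ?z] nrm_L_nonneg[OF T] by (cases "hnorm ip ?z = 0") auto
qed (rule nrm_L_nonneg[OF T])

lemma nrm_L_mult:
  assumes S: "op_linear S" and T: "op_linear T" shows "nrm L (S \<otimes>\<^bsub>L\<^esub> T) \<le> nrm L S * nrm L T"
proof (rule nrm_L_le)
  fix x
  have "hnorm ip (S (T x)) \<le> nrm L S * hnorm ip (T x)" by (rule hnorm_le_nrm_L[OF S])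
  also have "\<dots> \<le> nrm L S * (nrm L T * hnorm ip x)"
    by (intro mult_left_mono hnorm_le_nrm_L T nrm_L_nonneg S)
  finally show "hnorm ip ((S \<otimes>\<^bsub>L\<^esub> T) x) \<le> nrm L S * nrm L T * hnorm ip x" by (simp add: mult.assoc)
qed (simp add: nrm_L_nonneg S T)

text \<open>With \<open>entry_le_nrm_L\<close> this makes convergence in operator norm equivalent to
  convergence of the finitely many matrix entries, from which completeness follows.\<close>

lemma nrm_L_le_entries:
  assumes T: "op_linear T" shows "nrm L T \<le> (\<Sum>q<n. \<Sum>r<n. cmod (ip (T (e q)) (e r)))"
proof (rule nrm_L_le)
  fix x
  have "hnorm ip (T (e q)) \<le> (\<Sum>r<n. cmod (ip (T (e q)) (e r)))" for q
    by (subst expansion, rule order.trans[OF hnorm_sum]) (simp add: hnorm_scale hnorm_basis)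
  then have "(\<Sum>q<n. hnorm ip (T (e q))) * hnorm ip x \<le> (\<Sum>q<n. \<Sum>r<n. cmod (ip (T (e q)) (e r))) * hnorm ip x"
    by (intro mult_right_mono sum_mono) auto
  then show "hnorm ip (T x) \<le> (\<Sum>q<n. \<Sum>r<n. cmod (ip (T (e q)) (e r))) * hnorm ip x"
    using op_linear_bounded[OF T, of x] by linarith
qed (intro sum_nonneg norm_ge_zero)

lemma entry_le_nrm_L:
  assumes T: "op_linear T" "q < n" "r < n" shows "cmod (ip (T (e q)) (e r)) \<le> nrm L T"
  using cauchy_schwarz[of "T (e q)" "e r"] hnorm_le_nrm_L[OF T(1), of "e q"] T by (simp add: hnorm_basis)

lemma complete_L:
  assumes X: "\<And>p. op_linear (X p)"
    and cauchy: "\<forall>\<epsilon>>0. \<exists>N. \<forall>p\<ge>N. \<forall>q\<ge>N. nrm L (X p \<ominus>\<^bsub>L\<^esub> X q) < \<epsilon>"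
  shows "\<exists>T. op_linear T \<and> (\<lambda>p. nrm L (X p \<ominus>\<^bsub>L\<^esub> T)) \<longlonglongrightarrow> 0"
proof -
  interpret star_algebra L by (rule star_algebra_L)
  have lin: "op_linear (X p \<ominus>\<^bsub>L\<^esub> T)" if "op_linear T" for p T
    using minus_closed[of "X p" T] X that by (simp add: carrier_L)
  have "\<exists>m. (\<lambda>p. ip (X p (e q)) (e r)) \<longlonglongrightarrow> m" if qr: "q < n" "r < n" for q r
  proof -
    have "Cauchy (\<lambda>p. ip (X p (e q)) (e r))"
    proof (rule metric_CauchyI)
      fix \<epsilon> :: real assume "\<epsilon> > 0"
      then obtain N where N: "\<forall>p\<ge>N. \<forall>q\<ge>N. nrm L (X p \<ominus>\<^bsub>L\<^esub> X q) < \<epsilon>" using cauchy by blast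
      have "dist (ip (X p (e q)) (e r)) (ip (X p' (e q)) (e r)) < \<epsilon>" if "p \<ge> N" "p' \<ge> N" for p p'
        using entry_le_nrm_L[OF lin[OF X[of p'], of p] qr] N[rule_format, OF that]
        by (simp add: minus_L X ip_minus_left dist_norm)
      then show "\<exists>N. \<forall>p\<ge>N. \<forall>p'\<ge>N. dist (ip (X p (e q)) (e r)) (ip (X p' (e q)) (e r)) < \<epsilon>" by blast
    qed
    then show ?thesis using Cauchy_convergent_iff convergent_def by blast
  qed
  then obtain m where m: "\<And>q r. q < n \<Longrightarrow> r < n \<Longrightarrow> (\<lambda>p. ip (X p (e q)) (e r)) \<longlonglongrightarrow> m q r" by metis
  \<comment> \<open>The operator whose matrix consists of the limits of the entries.\<close>
  define T where "T x = (\<Sum>q<n. scale (ip x (e q)) (\<Sum>r<n. scale (m q r) (e r)))" for x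
  have T: "op_linear T"
    by (simp add: T_def op_linear_def ip_add_left ip_scale_left scale_left_distrib sum.distrib
        scale_sum_right distrib_right mult.assoc)
  have Te: "ip (T (e q)) (e r) = m q r" if "q < n" "r < n" for q r
    using that by (simp add: T_def ip_sum_left ip_scale_left orthonormal if_distrib if_distribR sum.delta
        cong: if_cong)
  have "(\<lambda>p. nrm L (X p \<ominus>\<^bsub>L\<^esub> T)) \<longlonglongrightarrow> 0"
  proof (rule real_tendsto_sandwich[OF _ _ tendsto_const])
    have "(\<lambda>p. \<Sum>q<n. \<Sum>r<n. cmod (ip (X p (e q)) (e r) - m q r)) \<longlonglongrightarrow> (\<Sum>q<n. \<Sum>r<n. 0)"
      by (intro tendsto_sum tendsto_norm_zero LIM_zero m) auto
    then show "(\<lambda>p. \<Sum>q<n. \<Sum>r<n. cmod (ip (X p (e q)) (e r) - m q r)) \<longlonglongrightarrow> 0" by simp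
    have "nrm L (X p \<ominus>\<^bsub>L\<^esub> T) \<le> (\<Sum>q<n. \<Sum>r<n. cmod (ip (X p (e q)) (e r) - m q r))" for p
      using nrm_L_le_entries[OF lin[OF T, of p]] by (simp add: minus_L T ip_minus_left Te)
    then show "eventually (\<lambda>p. nrm L (X p \<ominus>\<^bsub>L\<^esub> T) \<le> (\<Sum>q<n. \<Sum>r<n. cmod (ip (X p (e q)) (e r) - m q r))) sequentially"
      by simp
    show "eventually (\<lambda>p. 0 \<le> nrm L (X p \<ominus>\<^bsub>L\<^esub> T)) sequentially"
      using nrm_L_nonneg[OF lin[OF T]] by simp
  qed
  with T show ?thesis by blast
qed

lemma cstar_algebra_L: "cstar_algebra L"
proof (intro cstar_algebra.intro cstar_algebra_axioms.intro star_algebra_L)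
  interpret star_algebra L by (rule star_algebra_L)
  fix S T :: "'h \<Rightarrow> 'h" and c assume "S \<in> carrier L"
  then have S: "op_linear S" by (simp add: carrier_L)
  show "nrm L S = 0 \<longleftrightarrow> S = \<zero>\<^bsub>L\<^esub>"
  proof
    assume "nrm L S = 0"
    then have "hnorm ip (S x) = 0" for x
      using hnorm_le_nrm_L[OF S, of x] hnorm_nonneg[of "S x"] by simp
    then show "S = \<zero>\<^bsub>L\<^esub>" by (simp add: fun_eq_iff)
  next
    assume "S = \<zero>\<^bsub>L\<^esub>"
    then have "nrm L S \<le> 0" by (intro nrm_L_le) (auto simp: hnorm_def)
    then show "nrm L S = 0" using nrm_L_nonneg[OF S] by simp
  qed
  have le: "nrm L (c \<odot>\<^bsub>L\<^esub> S) \<le> cmod c * nrm L S" if "op_linear S" for c S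
    using hnorm_le_nrm_L[OF that] nrm_L_nonneg[OF that]
    by (intro nrm_L_le) (auto simp: hnorm_scale mult.assoc intro!: mult_left_mono)
  show "nrm L (c \<odot>\<^bsub>L\<^esub> S) = cmod c * nrm L S"
  proof (rule antisym)
    have cS: "op_linear (c \<odot>\<^bsub>L\<^esub> S)" using smult_closed[of S c] S by (simp add: carrier_L)
    show "cmod c * nrm L S \<le> nrm L (c \<odot>\<^bsub>L\<^esub> S)"
    proof (cases "c = 0")
      case True
      then show ?thesis using nrm_L_nonneg[OF cS] by simp
    next
      case False
      then have "(1 / c) \<odot>\<^bsub>L\<^esub> (c \<odot>\<^bsub>L\<^esub> S) = S" using S by (simp add: smult_smult carrier_L)
      then show ?thesis using le[OF cS, of "1 / c"] False by (simp add: norm_divide field_simps)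
    qed
  qed (rule le[OF S])
  show "nrm L (star L S \<otimes>\<^bsub>L\<^esub> S) = (nrm L S)\<^sup>2"
  proof (rule antisym)
    have "nrm L (star L S \<otimes>\<^bsub>L\<^esub> S) \<le> nrm L (star L S) * nrm L S"
      by (intro nrm_L_mult op_linear_star S)
    also have "\<dots> \<le> nrm L S * nrm L S" by (intro mult_right_mono nrm_L_star_le nrm_L_nonneg S)
    finally show "nrm L (star L S \<otimes>\<^bsub>L\<^esub> S) \<le> (nrm L S)\<^sup>2" by (simp add: power2_eq_square)
    have SS: "op_linear (star L S \<otimes>\<^bsub>L\<^esub> S)"
      using m_closed[of "star L S" S] S op_linear_star[OF S] by (simp add: carrier_L)
    have "nrm L S \<le> sqrt (nrm L (star L S \<otimes>\<^bsub>L\<^esub> S))"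
    proof (rule nrm_L_le)
      fix x
      have "(hnorm ip (S x))\<^sup>2 = Re (ip x ((star L S \<otimes>\<^bsub>L\<^esub> S) x))"
        by (simp add: hnorm_square ip_star[OF S])
      also have "\<dots> \<le> hnorm ip x * hnorm ip ((star L S \<otimes>\<^bsub>L\<^esub> S) x)"
        using cauchy_schwarz complex_Re_le_cmod order.trans by blast
      also have "\<dots> \<le> hnorm ip x * (nrm L (star L S \<otimes>\<^bsub>L\<^esub> S) * hnorm ip x)"
        by (intro mult_left_mono hnorm_le_nrm_L SS hnorm_nonneg)
      also have "\<dots> = (sqrt (nrm L (star L S \<otimes>\<^bsub>L\<^esub> S)) * hnorm ip x)\<^sup>2"
        using nrm_L_nonneg[OF SS] by (simp add: power_mult_distrib) (simp add: power2_eq_square)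
      finally show "hnorm ip (S x) \<le> sqrt (nrm L (star L S \<otimes>\<^bsub>L\<^esub> S)) * hnorm ip x"
        by (rule power2_le_imp_le) (simp add: nrm_L_nonneg[OF SS])
    qed (simp add: nrm_L_nonneg[OF SS])
    then show "(nrm L S)\<^sup>2 \<le> nrm L (star L S \<otimes>\<^bsub>L\<^esub> S)"
      using nrm_L_nonneg[OF S] nrm_L_nonneg[OF SS] by (metis power_mono real_sqrt_pow2)
  qed
  assume "T \<in> carrier L"
  then have T: "op_linear T" by (simp add: carrier_L)
  show "nrm L (S \<otimes>\<^bsub>L\<^esub> T) \<le> nrm L S * nrm L T" using S T by (rule nrm_L_mult)
  show "nrm L (S \<oplus>\<^bsub>L\<^esub> T) \<le> nrm L S + nrm L T"
  proof (rule nrm_L_le)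
    show "hnorm ip ((S \<oplus>\<^bsub>L\<^esub> T) x) \<le> (nrm L S + nrm L T) * hnorm ip x" for x
      using hnorm_triangle[of "S x" "T x"] hnorm_le_nrm_L[OF S, of x] hnorm_le_nrm_L[OF T, of x]
      by (simp add: distrib_right)
  qed (simp add: nrm_L_nonneg S T)
next
  fix X :: "nat \<Rightarrow> 'h \<Rightarrow> 'h"
  assume X: "range X \<subseteq> carrier L" "\<forall>\<epsilon>>0. \<exists>N. \<forall>p\<ge>N. \<forall>q\<ge>N. nrm L (X p \<ominus>\<^bsub>L\<^esub> X q) < \<epsilon>"
  then have "op_linear (X p)" for p by (auto simp: carrier_L)
  then show "\<exists>T\<in>carrier L. (\<lambda>p. nrm L (X p \<ominus>\<^bsub>L\<^esub> T)) \<longlonglongrightarrow> 0"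
    using complete_L[OF _ X(2)] by (auto simp: carrier_L)
qed

lemma op_eqI:
  assumes "op_linear S" "op_linear T" "\<And>q r. q < n \<Longrightarrow> r < n \<Longrightarrow> ip (S (e q)) (e r) = ip (T (e q)) (e r)"
  shows "S = T"
proof
  fix x
  have "S (e q) = T (e q)" if "q < n" for q using assms(3)[OF that] by (rule ip_eqI)
  then show "S x = T x"
    by (simp add: op_linear_expansion[OF assms(1), of x] op_linear_expansion[OF assms(2), of x])
qed

text \<open>A unit vector lets the projection be written with no division by \<open>ip v v\<close>;
  the normalisation of \<xi> enters through this formula.\<close>

lemma orthogonal_projection_line:
  assumes "ip v v = 1"
  shows "orthogonal_projection ip (span {v}) = (\<lambda>x. scale (ip x v) v)"
proof
  fix x
  show "orthogonal_projection ip (span {v}) x = scale (ip x v) v"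
    unfolding orthogonal_projection_def
  proof (rule the_equality)
    show "scale (ip x v) v \<in> span {v} \<and> (\<forall>w\<in>span {v}. ip (x - scale (ip x v) v) w = 0)"
      using assms by (auto simp: span_singleton ip_minus_left ip_scale_left ip_scale_right)
    fix y assume y: "y \<in> span {v} \<and> (\<forall>w\<in>span {v}. ip (x - y) w = 0)"
    then obtain c where "y = scale c v" by (auto simp: span_singleton)
    moreover have "v \<in> span {v}" by (rule span_base) simp
    then have "ip (x - y) v = 0" using y by blast
    ultimately show "y = scale (ip x v) v" using assms by (simp add: ip_minus_left ip_scale_left)
  qed
qed

end

section \<open>Gram matrices\<close>

text \<open>The first and last letters are split off because these are the ones on which
  \<open>circ l k T\<close> acts as the identity.\<close>

lemma idx_add_2_iff: "z \<in> idx n (k + 2) \<longleftrightarrow> (\<exists>r c p. z = r # c @ [p] \<and> r < n \<and> c \<in> idx n k \<and> p < n)"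
proof
  assume z: "z \<in> idx n (k + 2)"
  then obtain r z' where "z = r # z'" "r < n" "z' \<in> idx n (Suc k)"
    by (auto elim!: idx_SucE)
  moreover from this(3) obtain c p where "z' = c @ [p]"
    by (cases z' rule: rev_cases) (auto simp: idx_def)
  ultimately show "\<exists>r c p. z = r # c @ [p] \<and> r < n \<and> c \<in> idx n k \<and> p < n"
    by (auto simp: idx_def)
qed (auto simp: idx_def)

lemma circ_eq:
  assumes "a \<in> idx n l" "c \<in> idx n k"
  shows "circ l k T (r # a @ [p]) (s # c @ [q]) = (if r = s \<and> p = q then T a c else 0)"
  using assms by (simp add: circ_def mat_tensor_def mat_id_def idx_def)

lemma mat_mult_circ_left:
  assumes "r < n" "a \<in> idx n l" "p < n"
  shows "mat_mult n (k + 2) (circ l k T) M (r # a @ [p]) y = (\<Sum>c\<in>idx n k. T a c * M (r # c @ [p]) y)"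
proof -
  have "mat_mult n (k + 2) (circ l k T) M (r # a @ [p]) y =
      (\<Sum>z\<in>(\<lambda>c. r # c @ [p]) ` idx n k. circ l k T (r # a @ [p]) z * M z y)"
    unfolding mat_mult_def using assms
    by (intro sum.mono_neutral_right) (auto simp: idx_add_2_iff circ_eq simp del: add_2_eq_Suc' split: if_splits)
  also have "\<dots> = (\<Sum>c\<in>idx n k. T a c * M (r # c @ [p]) y)"
    using assms by (subst sum.reindex) (auto simp: inj_on_def circ_eq)
  finally show ?thesis .
qed

lemma mat_mult_circ_right:
  assumes "s < n" "b \<in> idx n k" "q < n"
  shows "mat_mult n (l + 2) M (circ l k T) x (s # b @ [q]) = (\<Sum>c\<in>idx n l. M x (s # c @ [q]) * T c b)"
proof -
  have "mat_mult n (l + 2) M (circ l k T) x (s # b @ [q]) =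
      (\<Sum>z\<in>(\<lambda>c. s # c @ [q]) ` idx n l. M x z * circ l k T z (s # b @ [q]))"
    unfolding mat_mult_def using assms
    by (intro sum.mono_neutral_right) (auto simp: idx_add_2_iff circ_eq simp del: add_2_eq_Suc' split: if_splits)
  also have "\<dots> = (\<Sum>c\<in>idx n l. M x (s # c @ [q]) * T c b)"
    using assms by (subst sum.reindex) (auto simp: inj_on_def circ_eq)
  finally show ?thesis .
qed

text \<open>The factor split off is the one numbered 0 in the product; it pairs the two leading
  letters and lets inductions run from the front of the words.\<close>

lemma higher_gram_Cons:
  "higher_gram ip \<xi> (Suc (Suc m)) (r # i # a) (s # j # b) =
    gram ip \<xi> i r j s * higher_gram ip \<xi> (Suc m) (i # a) (j # b)"
  unfolding higher_gram_def by (simp add: prod.lessThan_Suc_shift del: prod.lessThan_Suc)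

context finite_hilbert_space
begin

context
  fixes \<xi> :: "nat \<Rightarrow> nat \<Rightarrow> 'h"
begin

abbreviation (input) "P \<equiv> (\<lambda>i j x. scale (ip x (\<xi> i j)) (\<xi> i j))"

lemma P_in_carrier: "P i j \<in> carrier L"
  by (simp add: carrier_L op_linear_def ip_add_left ip_scale_left scale_left_distrib)

text \<open>The outermost operator \<open>P i j\<close> contributes the factor
  \<open>ip (\<xi> i j) (\<xi> r s)\<close> and leaves the shorter word tested against
  \<open>\<xi> i j\<close>. Thus every projection becomes a new test vector, which is why
  \<open>r\<close> and \<open>s\<close> vary in the induction; the vectors on the two sides supply
  the first and last letters.\<close>

lemma ip_tensor_power_P:
  "a \<in> idx n k \<Longrightarrow> b \<in> idx n k \<Longrightarrow>
    ip (tensor_power L P a b (\<xi> p q)) (\<xi> r s) = higher_gram ip \<xi> (k + 2) (r # a @ [p]) (s # b @ [q])"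
proof (induction k arbitrary: a b r s)
  case 0
  then show ?case by (simp add: higher_gram_def gram_def)
next
  case (Suc k)
  then obtain i a' j b' where [simp]: "a = i # a'" "b = j # b'"
    and ab: "a' \<in> idx n k" "b' \<in> idx n k"
    by (auto elim!: idx_SucE)
  show ?case
    using Suc.IH[OF ab, of i j] by (simp add: ip_scale_left higher_gram_Cons gram_def)
qed

text \<open>For fixed \<open>a\<close> and \<open>b\<close> the intertwining relation is an identity
  of operators. Its coefficients between \<open>\<xi> p q\<close> and \<open>\<xi> r s\<close> are
  the entries of the two Gram products at words with outer letters \<open>r\<close>,
  \<open>p\<close> and \<open>s\<close>, \<open>q\<close>.\<close>

theorem Hom_P_eq:
  assumes basis: "\<And>q. q < n \<Longrightarrow> \<xi> 0 q = e q"
  shows "Hom L n P k l =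
    {T \<in> mats n l k. mat_eq n (l + 2) (k + 2)
       (mat_mult n (k + 2) (circ l k T) (higher_gram ip \<xi> (k + 2)))
       (mat_mult n (l + 2) (higher_gram ip \<xi> (l + 2)) (circ l k T))}"
proof -
  interpret star_algebra L by (rule star_algebra_L)
  note tp = tensor_power_closed[of n P, OF P_in_carrier]
  have "(\<Oplus>\<^bsub>L\<^esub>c\<in>idx n k. T a c \<odot>\<^bsub>L\<^esub> tensor_power L P c b) = (\<Oplus>\<^bsub>L\<^esub>c\<in>idx n l. T c b \<odot>\<^bsub>L\<^esub> tensor_power L P a c)
    \<longleftrightarrow> (\<forall>r<n. \<forall>p<n. \<forall>s<n. \<forall>q<n.
      mat_mult n (k + 2) (circ l k T) (higher_gram ip \<xi> (k + 2)) (r # a @ [p]) (s # b @ [q]) =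
      mat_mult n (l + 2) (higher_gram ip \<xi> (l + 2)) (circ l k T) (r # a @ [p]) (s # b @ [q]))"
    (is "?S = ?R \<longleftrightarrow> _") if ab: "a \<in> idx n l" "b \<in> idx n k" for T a b
  proof -
    have S: "ip (?S (\<xi> p q)) (\<xi> r s) =
        mat_mult n (k + 2) (circ l k T) (higher_gram ip \<xi> (k + 2)) (r # a @ [p]) (s # b @ [q])"
      if "r < n" "p < n" "s < n" "q < n" for r p s q
    proof -
      have "?S (\<xi> p q) = (\<Sum>c\<in>idx n k. (T a c \<odot>\<^bsub>L\<^esub> tensor_power L P c b) (\<xi> p q))"
        using tp[of _ k b] ab by (intro finsum_L) (auto simp: smult_closed simp flip: mem_Collect_eq[of _ op_linear] carrier_L)
      then show ?thesis
        using that ab by (simp add: mat_mult_circ_left ip_sum_left ip_scale_left ip_tensor_power_P[of _ k]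
            del: add_2_eq_Suc')
    qed
    have R: "ip (?R (\<xi> p q)) (\<xi> r s) =
        mat_mult n (l + 2) (higher_gram ip \<xi> (l + 2)) (circ l k T) (r # a @ [p]) (s # b @ [q])"
      if "r < n" "p < n" "s < n" "q < n" for r p s q
    proof -
      have "?R (\<xi> p q) = (\<Sum>c\<in>idx n l. (T c b \<odot>\<^bsub>L\<^esub> tensor_power L P a c) (\<xi> p q))"
        using tp[of a l] ab by (intro finsum_L) (auto simp: smult_closed simp flip: mem_Collect_eq[of _ op_linear] carrier_L)
      then show ?thesis
        using that ab
        by (simp add: mat_mult_circ_right ip_sum_left ip_scale_left ip_tensor_power_P[of _ l] mult.commute
            del: add_2_eq_Suc')
    qed
    have lin: "op_linear ?S" "op_linear ?R"
    proof -
      have "?S \<in> carrier L" "?R \<in> carrier L"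
        using tp[of _ k b] tp[of a l] ab by (auto intro!: finsum_closed smult_closed)
      then show "op_linear ?S" "op_linear ?R" by (simp_all add: carrier_L)
    qed
    show ?thesis
    proof
      assume "?S = ?R"
      then show "\<forall>r<n. \<forall>p<n. \<forall>s<n. \<forall>q<n.
          mat_mult n (k + 2) (circ l k T) (higher_gram ip \<xi> (k + 2)) (r # a @ [p]) (s # b @ [q]) =
          mat_mult n (l + 2) (higher_gram ip \<xi> (l + 2)) (circ l k T) (r # a @ [p]) (s # b @ [q])"
        using S R by (simp del: add_2_eq_Suc')
    next
      assume eq: "\<forall>r<n. \<forall>p<n. \<forall>s<n. \<forall>q<n.
          mat_mult n (k + 2) (circ l k T) (higher_gram ip \<xi> (k + 2)) (r # a @ [p]) (s # b @ [q]) =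
          mat_mult n (l + 2) (higher_gram ip \<xi> (l + 2)) (circ l k T) (r # a @ [p]) (s # b @ [q])"
      show "?S = ?R"
      proof (rule op_eqI[OF lin])
        \<comment> \<open>Only the words with \<open>r = p = 0\<close> are used: they give the
          coefficients in the basis formed by row 0, which determine an operator.\<close>
        fix q s assume qs: "q < n" "s < n"
        then have "0 < n" by simp
        with qs show "ip (?S (e q)) (e s) = ip (?R (e q)) (e s)"
          using S[of 0 0 s q] R[of 0 0 s q] eq by (simp flip: basis del: add_2_eq_Suc')
      qed
    qed
  qed
  then show ?thesis
    unfolding Hom_def mat_eq_def by (intro Collect_cong) (auto simp: idx_add_2_iff simp del: add_2_eq_Suc')
qed

end

end

theorem theorem4p6:
  fixes scale :: "complex \<Rightarrow> 'h::ab_group_add \<Rightarrow> 'h"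
    and ip :: "'h \<Rightarrow> 'h \<Rightarrow> complex"
    and n :: nat
    and \<xi> :: "nat \<Rightarrow> nat \<Rightarrow> 'h"
    and S :: "'s cstar_alg" and s :: "nat \<Rightarrow> nat \<Rightarrow> 's"
    and \<pi> :: "'s \<Rightarrow> 'h \<Rightarrow> 'h"
    and A :: "'a cstar_alg" and u :: "nat \<Rightarrow> nat \<Rightarrow> 'a"
  assumes "hilbert_space scale ip"
    and "has_dimension scale n"
    and "magic_basis scale ip n \<xi>"
    and unit: "\<forall>i<n. \<forall>j<n. hnorm ip (\<xi> i j) = 1"
    and "is_universal_magic n S s"
    and "\<pi> \<in> star_hom S (bounded_ops scale ip)"
    and "\<forall>i<n. \<forall>j<n. \<pi> (s i j) = orthogonal_projection ip (module.span scale {\<xi> i j})"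
    and "is_hopf_image n S s (bounded_ops scale ip) \<pi> A u"
  shows "\<forall>k l. Hom A n u k l =
    {T \<in> mats n l k. mat_eq n (l + 2) (k + 2)
       (mat_mult n (k + 2) (circ l k T) (higher_gram ip \<xi> (k + 2)))
       (mat_mult n (l + 2) (higher_gram ip \<xi> (l + 2)) (circ l k T))}"
proof (intro allI)
  fix k l
  interpret hilbert_space scale ip by fact
  have unit': "ip (\<xi> i j) (\<xi> i j) = 1" if "i < n" "j < n" for i j
    using unit that ip_cnj[of "\<xi> i j" "\<xi> i j"] by (simp add: hnorm_def complex_eq_iff)
  have row: "orthogonal_basis scale ip n (\<xi> 0)" if "0 < n"
    using \<open>magic_basis scale ip n \<xi>\<close> that unfolding magic_basis_def by blast
  have spanning: "span (\<xi> 0 ` {..<n}) = UNIV"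
  proof (cases "n = 0")
    \<comment> \<open>There is no row 0 to span the space here; the space is zero because its
      dimension is.\<close>
    case True
    then obtain B where "finite_dimensional_vector_space scale B" "card B = 0"
      using \<open>has_dimension scale n\<close> unfolding has_dimension_def by blast
    then have "span {} = (UNIV :: 'h set)"
      by (metis card_0_eq finite_dimensional_vector_space.finite_Basis
          finite_dimensional_vector_space.span_Basis)
    with True show ?thesis by simp
  qed (use row in \<open>auto simp: orthogonal_basis_def\<close>)
  interpret finite_hilbert_space scale ip "\<xi> 0" n
    by unfold_locales (use row unit' spanning in \<open>auto simp: orthogonal_basis_def\<close>)
  let ?P = "\<lambda>i j x. scale (ip x (\<xi> i j)) (\<xi> i j)"
  have "\<pi> (s i j) = ?P i j" if "i < n" "j < n" for i j
    using assms(7) that orthogonal_projection_line[OF unit'[OF that]] by simp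
  then have "Hom A n u k l = Hom L n ?P k l"
    using Hom_hopf_image[OF assms(5) cstar_algebra_L assms(6,8)]
      star_algebra.Hom_cong[OF star_algebra_L, of n "\<lambda>i j. \<pi> (s i j)" ?P] P_in_carrier by simp
  also have "\<dots> = {T \<in> mats n l k. mat_eq n (l + 2) (k + 2)
       (mat_mult n (k + 2) (circ l k T) (higher_gram ip \<xi> (k + 2)))
       (mat_mult n (l + 2) (higher_gram ip \<xi> (l + 2)) (circ l k T))}"
    by (rule Hom_P_eq) simp
  finally show "Hom A n u k l = {T \<in> mats n l k. mat_eq n (l + 2) (k + 2)
       (mat_mult n (k + 2) (circ l k T) (higher_gram ip \<xi> (k + 2)))
       (mat_mult n (l + 2) (higher_gram ip \<xi> (l + 2)) (circ l k T))}" .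
qed

end
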